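(* Let $M$ be a smooth manifold, $L$ a twisted Dirac structure on $M$ (with twist a closed 3-form $H$), and $N\subseteq M$ a closed and embedded submanifold, with blowdown map $p:\mathrm{Blup}(M,N)\to M$. There exists an open and dense subset $V\subseteq\mathbb{P}(\nu_N(M))$ such that the Dirac structure $p^*(L|_{M\setminus N})$ extends smoothly to a ($p^*H$-twisted) Dirac structure on $V\cup\big(\mathrm{Blup}(M,N)\setminus\mathbb{P}(\nu_N(M))\big)$.
   Context: Blowup. For a closed embedded submanifold $N\subseteq M$ with normal bundle $\nu_N(M)=TM|_N/TN$, the real projective blowup is, as a set, $\mathrm{Blup}(M,N)=(M\setminus N)\sqcup\mathbb{P}(\nu_N(M))$, where $\mathbb{P}(\nu_N(M))$ is the projectivised normal bundle. The blowdown map $p:\mathrm{Blup}(M,N)\to M$ is the identity on $M\setminus N$ and the bundle projection on $\mathbb{P}(\nu_N(M))\to N$. The smooth structure is determined by charts: for a submanifold chart $(U,(x,y))$ with $U\cap N=\{x=0\}$ and $1\le i\le \operatorname{codim}N$, the set $U_i=p^{-1}(\{x_i\neq0\})\cup\{[v]\in\mathbb{P}(\nu_N(M))|_{U\cap N}:dx_i(v)\neq0\}$ has coordinates $(\tilde x,y)$ in which $p(\tilde x,y)=(x,y)$ with $x_i=\tilde x_i$ and $x_j=\tilde x_i\tilde x_j$ for $j\ne i$; thus $\mathbb{P}(\nu_N(M))\cap U_i=\{\tilde x_i=0\}$. Dirac structures. $\mathbb{T}M=TM\oplus T^*M$ carries the pairing $\langle(v,\xi),(w,\eta)\rangle=\frac12(\xi(w)+\eta(v))$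 and, for a closed 3-form $H$, the bracket $[(X,\alpha),(Y,\beta)]=([X,Y],\mathcal{L}_X\beta-i_Yd\alpha+i_Yi_XH)$. An $H$-twisted Dirac structure is a smooth subbundle $L\subseteq\mathbb{T}M$ which is maximally isotropic and whose sections are closed under this bracket. $p^*(L|_{M\setminus N})$ denotes the transport of $L|_{M\setminus N}$ to $\mathrm{Blup}(M,N)\setminus\mathbb{P}(\nu_N(M))$ by the diffeomorphism $p$ onto $M\setminus N$. *)

theory Defs
  imports "HOL-Analysis.Analysis"
begin

section \<open>Smooth maps between open subsets of normed spaces\<close>

fun Ck_on :: "nat \<Rightarrow> 'a::real_normed_vector set \<Rightarrow> ('a \<Rightarrow> 'b::real_normed_vector) \<Rightarrow> bool" where
  "Ck_on 0 S f \<longleftrightarrow> continuous_on S f"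
| "Ck_on (Suc k) S f \<longleftrightarrow>
     (\<forall>x\<in>S. f differentiable (at x)) \<and> (\<forall>v. Ck_on k S (\<lambda>x. frechet_derivative f (at x) v))"

text \<open>Only used for open \<open>S\<close>.\<close>

definition smooth_on :: "'a::real_normed_vector set \<Rightarrow> ('a \<Rightarrow> 'b::real_normed_vector) \<Rightarrow> bool" where
  "smooth_on S f \<longleftrightarrow> (\<forall>k. Ck_on k S f)"


section \<open>Smooth manifolds\<close>

text \<open>A chart is a pair of its domain and its coordinate map; the values of the coordinate map
  outside the domain are irrelevant. A manifold is given by its underlying set and its maximal
  smooth atlas, which also determines its topology.\<close>

type_synonym ('a, 'n) chart = "'a set \<times> ('a \<Rightarrow> (real, 'n) vec)"

definition is_chart :: "('a, 'n::finite) chart \<Rightarrow> bool" where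
  "is_chart c \<longleftrightarrow> inj_on (snd c) (fst c) \<and> open (snd c ` fst c)"

definition inv_chart :: "('a, 'n::finite) chart \<Rightarrow> real^'n \<Rightarrow> 'a" where
  "inv_chart c = inv_into (fst c) (snd c)"

definition transition :: "('a, 'n::finite) chart \<Rightarrow> ('a, 'n) chart \<Rightarrow> real^'n \<Rightarrow> real^'n" where
  "transition c d = snd d \<circ> inv_chart c"

definition compatible :: "('a, 'n::finite) chart \<Rightarrow> ('a, 'n) chart \<Rightarrow> bool" where
  "compatible c d \<longleftrightarrow>
     open (snd c ` (fst c \<inter> fst d)) \<and> open (snd d ` (fst c \<inter> fst d)) \<and>
     smooth_on (snd c ` (fst c \<inter> fst d)) (transition c d) \<and>
     smooth_on (snd d ` (fst c \<inter> fst d)) (transition d c)"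

definition smooth_atlas :: "'a set \<Rightarrow> ('a, 'n::finite) chart set \<Rightarrow> bool" where
  "smooth_atlas M A \<longleftrightarrow>
     (\<forall>c\<in>A. is_chart c) \<and> (\<Union>c\<in>A. fst c) = M \<and> (\<forall>c\<in>A. \<forall>d\<in>A. compatible c d)"

definition maximal_atlas :: "'a set \<Rightarrow> ('a, 'n::finite) chart set \<Rightarrow> ('a, 'n) chart set" where
  "maximal_atlas M A = {c. fst c \<subseteq> M \<and> is_chart c \<and> (\<forall>d\<in>A. compatible c d)}"

definition atlas_topology :: "('a, 'n::finite) chart set \<Rightarrow> 'a topology" where
  "atlas_topology A =
     topology (\<lambda>W. W \<subseteq> (\<Union>c\<in>A. fst c) \<and> (\<forall>c\<in>A. open (snd c ` (fst c \<inter> W))))"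

lemma openin_atlas_topology:
  assumes "\<forall>c\<in>A. is_chart c"
  shows "openin (atlas_topology A) W \<longleftrightarrow>
           W \<subseteq> (\<Union>c\<in>A. fst c) \<and> (\<forall>c\<in>A. open (snd c ` (fst c \<inter> W)))"
proof -
  have inter: "snd c ` (fst c \<inter> (S \<inter> T)) = snd c ` (fst c \<inter> S) \<inter> snd c ` (fst c \<inter> T)"
    if "c \<in> A" for c S T
  proof -
    have "inj_on (snd c) (fst c)"
      using assms that by (auto simp: is_chart_def)
    then show ?thesis
      by (auto simp: inj_on_def)
  qed
  have union: "snd c ` (fst c \<inter> \<Union>K) = (\<Union>S\<in>K. snd c ` (fst c \<inter> S))" for c :: "('a, 'b) chart" and K
    by auto
  have "istopology (\<lambda>W. W \<subseteq> (\<Union>c\<in>A. fst c) \<and> (\<forall>c\<in>A. open (snd c ` (fst c \<inter> W))))"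
    unfolding istopology_def
    by (intro conjI allI impI ballI) (auto simp: inter union)
  then show ?thesis
    unfolding atlas_topology_def by (simp add: topology_inverse')
qed

definition smooth_manifold :: "'a set \<Rightarrow> ('a, 'n::finite) chart set \<Rightarrow> bool" where
  "smooth_manifold M A \<longleftrightarrow>
     smooth_atlas M A \<and> maximal_atlas M A = A \<and>
     Hausdorff_space (atlas_topology A) \<and> second_countable (atlas_topology A)"


section \<open>Tangent and cotangent spaces\<close>

text \<open>A tangent vector at \<open>q\<close> is the family of its coordinate vectors in all charts around \<open>q\<close>,
  related by the derivatives of the transition maps (and set to zero in all other charts).
  The vector space operations are chartwise. A cotangent vector is a linear functional on the
  tangent space, set to zero outside of it.\<close>

type_synonym ('a, 'n) tvec = "('a, 'n) chart \<Rightarrow> (real, 'n) vec"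
type_synonym ('a, 'n) cotvec = "('a, 'n) tvec \<Rightarrow> real"

definition lincomb :: "real \<Rightarrow> ('a, 'n::finite) tvec \<Rightarrow> real \<Rightarrow> ('a, 'n) tvec \<Rightarrow> ('a, 'n) tvec" where
  "lincomb a v b w = (\<lambda>c. a *\<^sub>R v c + b *\<^sub>R w c)"

definition tangent_space :: "('a, 'n::finite) chart set \<Rightarrow> 'a \<Rightarrow> ('a, 'n) tvec set" where
  "tangent_space A q =
     {v. (\<forall>c\<in>A. \<forall>d\<in>A. q \<in> fst c \<inter> fst d \<longrightarrow>
            v d = frechet_derivative (transition c d) (at (snd c q)) (v c)) \<and>
         (\<forall>c. c \<notin> A \<or> q \<notin> fst c \<longrightarrow> v c = 0)}"

definition cotangent_space :: "('a, 'n::finite) chart set \<Rightarrow> 'a \<Rightarrow> ('a, 'n) cotvec set" where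
  "cotangent_space A q =
     {\<xi>. (\<forall>v\<in>tangent_space A q. \<forall>w\<in>tangent_space A q. \<forall>a b.
            \<xi> (lincomb a v b w) = a * \<xi> v + b * \<xi> w) \<and>
         (\<forall>v. v \<notin> tangent_space A q \<longrightarrow> \<xi> v = 0)}"

text \<open>The tangent vector at \<open>q\<close> with coordinate vector \<open>w\<close> in the chart \<open>c\<close>.\<close>

definition tangent_of ::
  "('a, 'n::finite) chart set \<Rightarrow> ('a, 'n) chart \<Rightarrow> 'a \<Rightarrow> real^'n \<Rightarrow> ('a, 'n) tvec" where
  "tangent_of A c q w =
     (\<lambda>d. if d \<in> A \<and> q \<in> fst d then frechet_derivative (transition c d) (at (snd c q)) w else 0)"

definition some_chart :: "('a, 'n::finite) chart set \<Rightarrow> 'a \<Rightarrow> ('a, 'n) chart" where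
  "some_chart A q = (SOME c. c \<in> A \<and> q \<in> fst c)"

text \<open>The differential at \<open>b\<close> of a smooth map \<open>f\<close> from the manifold with atlas \<open>B\<close> to the one with
  atlas \<open>A\<close>, computed in an arbitrary chart around \<open>b\<close>.\<close>

definition tangent_map ::
  "('b, 'm::finite) chart set \<Rightarrow> ('a, 'n::finite) chart set \<Rightarrow> ('b \<Rightarrow> 'a) \<Rightarrow> 'b \<Rightarrow>
   ('b, 'm) tvec \<Rightarrow> ('a, 'n) tvec" where
  "tangent_map B A f b v =
     (\<lambda>c. if c \<in> A \<and> f b \<in> fst c
          then let d = some_chart B b
               in frechet_derivative (snd c \<circ> f \<circ> inv_chart d) (at (snd d b)) (v d)
          else 0)"

definition cotangent_map ::
  "('b, 'm::finite) chart set \<Rightarrow> ('a, 'n::finite) chart set \<Rightarrow> ('b \<Rightarrow> 'a) \<Rightarrow> 'b \<Rightarrow>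
   ('a, 'n) cotvec \<Rightarrow> ('b, 'm) cotvec" where
  "cotangent_map B A f b \<xi> =
     (\<lambda>v. if v \<in> tangent_space B b then \<xi> (tangent_map B A f b v) else 0)"


section \<open>Differential 3-forms\<close>

type_synonym ('a, 'n) three_form =
  "'a \<Rightarrow> ('a, 'n) tvec \<Rightarrow> ('a, 'n) tvec \<Rightarrow> ('a, 'n) tvec \<Rightarrow> real"

definition form_coords ::
  "('a, 'n::finite) chart set \<Rightarrow> ('a, 'n) three_form \<Rightarrow> ('a, 'n) chart \<Rightarrow>
   real^'n \<Rightarrow> real^'n \<Rightarrow> real^'n \<Rightarrow> real^'n \<Rightarrow> real" where
  "form_coords A H c u a1 a2 a3 =
     (let q = inv_chart c u in H q (tangent_of A c q a1) (tangent_of A c q a2) (tangent_of A c q a3))"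

definition alternating_trilinear_on ::
  "('a, 'n::finite) tvec set \<Rightarrow> (('a, 'n) tvec \<Rightarrow> ('a, 'n) tvec \<Rightarrow> ('a, 'n) tvec \<Rightarrow> real) \<Rightarrow> bool" where
  "alternating_trilinear_on T h \<longleftrightarrow>
     (\<forall>u\<in>T. \<forall>v\<in>T. \<forall>w\<in>T.
        h v u w = - h u v w \<and> h u w v = - h u v w \<and>
        (\<forall>u'\<in>T. \<forall>a b. h (lincomb a u b u') v w = a * h u v w + b * h u' v w))"

definition smooth_three_form ::
  "('a, 'n::finite) chart set \<Rightarrow> 'a set \<Rightarrow> ('a, 'n) three_form \<Rightarrow> bool" where
  "smooth_three_form A W H \<longleftrightarrow>
     (\<forall>q\<in>W. alternating_trilinear_on (tangent_space A q) (H q)) \<and>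
     (\<forall>c\<in>A. \<forall>a1 a2 a3. smooth_on (snd c ` (fst c \<inter> W)) (\<lambda>u. form_coords A H c u a1 a2 a3))"

text \<open>In the definition of \<open>dH = 0\<close>, the coordinate vectors \<open>a0, \<dots>, a3\<close> are constant, so that the
  corresponding coordinate vector fields commute.\<close>

definition closed_three_form ::
  "('a, 'n::finite) chart set \<Rightarrow> 'a set \<Rightarrow> ('a, 'n) three_form \<Rightarrow> bool" where
  "closed_three_form A W H \<longleftrightarrow>
     smooth_three_form A W H \<and>
     (\<forall>c\<in>A. \<forall>u\<in>snd c ` (fst c \<inter> W). \<forall>a0 a1 a2 a3.
        frechet_derivative (\<lambda>x. form_coords A H c x a1 a2 a3) (at u) a0
      - frechet_derivative (\<lambda>x. form_coords A H c x a0 a2 a3) (at u) a1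
      + frechet_derivative (\<lambda>x. form_coords A H c x a0 a1 a3) (at u) a2
      - frechet_derivative (\<lambda>x. form_coords A H c x a0 a1 a2) (at u) a3 = 0)"

definition pullback_three_form ::
  "('b, 'm::finite) chart set \<Rightarrow> ('a, 'n::finite) chart set \<Rightarrow> ('b \<Rightarrow> 'a) \<Rightarrow>
   ('a, 'n) three_form \<Rightarrow> ('b, 'm) three_form" where
  "pullback_three_form B A f H =
     (\<lambda>b u v w. H (f b) (tangent_map B A f b u) (tangent_map B A f b v) (tangent_map B A f b w))"


section \<open>Dirac structures\<close>

type_synonym ('a, 'n) gvec = "('a, 'n) tvec \<times> ('a, 'n) cotvec"

definition gen_tangent_space :: "('a, 'n::finite) chart set \<Rightarrow> 'a \<Rightarrow> ('a, 'n) gvec set" where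
  "gen_tangent_space A q = tangent_space A q \<times> cotangent_space A q"

definition pairing :: "('a, 'n::finite) gvec \<Rightarrow> ('a, 'n) gvec \<Rightarrow> real" where
  "pairing x y = (snd x (fst y) + snd y (fst x)) / 2"

definition is_subspace :: "('a, 'n::finite) gvec set \<Rightarrow> bool" where
  "is_subspace K \<longleftrightarrow>
     K \<noteq> {} \<and>
     (\<forall>x\<in>K. \<forall>y\<in>K. \<forall>a b.
        (lincomb a (fst x) b (fst y), (\<lambda>v. a * snd x v + b * snd y v)) \<in> K)"

definition isotropic :: "('a, 'n::finite) chart set \<Rightarrow> 'a \<Rightarrow> ('a, 'n) gvec set \<Rightarrow> bool" where
  "isotropic A q K \<longleftrightarrow>
     K \<subseteq> gen_tangent_space A q \<and> is_subspace K \<and> (\<forall>x\<in>K. \<forall>y\<in>K. pairing x y = 0)"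

definition maximally_isotropic :: "('a, 'n::finite) chart set \<Rightarrow> 'a \<Rightarrow> ('a, 'n) gvec set \<Rightarrow> bool" where
  "maximally_isotropic A q K \<longleftrightarrow>
     isotropic A q K \<and> (\<forall>K'. isotropic A q K' \<and> K \<subseteq> K' \<longrightarrow> K' = K)"

text \<open>Coordinates of a generalised tangent vector; those of the covector part are its values on the
  coordinate vectors of the chart.\<close>

definition gen_coords ::
  "('a, 'n::finite) chart set \<Rightarrow> ('a, 'n) chart \<Rightarrow> 'a \<Rightarrow> ('a, 'n) gvec \<Rightarrow> (real^'n) \<times> (real^'n)" where
  "gen_coords A c q x = (fst x c, \<chi> k. snd x (tangent_of A c q (axis k 1)))"

text \<open>A smooth subbundle over \<open>W\<close> is one which near every point is spanned by a smooth frame.\<close>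

definition smooth_subbundle ::
  "('a, 'n::finite) chart set \<Rightarrow> 'a set \<Rightarrow> ('a \<Rightarrow> ('a, 'n) gvec set) \<Rightarrow> bool" where
  "smooth_subbundle A W L \<longleftrightarrow>
     (\<forall>q\<in>W. L q \<subseteq> gen_tangent_space A q) \<and>
     (\<forall>q0\<in>W. \<exists>c\<in>A. \<exists>O1 r. \<exists>e :: nat \<Rightarrow> real^'n \<Rightarrow> (real^'n) \<times> (real^'n).
        q0 \<in> fst c \<and> open O1 \<and> snd c q0 \<in> O1 \<and> O1 \<subseteq> snd c ` (fst c \<inter> W) \<and>
        (\<forall>j<r. smooth_on O1 (e j)) \<and>
        (\<forall>u\<in>O1. inj_on (\<lambda>j. e j u) {..<r} \<and> independent ((\<lambda>j. e j u) ` {..<r}) \<and>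
           gen_coords A c (inv_chart c u) ` L (inv_chart c u) = span ((\<lambda>j. e j u) ` {..<r})))"

definition section_coords ::
  "('a, 'n::finite) chart set \<Rightarrow> ('a, 'n) chart \<Rightarrow> ('a \<Rightarrow> ('a, 'n) gvec) \<Rightarrow>
   real^'n \<Rightarrow> (real^'n) \<times> (real^'n)" where
  "section_coords A c \<sigma> = (\<lambda>u. gen_coords A c (inv_chart c u) (\<sigma> (inv_chart c u)))"

definition smooth_section ::
  "('a, 'n::finite) chart set \<Rightarrow> 'a set \<Rightarrow> ('a \<Rightarrow> ('a, 'n) gvec set) \<Rightarrow> ('a \<Rightarrow> ('a, 'n) gvec) \<Rightarrow> bool" where
  "smooth_section A W L \<sigma> \<longleftrightarrow>
     (\<forall>q\<in>W. \<sigma> q \<in> L q) \<and> (\<forall>c\<in>A. smooth_on (snd c ` (fst c \<inter> W)) (section_coords A c \<sigma>))"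

text \<open>The twisted bracket in local coordinates. One-forms on \<open>\<real>\<^sup>n\<close> are identified with their
  coefficient vectors.\<close>

definition lie_bracket ::
  "(real^'n \<Rightarrow> real^'n) \<Rightarrow> (real^'n \<Rightarrow> real^'n) \<Rightarrow> real^'n::finite \<Rightarrow> real^'n" where
  "lie_bracket X Y u = frechet_derivative Y (at u) (X u) - frechet_derivative X (at u) (Y u)"

definition lie_derivative ::
  "(real^'n \<Rightarrow> real^'n) \<Rightarrow> (real^'n \<Rightarrow> real^'n) \<Rightarrow> real^'n::finite \<Rightarrow> real^'n" where
  "lie_derivative X \<beta> u =
     (\<chi> k. frechet_derivative \<beta> (at u) (X u) $ k
           + \<beta> u \<bullet> frechet_derivative X (at u) (axis k 1))"

definition exterior_derivative ::
  "(real^'n \<Rightarrow> real^'n) \<Rightarrow> real^'n::finite \<Rightarrow> real^'n \<Rightarrow> real^'n \<Rightarrow> real" where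
  "exterior_derivative \<alpha> u v w =
     frechet_derivative \<alpha> (at u) v \<bullet> w - frechet_derivative \<alpha> (at u) w \<bullet> v"

definition twisted_bracket ::
  "(real^'n \<Rightarrow> real^'n \<Rightarrow> real^'n \<Rightarrow> real^'n \<Rightarrow> real) \<Rightarrow>
   (real^'n \<Rightarrow> (real^'n) \<times> (real^'n)) \<Rightarrow> (real^'n \<Rightarrow> (real^'n) \<times> (real^'n)) \<Rightarrow>
   real^'n::finite \<Rightarrow> (real^'n) \<times> (real^'n)" where
  "twisted_bracket h s t u =
     (let X = fst \<circ> s; \<alpha> = snd \<circ> s; Y = fst \<circ> t; \<beta> = snd \<circ> t
      in (lie_bracket X Y u,
          lie_derivative X \<beta> u
          - (\<chi> k. exterior_derivative \<alpha> u (Y u) (axis k 1))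
          + (\<chi> k. h u (X u) (Y u) (axis k 1))))"

text \<open>Sections are taken over arbitrary open subsets, that is, \<open>L\<close> is closed under the bracket as
  a sheaf of sections.\<close>

definition involutive ::
  "('a, 'n::finite) chart set \<Rightarrow> 'a set \<Rightarrow> ('a, 'n) three_form \<Rightarrow> ('a \<Rightarrow> ('a, 'n) gvec set) \<Rightarrow> bool" where
  "involutive A W H L \<longleftrightarrow>
     (\<forall>W' \<sigma> \<tau>. openin (atlas_topology A) W' \<and> W' \<subseteq> W \<and>
        smooth_section A W' L \<sigma> \<and> smooth_section A W' L \<tau> \<longrightarrow>
        (\<forall>c\<in>A. \<forall>q\<in>fst c \<inter> W'.
           twisted_bracket (form_coords A H c) (section_coords A c \<sigma>) (section_coords A c \<tau>) (snd c q)
             \<in> gen_coords A c q ` L q))"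

text \<open>\<open>L\<close> is an \<open>H\<close>-twisted Dirac structure on the open subset \<open>W\<close> of the manifold with atlas \<open>A\<close>.\<close>

definition twisted_dirac ::
  "('a, 'n::finite) chart set \<Rightarrow> 'a set \<Rightarrow> ('a, 'n) three_form \<Rightarrow> ('a \<Rightarrow> ('a, 'n) gvec set) \<Rightarrow> bool" where
  "twisted_dirac A W H L \<longleftrightarrow>
     openin (atlas_topology A) W \<and>
     closed_three_form A W H \<and>
     smooth_subbundle A W L \<and>
     (\<forall>q\<in>W. maximally_isotropic A q (L q)) \<and>
     involutive A W H L"

definition pullback_dirac ::
  "('b, 'm::finite) chart set \<Rightarrow> ('a, 'n::finite) chart set \<Rightarrow> ('b \<Rightarrow> 'a) \<Rightarrow>
   ('a \<Rightarrow> ('a, 'n) gvec set) \<Rightarrow> 'b \<Rightarrow> ('b, 'm) gvec set" where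
  "pullback_dirac B A f L b =
     {(v, cotangent_map B A f b \<xi>) | v \<xi>.
        v \<in> tangent_space B b \<and> \<xi> \<in> cotangent_space A (f b) \<and> (tangent_map B A f b v, \<xi>) \<in> L (f b)}"


section \<open>Submanifolds and their normal bundles\<close>

text \<open>The index set \<open>S\<close> singles out the coordinates \<open>x\<close> among the coordinates \<open>(x, y)\<close>.\<close>

definition submanifold_chart ::
  "('a, 'n::finite) chart set \<Rightarrow> 'a set \<Rightarrow> ('a, 'n) chart \<Rightarrow> 'n set \<Rightarrow> bool" where
  "submanifold_chart A N c S \<longleftrightarrow>
     c \<in> A \<and> fst c \<inter> N = {q \<in> fst c. \<forall>j\<in>S. snd c q $ j = 0}"

definition closed_embedded_submanifold :: "('a, 'n::finite) chart set \<Rightarrow> 'a set \<Rightarrow> bool" where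
  "closed_embedded_submanifold A N \<longleftrightarrow>
     closedin (atlas_topology A) N \<and> (\<forall>q\<in>N. \<exists>c S. submanifold_chart A N c S \<and> q \<in> fst c)"

definition submanifold_tangent_space ::
  "('a, 'n::finite) chart set \<Rightarrow> 'a set \<Rightarrow> 'a \<Rightarrow> ('a, 'n) tvec set" where
  "submanifold_tangent_space A N q =
     {v \<in> tangent_space A q. \<forall>c S. submanifold_chart A N c S \<and> q \<in> fst c \<longrightarrow> (\<forall>j\<in>S. v c $ j = 0)}"

text \<open>The class of \<open>v\<close> in \<open>T\<^sub>qM / T\<^sub>qN\<close>, and the point of the projectivisation it represents,
  i.e. the set of the nonzero multiples of that class.\<close>

definition normal_class ::
  "('a, 'n::finite) chart set \<Rightarrow> 'a set \<Rightarrow> 'a \<Rightarrow> ('a, 'n) tvec \<Rightarrow> ('a, 'n) tvec set" where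
  "normal_class A N q v =
     {w \<in> tangent_space A q. lincomb 1 w (-1) v \<in> submanifold_tangent_space A N q}"

definition normal_line ::
  "('a, 'n::finite) chart set \<Rightarrow> 'a set \<Rightarrow> 'a \<Rightarrow> ('a, 'n) tvec \<Rightarrow> ('a, 'n) tvec set set" where
  "normal_line A N q v = {normal_class A N q (\<lambda>c. t *\<^sub>R v c) | t. t \<noteq> 0}"

definition proj_normal_space ::
  "('a, 'n::finite) chart set \<Rightarrow> 'a set \<Rightarrow> 'a \<Rightarrow> ('a, 'n) tvec set set set" where
  "proj_normal_space A N q =
     normal_line A N q ` (tangent_space A q - submanifold_tangent_space A N q)"


section \<open>The real projective blowup\<close>

type_synonym ('a, 'n) blowup_point = "'a + 'a \<times> ('a, 'n) tvec set set"

definition exceptional_divisor ::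
  "('a, 'n::finite) chart set \<Rightarrow> 'a set \<Rightarrow> ('a, 'n) blowup_point set" where
  "exceptional_divisor A N = Inr ` {(q, l). q \<in> N \<and> l \<in> proj_normal_space A N q}"

definition blowup_set ::
  "'a set \<Rightarrow> ('a, 'n::finite) chart set \<Rightarrow> 'a set \<Rightarrow> ('a, 'n) blowup_point set" where
  "blowup_set M A N = Inl ` (M - N) \<union> exceptional_divisor A N"

definition blowdown :: "('a, 'n::finite) blowup_point \<Rightarrow> 'a" where
  "blowdown = case_sum id fst"

text \<open>The chart \<open>U\<^sub>i\<close> for a submanifold chart \<open>c = (U, (x, y))\<close>. On the complement of the exceptional
  divisor the equations \<open>x\<^sub>i = \<tilde>x\<^sub>i\<close>, \<open>x\<^sub>j = \<tilde>x\<^sub>i \<tilde>x\<^sub>j\<close> are solved for the new coordinates;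
  at \<open>[v]\<close>, where \<open>\<tilde>x\<^sub>i = 0\<close>, the other ones are the continuous extensions
  \<open>\<tilde>x\<^sub>j = dx\<^sub>j(v) / dx\<^sub>i(v)\<close>, which depend only on the line \<open>[v]\<close>.\<close>

definition blowup_chart ::
  "('a, 'n::finite) chart set \<Rightarrow> 'a set \<Rightarrow> ('a, 'n) chart \<Rightarrow> 'n set \<Rightarrow> 'n \<Rightarrow>
   (('a, 'n) blowup_point, 'n) chart" where
  "blowup_chart A N c S i =
     (Inl ` {q \<in> fst c - N. snd c q $ i \<noteq> 0} \<union>
      Inr ` {(q, l). q \<in> fst c \<inter> N \<and> l \<in> proj_normal_space A N q \<and> (\<exists>v\<in>\<Union>l. v c $ i \<noteq> 0)},
      case_sum
        (\<lambda>q. \<chi> j. if j \<in> S - {i} then snd c q $ j / snd c q $ i else snd c q $ j)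
        (\<lambda>(q, l). let v = (SOME v. v \<in> \<Union>l)
                  in \<chi> j. if j \<in> S - {i} then v c $ j / v c $ i else snd c q $ j))"

text \<open>The charts of \<open>M \<setminus> N\<close> are added since the charts \<open>U\<^sub>i\<close> need not cover it.\<close>

definition blowup_atlas ::
  "'a set \<Rightarrow> ('a, 'n::finite) chart set \<Rightarrow> 'a set \<Rightarrow> (('a, 'n) blowup_point, 'n) chart set" where
  "blowup_atlas M A N =
     maximal_atlas (blowup_set M A N)
       ({blowup_chart A N c S i | c S i. submanifold_chart A N c S \<and> i \<in> S} \<union>
        {(Inl ` fst c, case_sum (snd c) (\<lambda>_. 0)) | c. c \<in> A \<and> fst c \<inter> N = {}})"

end

theory Submission
  imports Defs
begin

text \<open>In a blowup chart the blowdown map is polynomial, so a smooth frame of \<open>L\<close> pulls back, after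
  multiplication by \<open>z\<^sub>i\<close>, to a smooth family which spans the pulled back structure off the
  exceptional divisor \<open>z\<^sub>i = 0\<close>. The Gram determinant of this family against a suitable dual family is
  a power of \<open>z\<^sub>i\<close> times a nonvanishing function. Hence the family can only finitely often be
  improved by dividing a member which vanishes on the divisor by \<open>z\<^sub>i\<close>, and near some point of any
  given open piece of the divisor this process ends with a frame. The points near which such a frame
  exists form \<open>V\<close>. Isotropy, involutivity and closedness of the pulled back form extend to the
  divisor by continuity, because its complement is dense.\<close>

section \<open>Calculus of smooth maps\<close>

text \<open>A smooth function can vanish to infinite order on a hyperplane, so division by
  \<open>z\<^sub>i\<close> need not end by itself, and a Lagrangian subbundle given off a
  hypersurface need not have limits on it. The bound comes from the blowdown: the inverse of its
  derivative has at most a simple pole, that is, \<open>z\<^sub>i\<close> times the inverse is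
  polynomial (\<open>pblow\<close>). Hence the pullback of vectors and covectors, scaled by
  \<open>z\<^sub>i\<close>, has an inverse transpose which becomes smooth after multiplication by
  \<open>z\<^sub>i\<^sup>2\<close> (\<open>gen_dual\<close>). Pairing the \<open>n\<close> frame
  members against it yields the order \<open>2n\<close>, whatever \<open>L\<close> is. Division
  needs vanishing on all of the hyperplane within the current open set, while a member may vanish on
  a part of it only. In that case the open set is shrunk to where the member is nonzero and the base
  point moves; this is why density of \<open>V\<close> is obtained and not \<open>V = E\<close>.
  Once frames exist, everything else is a continuity argument: a Lagrangian space is its own
  orthogonal, so membership is a system of equations between continuous functions.\<close>

lemma Ck_on_Suc_imp: "Ck_on (Suc k) S f \<Longrightarrow> Ck_on k S f"
proof (induction k arbitrary: f)
  case 0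
  then show ?case
    by (auto intro!: continuous_at_imp_continuous_on differentiable_imp_continuous_within)
qed auto

lemma Ck_on_imp_continuous_on: "Ck_on k S f \<Longrightarrow> continuous_on S f"
  by (induction k) (use Ck_on_Suc_imp in \<open>force simp del: Ck_on.simps(2)\<close>)+

lemma Ck_on_subset: "Ck_on k S f \<Longrightarrow> T \<subseteq> S \<Longrightarrow> Ck_on k T f"
proof (induction k arbitrary: f)
  case 0
  then show ?case by (auto intro: continuous_on_subset)
next
  case (Suc k)
  then show ?case by (auto simp del: Ck_on.simps simp: Ck_on.simps(2))
qed

text \<open>\<open>frechet_derivative\<close> is chosen from the predicate
  \<open>has_derivative\<close>, and this predicate is the same for both functions; so equality
  holds even at points where neither is differentiable.\<close>

lemma frechet_derivative_cong_open:
  assumes "open S" "x \<in> S" "\<And>y. y \<in> S \<Longrightarrow> f y = g y"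
  shows "frechet_derivative f (at x) = frechet_derivative g (at x)"
proof -
  have "(f has_derivative D) (at x) \<longleftrightarrow> (g has_derivative D) (at x)" for D
    using assms by (metis has_derivative_transform_within_open)
  then show ?thesis by (simp add: frechet_derivative_def)
qed

lemma differentiable_cong_open:
  assumes "open S" "x \<in> S" "\<And>y. y \<in> S \<Longrightarrow> f y = g y" "f differentiable (at x)"
  shows "g differentiable (at x)"
  using assms by (metis has_derivative_transform_within_open differentiable_def)

lemma Ck_on_cong:
  assumes "open S" "\<And>y. y \<in> S \<Longrightarrow> f y = g y" "Ck_on k S f"
  shows "Ck_on k S g"
  using assms
proof (induction k arbitrary: f g)
  case 0
  then show ?case by (simp cong: continuous_on_cong)
next
  case (Suc k)
  show ?case unfolding Ck_on.simps
  proof (intro conjI ballI allI)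
    show "g differentiable at x" if "x \<in> S" for x
      using differentiable_cong_open[OF Suc.prems(1) that Suc.prems(2)] Suc.prems(3) that by auto
    show "Ck_on k S (\<lambda>x. frechet_derivative g (at x) v)" for v
      by (rule Suc.IH[OF Suc.prems(1), of "\<lambda>x. frechet_derivative f (at x) v"])
        (use frechet_derivative_cong_open[OF Suc.prems(1) _ Suc.prems(2)] Suc.prems(3) in auto)
  qed
qed

lemma Ck_on_local:
  assumes "\<And>x. x \<in> S \<Longrightarrow> \<exists>T. open T \<and> x \<in> T \<and> Ck_on k T f"
  shows "Ck_on k S f"
  using assms
proof (induction k arbitrary: f)
  case 0
  then show ?case
    by (auto intro!: continuous_at_imp_continuous_on) (metis continuous_on_eq_continuous_at)
next
  case (Suc k)
  show ?case unfolding Ck_on.simps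
  proof (intro conjI ballI allI)
    show "f differentiable at x" if "x \<in> S" for x
      using Suc.prems[OF that] by auto
    show "Ck_on k S (\<lambda>x. frechet_derivative f (at x) v)" for v
      by (rule Suc.IH) (use Suc.prems in fastforce)
  qed
qed

lemma Ck_on_const: "Ck_on k S (\<lambda>x. c)"
  by (induction k arbitrary: c) auto

text \<open>Lets any derivative rule supply the next order: the chosen
  \<open>frechet_derivative\<close> agrees with \<open>D\<close> on the open set, which leaves only
  the regularity of \<open>D\<close> to be checked.\<close>

lemma Ck_on_Suc_I:
  assumes "open S" "\<And>x. x \<in> S \<Longrightarrow> (f has_derivative D x) (at x)" "\<And>v. Ck_on k S (\<lambda>x. D x v)"
  shows "Ck_on (Suc k) S f"
  unfolding Ck_on.simps
proof (intro conjI ballI allI)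
  show "f differentiable at x" if "x \<in> S" for x
    using assms(2)[OF that] by (auto simp: differentiable_def)
  show "Ck_on k S (\<lambda>x. frechet_derivative f (at x) v)" for v
    by (rule Ck_on_cong[OF assms(1) _ assms(3)[of v]]) (metis assms(2) frechet_derivative_at)
qed

lemma Ck_on_has_derivative:
  "Ck_on (Suc k) S f \<Longrightarrow> x \<in> S \<Longrightarrow> (f has_derivative frechet_derivative f (at x)) (at x)"
  by (simp add: frechet_derivative_works)

lemma Ck_on_bounded_linear:
  assumes "open S" "bounded_linear h" "Ck_on k S f"
  shows "Ck_on k S (\<lambda>x. h (f x))"
  using assms(3)
proof (induction k arbitrary: f)
  case 0
  then show ?case using assms by (simp add: bounded_linear.continuous_on)
next
  case (Suc k)
  show ?case
    by (rule Ck_on_Suc_I[OF assms(1) bounded_linear.has_derivative[OF assms(2) Ck_on_has_derivative[OF Suc.prems]]])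
      (use Suc in auto)
qed

lemma Ck_on_id: "open S \<Longrightarrow> Ck_on k S (\<lambda>x. x)"
proof (cases k)
  case (Suc m)
  assume "open S"
  then show ?thesis unfolding Suc
    by (rule Ck_on_Suc_I) (auto intro: Ck_on_const derivative_intros)
qed auto

lemma Ck_on_add:
  assumes "open S" "Ck_on k S f" "Ck_on k S g"
  shows "Ck_on k S (\<lambda>x. f x + g x)"
  using assms(2-)
proof (induction k arbitrary: f g)
  case 0
  then show ?case by (auto intro: continuous_intros)
next
  case (Suc k)
  show ?case
    by (rule Ck_on_Suc_I[OF assms(1) has_derivative_add[OF Ck_on_has_derivative[OF Suc.prems(1)] Ck_on_has_derivative[OF Suc.prems(2)]]])
      (use Suc in auto)
qed

lemma (in bounded_bilinear) Ck_on:
  assumes "open S" "Ck_on k S f" "Ck_on k S g"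
  shows "Ck_on k S (\<lambda>x. prod (f x) (g x))"
  using assms(2-)
proof (induction k arbitrary: f g)
  case 0
  then show ?case by (auto intro: continuous_on)
next
  case (Suc k)
  show ?case
  proof (rule Ck_on_Suc_I[OF assms(1) FDERIV[OF Ck_on_has_derivative[OF Suc.prems(1)] Ck_on_has_derivative[OF Suc.prems(2)]]])
    show "Ck_on k S (\<lambda>x. prod (f x) (frechet_derivative g (at x) v) + prod (frechet_derivative f (at x) v) (g x))" for v
      by (intro Ck_on_add[OF assms(1)] Suc.IH Ck_on_Suc_imp[OF Suc.prems(1)] Ck_on_Suc_imp[OF Suc.prems(2)])
        (use Suc.prems in auto)
  qed
qed

lemma Ck_on_sum:
  assumes "open S" "\<And>i. i \<in> I \<Longrightarrow> Ck_on k S (f i)"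
  shows "Ck_on k S (\<lambda>x. \<Sum>i\<in>I. f i x)"
  using assms(2) by (induction I rule: infinite_finite_induct) (auto intro: Ck_on_const Ck_on_add[OF assms(1)])

lemma Ck_on_componentwise:
  fixes f :: "'a::real_normed_vector \<Rightarrow> 'b::euclidean_space"
  assumes "open S" "\<And>b. b \<in> Basis \<Longrightarrow> Ck_on k S (\<lambda>x. f x \<bullet> b)"
  shows "Ck_on k S f"
proof -
  have "Ck_on k S (\<lambda>x. \<Sum>b\<in>Basis. (f x \<bullet> b) *\<^sub>R b)"
    by (intro Ck_on_sum[OF assms(1)] bounded_bilinear.Ck_on[OF bounded_bilinear_scaleR] assms Ck_on_const)
  then show ?thesis by (simp add: euclidean_representation)
qed

lemma linear_basis_expansion:
  fixes D :: "'a::euclidean_space \<Rightarrow> 'b::real_vector"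
  assumes "linear D"
  shows "D w = (\<Sum>b\<in>Basis. (w \<bullet> b) *\<^sub>R D b)"
proof -
  have "D w = D (\<Sum>b\<in>Basis. (w \<bullet> b) *\<^sub>R b)" by (simp add: euclidean_representation)
  also have "\<dots> = (\<Sum>b\<in>Basis. (w \<bullet> b) *\<^sub>R D b)"
    by (simp add: linear_sum[OF assms] linear_scale[OF assms])
  finally show ?thesis .
qed

lemma Ck_on_compose:
  fixes f :: "'b::euclidean_space \<Rightarrow> 'c::real_normed_vector" and g :: "'a::real_normed_vector \<Rightarrow> 'b"
  assumes "open S" "open T" "g ` S \<subseteq> T" "Ck_on k T f" "Ck_on k S g"
  shows "Ck_on k S (\<lambda>x. f (g x))"
  using assms(4,5)
proof (induction k arbitrary: f)
  case 0
  then show ?case using assms by (auto intro: continuous_on_compose2)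
next
  case (Suc k)
  \<comment> \<open>The chain rule expanded in a basis: the derivative of \<open>f\<close> is then
    evaluated on fixed vectors only, the form to which the induction hypothesis applies.\<close>
  let ?D = "\<lambda>x. \<lambda>v. \<Sum>b\<in>Basis. (frechet_derivative g (at x) v \<bullet> b) *\<^sub>R frechet_derivative f (at (g x)) b"
  show ?case
  proof (rule Ck_on_Suc_I[OF assms(1), of _ ?D])
    fix x assume x: "x \<in> S"
    have f: "(f has_derivative frechet_derivative f (at (g x))) (at (g x))"
      using Suc.prems(1) assms x by (auto simp: frechet_derivative_works)
    have "((\<lambda>x. f (g x)) has_derivative (\<lambda>v. frechet_derivative f (at (g x)) (frechet_derivative g (at x) v))) (at x)"
      by (rule has_derivative_compose[OF Ck_on_has_derivative[OF Suc.prems(2) x] f])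
    moreover have "linear (frechet_derivative f (at (g x)))"
      using f has_derivative_linear by blast
    ultimately show "((\<lambda>x. f (g x)) has_derivative ?D x) (at x)"
      by (simp add: linear_basis_expansion[of "frechet_derivative f (at (g x))" "frechet_derivative g (at x) _"])
  next
    fix v
    show "Ck_on k S (\<lambda>x. ?D x v)"
      by (intro Ck_on_sum[OF assms(1)] bounded_bilinear.Ck_on[OF bounded_bilinear_scaleR assms(1)]
          Ck_on_bounded_linear[OF assms(1) bounded_linear_inner_left] Suc.IH)
        (use Suc.prems Ck_on_Suc_imp in auto)
  qed
qed

lemma Ck_on_inverse:
  fixes f :: "'a::real_normed_vector \<Rightarrow> real"
  assumes "open S" "Ck_on k S f" "\<And>x. x \<in> S \<Longrightarrow> f x \<noteq> 0"
  shows "Ck_on k S (\<lambda>x. inverse (f x))"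
  using assms(2)
proof (induction k)
  case 0
  then show ?case using assms by (auto intro: continuous_intros)
next
  case (Suc k)
  have IH: "Ck_on k S (\<lambda>x. inverse (f x))"
    using Suc Ck_on_Suc_imp by auto
  show ?case
  proof (rule Ck_on_Suc_I[OF assms(1)])
    show "((\<lambda>x. inverse (f x)) has_derivative (\<lambda>v. - (inverse (f x) * frechet_derivative f (at x) v * inverse (f x)))) (at x)"
      if "x \<in> S" for x
      by (rule Deriv.has_derivative_inverse) (use assms that Ck_on_has_derivative[OF Suc.prems that] in auto)
    show "Ck_on k S (\<lambda>x. - (inverse (f x) * frechet_derivative f (at x) v * inverse (f x)))" for v
      by (rule Ck_on_bounded_linear[OF assms(1) bounded_linear_minus[OF bounded_linear_ident]],
          intro bounded_bilinear.Ck_on[OF bounded_bilinear_mult assms(1)] IH)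
        (use Suc.prems in auto)
  qed
qed

lemma smooth_on_subset: "smooth_on S f \<Longrightarrow> T \<subseteq> S \<Longrightarrow> smooth_on T f"
  by (meson Ck_on_subset smooth_on_def)

lemma smooth_on_cong:
  "open S \<Longrightarrow> (\<And>y. y \<in> S \<Longrightarrow> f y = g y) \<Longrightarrow> smooth_on S f \<longleftrightarrow> smooth_on S g"
  by (metis Ck_on_cong smooth_on_def)

lemma smooth_on_local:
  "(\<And>x. x \<in> S \<Longrightarrow> \<exists>T. open T \<and> x \<in> T \<and> smooth_on T f) \<Longrightarrow> smooth_on S f"
  unfolding smooth_on_def by (meson Ck_on_local)

lemma smooth_on_imp_continuous_on: "smooth_on S f \<Longrightarrow> continuous_on S f"
  by (metis Ck_on.simps(1) smooth_on_def)

lemma smooth_on_has_derivative: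
  "smooth_on S f \<Longrightarrow> x \<in> S \<Longrightarrow> (f has_derivative frechet_derivative f (at x)) (at x)"
  by (meson Ck_on_has_derivative smooth_on_def)

lemma smooth_on_linear_derivative:
  "smooth_on S f \<Longrightarrow> x \<in> S \<Longrightarrow> linear (frechet_derivative f (at x))"
  using smooth_on_has_derivative has_derivative_linear by blast

lemma smooth_on_frechet: "smooth_on S f \<Longrightarrow> smooth_on S (\<lambda>x. frechet_derivative f (at x) v)"
  unfolding smooth_on_def by (metis Ck_on.simps(2))

lemma smooth_on_const [intro, simp]: "smooth_on S (\<lambda>x. c)"
  by (simp add: smooth_on_def Ck_on_const)

lemma smooth_on_id [intro, simp]: "open S \<Longrightarrow> smooth_on S (\<lambda>x. x)"
  by (simp add: smooth_on_def Ck_on_id)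

lemma smooth_on_bounded_linear:
  "open S \<Longrightarrow> bounded_linear h \<Longrightarrow> smooth_on S f \<Longrightarrow> smooth_on S (\<lambda>x. h (f x))"
  by (simp add: smooth_on_def Ck_on_bounded_linear)

lemma smooth_on_add: "open S \<Longrightarrow> smooth_on S f \<Longrightarrow> smooth_on S g \<Longrightarrow> smooth_on S (\<lambda>x. f x + g x)"
  by (simp add: smooth_on_def Ck_on_add)

lemma smooth_on_minus: "open S \<Longrightarrow> smooth_on S f \<Longrightarrow> smooth_on S (\<lambda>x. - f x)"
  by (rule smooth_on_bounded_linear[OF _ bounded_linear_minus[OF bounded_linear_ident]])

lemma smooth_on_diff: "open S \<Longrightarrow> smooth_on S f \<Longrightarrow> smooth_on S g \<Longrightarrow> smooth_on S (\<lambda>x. f x - g x)"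
  using smooth_on_add[of S f "\<lambda>x. - g x"] by (simp add: smooth_on_minus)

lemma (in bounded_bilinear) smooth_on:
  "open S \<Longrightarrow> smooth_on S f \<Longrightarrow> smooth_on S g \<Longrightarrow> smooth_on S (\<lambda>x. prod (f x) (g x))"
  by (simp add: smooth_on_def Ck_on)

lemmas smooth_on_scaleR = bounded_bilinear.smooth_on[OF bounded_bilinear_scaleR]
lemmas smooth_on_inner = bounded_bilinear.smooth_on[OF bounded_bilinear_inner]
lemmas smooth_on_mult = bounded_bilinear.smooth_on[OF bounded_bilinear_mult]

lemma smooth_on_sum:
  "open S \<Longrightarrow> (\<And>i. i \<in> I \<Longrightarrow> smooth_on S (f i)) \<Longrightarrow> smooth_on S (\<lambda>x. \<Sum>i\<in>I. f i x)"
  by (simp add: smooth_on_def Ck_on_sum)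

lemma smooth_on_componentwise:
  fixes f :: "'a::real_normed_vector \<Rightarrow> 'b::euclidean_space"
  shows "open S \<Longrightarrow> (\<And>b. b \<in> Basis \<Longrightarrow> smooth_on S (\<lambda>x. f x \<bullet> b)) \<Longrightarrow> smooth_on S f"
  by (simp add: smooth_on_def Ck_on_componentwise)

lemma smooth_on_compose:
  fixes f :: "'b::euclidean_space \<Rightarrow> 'c::real_normed_vector"
  shows "open S \<Longrightarrow> open T \<Longrightarrow> g ` S \<subseteq> T \<Longrightarrow> smooth_on T f \<Longrightarrow> smooth_on S g \<Longrightarrow> smooth_on S (\<lambda>x. f (g x))"
  by (simp add: smooth_on_def Ck_on_compose)

lemma smooth_on_inverse:
  fixes f :: "'a::real_normed_vector \<Rightarrow> real"
  shows "open S \<Longrightarrow> smooth_on S f \<Longrightarrow> (\<And>x. x \<in> S \<Longrightarrow> f x \<noteq> 0) \<Longrightarrow> smooth_on S (\<lambda>x. inverse (f x))"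
  by (simp add: smooth_on_def Ck_on_inverse)

lemma smooth_on_divide:
  fixes f :: "'a::real_normed_vector \<Rightarrow> real"
  shows "open S \<Longrightarrow> smooth_on S f \<Longrightarrow> smooth_on S g \<Longrightarrow> (\<And>x. x \<in> S \<Longrightarrow> g x \<noteq> 0) \<Longrightarrow> smooth_on S (\<lambda>x. f x / g x)"
  by (simp add: divide_inverse smooth_on_mult smooth_on_inverse)

lemma smooth_on_nth: "open S \<Longrightarrow> smooth_on S f \<Longrightarrow> smooth_on S (\<lambda>x. f x $ j)"
  by (rule smooth_on_bounded_linear[OF _ bounded_linear_vec_nth])

lemma smooth_on_vec_lambda:
  fixes f :: "'n::finite \<Rightarrow> 'a::real_normed_vector \<Rightarrow> real"
  assumes "open S" "\<And>j. smooth_on S (f j)"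
  shows "smooth_on S (\<lambda>x. \<chi> j. f j x)"
proof (rule smooth_on_componentwise[OF assms(1)])
  fix b :: "real^'n" assume "b \<in> Basis"
  then obtain j where "b = axis j 1" by (auto simp: Basis_vec_def)
  then show "smooth_on S (\<lambda>x. (\<chi> j. f j x) \<bullet> b)" using assms(2)[of j] by (simp add: inner_axis)
qed

lemma smooth_on_fst: "open S \<Longrightarrow> smooth_on S f \<Longrightarrow> smooth_on S (\<lambda>x. fst (f x))"
  by (rule smooth_on_bounded_linear[OF _ bounded_linear_fst])

lemma smooth_on_snd: "open S \<Longrightarrow> smooth_on S f \<Longrightarrow> smooth_on S (\<lambda>x. snd (f x))"
  by (rule smooth_on_bounded_linear[OF _ bounded_linear_snd])

lemma smooth_on_Pair:
  fixes f :: "'a::real_normed_vector \<Rightarrow> 'b::euclidean_space" and g :: "'a \<Rightarrow> 'c::euclidean_space"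
  assumes "open S" "smooth_on S f" "smooth_on S g"
  shows "smooth_on S (\<lambda>x. (f x, g x))"
proof (rule smooth_on_componentwise[OF assms(1)])
  fix b :: "'b \<times> 'c"
  have "smooth_on S (\<lambda>x. f x \<bullet> fst b + g x \<bullet> snd b)"
    by (intro smooth_on_add smooth_on_inner assms smooth_on_const)
  then show "smooth_on S (\<lambda>x. (f x, g x) \<bullet> b)" by (simp add: inner_prod_def)
qed

text \<open>\<open>smooth_on\<close> speaks of the derivative on fixed vectors; linearity and a
  basis expansion carry this over to a varying argument \<open>w x\<close>.\<close>

lemma smooth_on_frechet_apply:
  fixes f :: "'b::euclidean_space \<Rightarrow> 'c::real_normed_vector"
  assumes "open S" "open T" "g ` S \<subseteq> T" "smooth_on T f" "smooth_on S g" "smooth_on S w"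
  shows "smooth_on S (\<lambda>x. frechet_derivative f (at (g x)) (w x))"
proof -
  have "smooth_on S (\<lambda>x. \<Sum>b\<in>Basis. (w x \<bullet> b) *\<^sub>R frechet_derivative f (at (g x)) b)"
  proof (intro smooth_on_sum smooth_on_scaleR assms(1))
    show "smooth_on S (\<lambda>x. w x \<bullet> b)" for b
      by (rule smooth_on_inner[OF assms(1,6) smooth_on_const])
    show "smooth_on S (\<lambda>x. frechet_derivative f (at (g x)) b)" for b
      by (rule smooth_on_compose[OF assms(1-3) smooth_on_frechet[OF assms(4)] assms(5)])
  qed
  moreover have "frechet_derivative f (at (g x)) (w x) = (\<Sum>b\<in>Basis. (w x \<bullet> b) *\<^sub>R frechet_derivative f (at (g x)) b)"
    if "x \<in> S" for x
  proof -
    have "g x \<in> T" using that assms(3) by auto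
    from linear_basis_expansion[OF smooth_on_linear_derivative[OF assms(4) this], of "w x"]
    show ?thesis by simp
  qed
  ultimately show ?thesis by (subst smooth_on_cong[OF assms(1)]) auto
qed

subsection \<open>Division by a coordinate\<close>

text \<open>Differentiating the integrand in direction \<open>v\<close> evaluates the derivative of
  \<open>f\<close> on \<open>t v + (1 - t) Q v\<close>, which brings in the factors \<open>t\<close>
  and \<open>1 - t\<close>. An arbitrary continuous weight \<open>\<phi>\<close> makes the statement
  stable under differentiation, so that induction on \<open>k\<close> works.\<close>

lemma Ck_on_weighted_segment_integral:
  fixes f :: "'a::euclidean_space \<Rightarrow> 'b::euclidean_space" and \<phi> :: "real \<Rightarrow> real"
  assumes "open S" "convex S" "linear Q" "\<And>z. z \<in> S \<Longrightarrow> Q z \<in> S"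
    and "Ck_on k S f" "continuous_on UNIV \<phi>"
  shows "Ck_on k S (\<lambda>z. integral {0..1} (\<lambda>t. \<phi> t *\<^sub>R f (t *\<^sub>R z + (1 - t) *\<^sub>R Q z)))"
  using assms(5,6)
proof (induction k arbitrary: f \<phi>)
  have Qc: "continuous_on T Q" for T
    using assms(3) linear_continuous_on linear_conv_bounded_linear by blast
  define P where "P = (\<lambda>z t. t *\<^sub>R z + (1 - t) *\<^sub>R Q z)"
  have PS: "P z t \<in> S" if "z \<in> S" "t \<in> cbox 0 1" for z t
    using convexD[OF assms(2) that(1) assms(4)[OF that(1)], of t "1 - t"] that(2) by (auto simp: P_def)
  have Pc: "continuous_on (S \<times> cbox 0 1) (\<lambda>x. P (fst x) (snd x))"
    unfolding P_def by (intro continuous_intros continuous_on_compose2[OF Qc[of UNIV]]) auto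
  have cont: "continuous_on (S \<times> cbox 0 1) (\<lambda>x. \<phi> (snd x) *\<^sub>R f (P (fst x) (snd x)))"
    if "continuous_on S f" "continuous_on UNIV \<phi>" for f :: "'a \<Rightarrow> 'b" and \<phi> :: "real \<Rightarrow> real"
    by (intro continuous_intros continuous_on_compose2[OF that(1) Pc] continuous_on_compose2[OF that(2)])
      (use PS in auto)
  {
    case 0
    then have "continuous_on S (\<lambda>z. integral (cbox 0 1) (\<lambda>t. \<phi> t *\<^sub>R f (P z t)))"
      by (intro integral_continuous_on_param) (use cont[of f \<phi>] in \<open>simp add: case_prod_beta'\<close>)
    then show ?case by (simp add: P_def)
  next
    case (Suc k)
    let ?f' = "\<lambda>z v. frechet_derivative f (at z) v"
    let ?D = "\<lambda>z t v. \<phi> t *\<^sub>R ?f' (P z t) (P v t)"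
    have cf': "continuous_on S (\<lambda>z. ?f' z v)" for v
    proof -
      have "Ck_on k S (\<lambda>z. ?f' z v)"
        using Suc.prems(1) by simp
      then show ?thesis by (rule Ck_on_imp_continuous_on)
    qed
    have der: "(f has_derivative ?f' z) (at z)" if "z \<in> S" for z
      using Ck_on_has_derivative[OF Suc.prems(1) that] .
    have Pl: "(\<lambda>z. P z t) = (\<lambda>z. t *\<^sub>R z + (1 - t) *\<^sub>R Q z)" for t by (simp add: P_def)
    have Pbl: "bounded_linear (\<lambda>z. P z t)" for t
      unfolding Pl by (intro bounded_linear_intros) (use assms(3) linear_conv_bounded_linear in auto)
    have derD: "((\<lambda>z. \<phi> t *\<^sub>R f (P z t)) has_derivative ?D z t) (at z)" if "z \<in> S" "t \<in> cbox 0 1" for z t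
      by (intro has_derivative_scaleR_right has_derivative_compose[OF bounded_linear_imp_has_derivative[OF Pbl] der] PS that)
    have blD: "bounded_linear (?D z t)" if "z \<in> S" "t \<in> cbox 0 1" for z t
      using derD[OF that] has_derivative_bounded_linear by blast
    \<comment> \<open>\<open>leibniz_rule\<close> wants the derivative of the integrand as a
      continuous family of bounded operators; continuity is then checked vector by vector.\<close>
    define F where "F = (\<lambda>z t. Blinfun (?D z t))"
    have F: "blinfun_apply (F z t) = ?D z t" if "z \<in> S" "t \<in> cbox 0 1" for z t
      unfolding F_def by (rule bounded_linear_Blinfun_apply[OF blD[OF that]])
    have splitD: "?D z t v = (\<phi> t * t) *\<^sub>R ?f' (P z t) v + (\<phi> t * (1 - t)) *\<^sub>R ?f' (P z t) (Q v)"
      if "z \<in> S" "t \<in> cbox 0 1" for z t v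
    proof -
      have "linear (?f' (P z t))" using der[OF PS[OF that]] has_derivative_linear by blast
      then show ?thesis by (simp add: P_def linear_add linear_scale scaleR_add_right)
    qed
    have cont': "continuous_on (S \<times> cbox 0 1) (\<lambda>x. ?D (fst x) (snd x) v)" for v
    proof -
      have "continuous_on (S \<times> cbox 0 1) (\<lambda>x. (\<phi> (snd x) * snd x) *\<^sub>R ?f' (P (fst x) (snd x)) v
               + (\<phi> (snd x) * (1 - snd x)) *\<^sub>R ?f' (P (fst x) (snd x)) (Q v))"
        by (intro continuous_on_add cont[OF cf'] continuous_intros Suc.prems(2))
      then show ?thesis
        by (rule continuous_on_eq) (use splitD in auto)
    qed
    have contF: "continuous_on (S \<times> cbox 0 1) (\<lambda>(z, t). F z t)"
      unfolding case_prod_beta'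
    proof (rule continuous_on_blinfun_componentwise)
      show "continuous_on (S \<times> cbox 0 1) (\<lambda>x. blinfun_apply (F (fst x) (snd x)) i)" for i
        by (rule continuous_on_eq[OF cont'[of i]]) (auto simp: F)
    qed
    have int: "(\<lambda>t. \<phi> t *\<^sub>R f (P z t)) integrable_on cbox 0 1"
      if "z \<in> S" "continuous_on S f" "continuous_on UNIV \<phi>" for z \<phi> and f :: "'a \<Rightarrow> 'b"
    proof (rule integrable_continuous)
      have "continuous_on (cbox 0 1) ((\<lambda>x. \<phi> (snd x) *\<^sub>R f (P (fst x) (snd x))) \<circ> (\<lambda>t. (z, t)))"
        by (rule continuous_on_compose[OF _ continuous_on_subset[OF cont]]) (use that in \<open>auto intro: continuous_intros\<close>)
      then show "continuous_on (cbox 0 1) (\<lambda>t. \<phi> t *\<^sub>R f (P z t))" by (simp add: o_def)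
    qed
    have cf: "continuous_on S f"
      using Ck_on_imp_continuous_on[OF Suc.prems(1)] .
    have G: "((\<lambda>z. integral (cbox 0 1) (\<lambda>t. \<phi> t *\<^sub>R f (P z t))) has_derivative
        (\<lambda>v. integral (cbox 0 1) (\<lambda>t. (\<phi> t * t) *\<^sub>R ?f' (P z t) v) + integral (cbox 0 1) (\<lambda>t. (\<phi> t * (1 - t)) *\<^sub>R ?f' (P z t) (Q v)))) (at z)"
      if z: "z \<in> S" for z
    proof -
      have "((\<lambda>z. integral (cbox 0 1) (\<lambda>t. \<phi> t *\<^sub>R f (P z t))) has_derivative integral (cbox 0 1) (F z)) (at z within S)"
        by (rule leibniz_rule[OF _ int contF z assms(2)])
          (use derD F cf Suc.prems(2) in \<open>auto intro: has_derivative_at_withinI\<close>)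
      moreover have "blinfun_apply (integral (cbox 0 1) (F z)) v = integral (cbox 0 1) (\<lambda>t. (\<phi> t * t) *\<^sub>R ?f' (P z t) v) + integral (cbox 0 1) (\<lambda>t. (\<phi> t * (1 - t)) *\<^sub>R ?f' (P z t) (Q v))" for v
      proof -
        have "F z integrable_on cbox 0 1"
        proof (rule integrable_continuous)
          have "continuous_on (cbox 0 1) ((\<lambda>(z, t). F z t) \<circ> (\<lambda>t. (z, t)))"
            by (rule continuous_on_compose[OF _ continuous_on_subset[OF contF]]) (use z in \<open>auto intro: continuous_intros\<close>)
          then show "continuous_on (cbox 0 1) (F z)" by (simp add: o_def)
        qed
        then have "blinfun_apply (integral (cbox 0 1) (F z)) v = integral (cbox 0 1) (\<lambda>t. F z t v)"
          by (simp add: blinfun_apply_integral)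
        also have "\<dots> = integral (cbox 0 1) (\<lambda>t. (\<phi> t * t) *\<^sub>R ?f' (P z t) v + (\<phi> t * (1 - t)) *\<^sub>R ?f' (P z t) (Q v))"
          by (rule Henstock_Kurzweil_Integration.integral_cong) (use F splitD z in auto)
        also have "\<dots> = integral (cbox 0 1) (\<lambda>t. (\<phi> t * t) *\<^sub>R ?f' (P z t) v) + integral (cbox 0 1) (\<lambda>t. (\<phi> t * (1 - t)) *\<^sub>R ?f' (P z t) (Q v))"
          by (intro Henstock_Kurzweil_Integration.integral_add int z cf' continuous_intros Suc.prems(2))
        finally show ?thesis .
      qed
      ultimately show ?thesis
        using at_within_open[OF z assms(1)] by (metis (no_types, lifting) ext)
    qed
    have "Ck_on (Suc k) S (\<lambda>z. integral (cbox 0 1) (\<lambda>t. \<phi> t *\<^sub>R f (P z t)))"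
    proof (rule Ck_on_Suc_I[OF assms(1) G])
      show "Ck_on k S (\<lambda>x. integral (cbox 0 1) (\<lambda>t. (\<phi> t * t) *\<^sub>R ?f' (P x t) v) +
              integral (cbox 0 1) (\<lambda>t. (\<phi> t * (1 - t)) *\<^sub>R ?f' (P x t) (Q v)))" for v
      proof (intro Ck_on_add[OF assms(1)])
        have c: "continuous_on UNIV (\<lambda>t. \<phi> t * t)" "continuous_on UNIV (\<lambda>t. \<phi> t * (1 - t))"
          by (intro continuous_intros Suc.prems(2))+
        have d: "Ck_on k S (\<lambda>z. ?f' z w)" for w using Suc.prems(1) by simp
        show "Ck_on k S (\<lambda>x. integral (cbox 0 1) (\<lambda>t. (\<phi> t * t) *\<^sub>R ?f' (P x t) v))"
          using Suc.IH[OF d c(1)] by (simp add: P_def)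
        show "Ck_on k S (\<lambda>x. integral (cbox 0 1) (\<lambda>t. (\<phi> t * (1 - t)) *\<^sub>R ?f' (P x t) (Q v)))"
          using Suc.IH[OF d c(2)] by (simp add: P_def)
      qed
    qed
    then show ?case by (simp add: P_def)
  }
qed

text \<open>For \<open>h\<close> vanishing on the hyperplane, the value there is forced:
  \<open>h / z\<^sub>i\<close> tends to the partial derivative in direction
  \<open>i\<close>.\<close>

definition coord_quot :: "'n::finite \<Rightarrow> (real^'n \<Rightarrow> 'b::real_normed_vector) \<Rightarrow> real^'n \<Rightarrow> 'b" where
  "coord_quot i h z = (if z $ i = 0 then frechet_derivative h (at z) (axis i 1) else h z /\<^sub>R (z $ i))"

lemma coord_quot_mult:
  assumes "z $ i = 0 \<Longrightarrow> h z = 0"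
  shows "(z $ i) *\<^sub>R coord_quot i h z = h z"
  using assms by (auto simp: coord_quot_def)

text \<open>Hadamard's lemma. With \<open>Q\<close> the projection to the hyperplane, integrating
  along the segment from \<open>Q z\<close> to \<open>z\<close> writes \<open>h z\<close> as
  \<open>z\<^sub>i\<close> times the mean of the \<open>i\<close>-th partial derivative, and this
  mean depends smoothly on \<open>z\<close>.\<close>

lemma smooth_on_coord_quot:
  fixes h :: "real^'n::finite \<Rightarrow> 'b::euclidean_space"
  assumes "open S" "smooth_on S h" "\<And>z. z \<in> S \<Longrightarrow> z $ i = 0 \<Longrightarrow> h z = 0"
  shows "smooth_on S (coord_quot i h)"
proof (rule smooth_on_local)
  fix z0 assume z0: "z0 \<in> S"
  show "\<exists>T. open T \<and> z0 \<in> T \<and> smooth_on T (coord_quot i h)"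
  proof (cases "z0 $ i = 0")
    case False
    let ?T = "S \<inter> {z. z $ i \<noteq> 0}"
    have "{z::real^'n. z $ i \<noteq> 0} = - {z. z $ i = 0}" by auto
    moreover have "closed {z::real^'n. z $ i = 0}" by (intro closed_Collect_eq continuous_intros)
    ultimately have T: "open ?T" using assms(1) by (metis open_Compl open_Int)
    have "smooth_on ?T (\<lambda>z. inverse (z $ i) *\<^sub>R h z)"
      by (intro smooth_on_scaleR smooth_on_inverse smooth_on_nth T smooth_on_id smooth_on_subset[OF assms(2)]) auto
    then have "smooth_on ?T (coord_quot i h)"
      by (subst smooth_on_cong[OF T, of _ "\<lambda>z. inverse (z $ i) *\<^sub>R h z"]) (auto simp: coord_quot_def)
    then show ?thesis using T False z0 by blast
  next
    case True
    obtain e where e: "e > 0" "ball z0 e \<subseteq> S" using assms(1) z0 open_contains_ball by blast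
    let ?T = "ball z0 e"
    define Q where "Q = (\<lambda>z::real^'n. z - (z $ i) *\<^sub>R axis i 1)"
    have Q: "linear Q" unfolding Q_def by (auto intro!: linearI simp: algebra_simps)
    have Qi: "Q z $ i = 0" "Q z = z \<longleftrightarrow> z $ i = 0" for z
      by (auto simp: Q_def)
    \<comment> \<open>The centre of the ball lies on the hyperplane, so dropping the
      \<open>i\<close>-th coordinate does not increase the distance to it.\<close>
    have QT: "Q z \<in> ?T" if "z \<in> ?T" for z
    proof -
      have "norm (Q z - z0) \<le> norm (z - z0)"
        by (rule norm_le_componentwise_cart) (auto simp: Q_def axis_def True)
      then show ?thesis using that by (simp add: dist_norm norm_minus_commute)
    qed
    let ?g = "\<lambda>z. integral {0..1} (\<lambda>t. (1::real) *\<^sub>R frechet_derivative h (at (t *\<^sub>R z + (1 - t) *\<^sub>R Q z)) (axis i 1))"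
    have sm: "smooth_on ?T ?g"
      unfolding smooth_on_def
    proof
      fix k
      have "Ck_on k S (\<lambda>z. frechet_derivative h (at z) (axis i 1))"
        using smooth_on_frechet[OF assms(2)] by (simp add: smooth_on_def)
      then show "Ck_on k ?T ?g"
        by (intro Ck_on_weighted_segment_integral Q QT continuous_on_const) (use e Ck_on_subset in auto)
    qed
    have "?g z = coord_quot i h z" if z: "z \<in> ?T" for z
    proof -
      let ?\<gamma> = "\<lambda>t. t *\<^sub>R z + (1 - t) *\<^sub>R Q z"
      have in_T: "?\<gamma> t \<in> ?T" if "t \<in> {0..1}" for t
        using convexD[OF convex_ball z QT[OF z], of t "1 - t"] that by auto
      have "((\<lambda>t. frechet_derivative h (at (?\<gamma> t)) (z - Q z)) has_integral (h (?\<gamma> 1) - h (?\<gamma> 0))) {0..1}"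
      proof (rule fundamental_theorem_of_calculus)
        fix t :: real assume t: "t \<in> {0..1}"
        have "(h has_derivative frechet_derivative h (at (?\<gamma> t))) (at (?\<gamma> t))"
          using smooth_on_has_derivative[OF assms(2)] in_T[OF t] e by auto
        moreover have "(?\<gamma> has_derivative (\<lambda>s. s *\<^sub>R (z - Q z))) (at t within {0..1})"
          by (auto intro!: derivative_eq_intros simp: algebra_simps)
        ultimately have "((\<lambda>t. h (?\<gamma> t)) has_derivative (\<lambda>s. frechet_derivative h (at (?\<gamma> t)) (s *\<^sub>R (z - Q z)))) (at t within {0..1})"
          using has_derivative_compose[of ?\<gamma>] by blast
        moreover have "linear (frechet_derivative h (at (?\<gamma> t)))"
          using smooth_on_linear_derivative[OF assms(2)] in_T[OF t] e by auto
        ultimately show "((\<lambda>t. h (?\<gamma> t)) has_vector_derivative frechet_derivative h (at (?\<gamma> t)) (z - Q z)) (at t within {0..1})"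
          by (simp add: has_vector_derivative_def linear_scale)
      qed auto
      moreover have "h (Q z) = 0" using assms(3) QT[OF z] e Qi by auto
      ultimately have I0: "((\<lambda>t. frechet_derivative h (at (?\<gamma> t)) (z - Q z)) has_integral h z) {0..1}"
        by simp
      have eq: "frechet_derivative h (at (?\<gamma> t)) (z - Q z) = (z $ i) *\<^sub>R frechet_derivative h (at (?\<gamma> t)) (axis i 1)"
        if t: "t \<in> {0..1}" for t
      proof -
        have "?\<gamma> t \<in> S" using in_T[OF t] e by blast
        moreover have "z - Q z = (z $ i) *\<^sub>R axis i 1" by (simp add: Q_def)
        ultimately show ?thesis
          using smooth_on_linear_derivative[OF assms(2)] linear_scale by metis
      qed
      have I: "((\<lambda>t. (z $ i) *\<^sub>R frechet_derivative h (at (?\<gamma> t)) (axis i 1)) has_integral h z) {0..1}"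
        by (rule has_integral_eq[OF eq I0])
      show ?thesis
      proof (cases "z $ i = 0")
        case True
        then have "Q z = z" by (simp add: Q_def)
        then have "?\<gamma> t = z" for t by (simp add: scaleR_left_diff_distrib)
        then show ?thesis by (simp add: coord_quot_def True)
      next
        case False
        have "((\<lambda>t. inverse (z $ i) *\<^sub>R (z $ i) *\<^sub>R frechet_derivative h (at (?\<gamma> t)) (axis i 1)) has_integral inverse (z $ i) *\<^sub>R h z) {0..1}"
          by (rule has_integral_cmul[OF I])
        then show ?thesis using False by (simp add: coord_quot_def integral_unique)
      qed
    qed
    then have "smooth_on ?T (coord_quot i h)"
      using smooth_on_cong[of ?T ?g "coord_quot i h"] sm by (simp del: scaleR_one)
    then show ?thesis using e z0 by (meson centre_in_ball open_ball)
  qed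
qed

section \<open>Extending spans of smooth frames across a coordinate hyperplane\<close>

lemma off_hyperplane_sequence:
  fixes z :: "real^'n::finite"
  assumes "open S" "z \<in> S"
  obtains s where "\<And>n. s n \<in> S" "\<And>n. s n $ i \<noteq> 0" "s \<longlonglongrightarrow> z"
proof -
  let ?s = "\<lambda>n. if z $ i = 0 then z + inverse (real (Suc n)) *\<^sub>R axis i 1 else z"
  have lim: "?s \<longlonglongrightarrow> z"
  proof (cases "z $ i = 0")
    case True
    have "(\<lambda>n. z + inverse (real (Suc n)) *\<^sub>R axis i 1) \<longlonglongrightarrow> z + 0 *\<^sub>R axis i 1"
      by (intro tendsto_intros LIMSEQ_inverse_real_of_nat)
    then show ?thesis using True by simp
  qed simp
  obtain N where N: "\<And>n. n \<ge> N \<Longrightarrow> ?s n \<in> S"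
    using topological_tendstoD[OF lim assms] unfolding eventually_sequentially by blast
  show thesis
    by (rule that[of "\<lambda>n. ?s (n + N)"]) (use N LIMSEQ_ignore_initial_segment[OF lim, of N] in \<open>auto simp: axis_def\<close>)
qed

lemma eq_if_eq_off_hyperplane:
  fixes f g :: "real^'n::finite \<Rightarrow> 'b::t2_space"
  assumes "open S" "continuous_on S f" "continuous_on S g" "z \<in> S"
    and "\<And>z. z \<in> S \<Longrightarrow> z $ i \<noteq> 0 \<Longrightarrow> f z = g z"
  shows "f z = g z"
proof -
  obtain s where s: "\<And>n. s n \<in> S" "\<And>n. s n $ i \<noteq> 0" "s \<longlonglongrightarrow> z"
    using off_hyperplane_sequence[OF assms(1,4), of i] by blast
  have "(\<lambda>n. f (s n)) \<longlonglongrightarrow> f z" "(\<lambda>n. g (s n)) \<longlonglongrightarrow> g z"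
    using s by (auto intro: continuous_on_tendsto_compose[OF assms(2) s(3) assms(4)]
        continuous_on_tendsto_compose[OF assms(3) s(3) assms(4)])
  then show ?thesis using LIMSEQ_unique assms(5)[OF s(1,2)] by auto
qed

section \<open>Changing one member of a family: spans and Gram determinants\<close>

lemma span_range_update_diff:
  assumes "x \<in> span (f ` (- {k}))"
  shows "span (range (f(k := f k - x))) = span (range f)"
proof -
  have x: "x \<in> span (range f)" using assms span_mono[of "f ` (- {k})" "range f"] by auto
  have x': "x \<in> span (range (f(k := f k - x)))"
    using assms span_mono[of "f ` (- {k})" "range (f(k := f k - x))"] by (auto simp: image_def)
  have "range (f(k := f k - x)) \<subseteq> span (range f)"
    using x by (auto intro: span_diff span_base)
  moreover have "f j \<in> span (range (f(k := f k - x)))" for j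
  proof (cases "j = k")
    case True
    have "f k = (f(k := f k - x)) k + x" by simp
    then show ?thesis using x' True by (metis span_add span_base rangeI)
  next
    case False
    then have "f j = (f(k := f k - x)) j" by simp
    then show ?thesis by (metis span_base rangeI)
  qed
  ultimately show ?thesis by (simp add: span_eq image_subset_iff)
qed

lemma span_range_update_scale:
  fixes f :: "'k \<Rightarrow> 'b::real_vector"
  assumes "f k = c *\<^sub>R y" "c \<noteq> 0"
  shows "span (range (f(k := y))) = span (range f)"
proof -
  have "y = inverse c *\<^sub>R f k" using assms by simp
  then have "range (f(k := y)) \<subseteq> span (range f)"
    by (auto intro: span_scale span_base)
  moreover have "f j \<in> span (range (f(k := y)))" for j
  proof (cases "j = k")
    case True
    have "f k = c *\<^sub>R (f(k := y)) k" using assms by simp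
    then show ?thesis using True by (metis span_scale span_base rangeI)
  next
    case False
    then have "f j = (f(k := y)) j" by simp
    then show ?thesis by (metis span_base rangeI)
  qed
  ultimately show ?thesis by (simp add: span_eq image_subset_iff)
qed

text \<open>The determinant is taken between two families and not of one with itself: it is then
  multilinear in \<open>f\<close> while \<open>g\<close> stays fixed, and dividing one member of
  \<open>f\<close> by \<open>z\<^sub>i\<close> lowers the order of vanishing by exactly one.\<close>

definition cross_gram :: "('k::finite \<Rightarrow> 'b::real_inner) \<Rightarrow> ('k \<Rightarrow> 'b) \<Rightarrow> real" where
  "cross_gram f g = det (\<chi> k l. f k \<bullet> g l :: real^'k^'k)"

text \<open>Taking inner products with all \<open>g l\<close> is linear, so subtracting a
  combination of the other members is a row operation.\<close>

lemma cross_gram_update_diff: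
  fixes f g :: "'k::finite \<Rightarrow> 'b::real_inner"
  assumes "x \<in> span (f ` (- {k}))"
  shows "cross_gram (f(k := f k - x)) g = cross_gram f g"
proof -
  define T where "T = (\<lambda>y. \<chi> l. y \<bullet> g l :: real^'k)"
  have T: "linear T" by (auto simp: T_def vec_eq_iff inner_add_left intro!: linearI)
  define A where "A = (\<chi> k. T (f k))"
  have row: "row j A = T (f j)" for j by (simp add: A_def row_def vec_eq_iff)
  have "T x \<in> span (T ` f ` (- {k}))"
    unfolding linear_span_image[OF T] using assms by simp
  then have "- T x \<in> span (T ` f ` (- {k}))" by (rule span_neg)
  moreover have "T ` f ` (- {k}) = {row j A |j. j \<noteq> k}" by (auto simp: row)
  ultimately have "det (\<chi> j. if j = k then row k A + - T x else row j A) = det A"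
    by (intro det_row_span) (simp add: span_vec_eq)
  moreover have "(\<chi> j. if j = k then row k A + - T x else row j A) = (\<chi> j. T ((f(k := f k - x)) j))"
    by (simp add: vec_eq_iff row linear_diff[OF T])
  ultimately show ?thesis by (simp add: cross_gram_def A_def T_def)
qed

lemma cross_gram_update_scale:
  fixes f g :: "'k::finite \<Rightarrow> 'b::real_inner"
  assumes "f k = c *\<^sub>R y"
  shows "cross_gram f g = c * cross_gram (f(k := y)) g"
proof -
  have 1: "(\<chi> a l. f a \<bullet> g l) = (\<chi> a. if a = k then c *s (\<chi> l. y \<bullet> g l) else (\<chi> l. f a \<bullet> g l))"
    by (simp add: vec_eq_iff assms)
  have 2: "(\<chi> a l. (f(k := y)) a \<bullet> g l) = (\<chi> a. if a = k then (\<chi> l. y \<bullet> g l) else (\<chi> l. f a \<bullet> g l))"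
    by (simp add: vec_eq_iff)
  show ?thesis unfolding cross_gram_def 1 2 by (rule det_row_mul)
qed

text \<open>A kernel vector of the Gram matrix gives a combination \<open>y\<close> of the
  \<open>f k\<close> that is orthogonal to all of them, hence to itself.\<close>

lemma cross_gram_nonzero:
  fixes f :: "'k::finite \<Rightarrow> 'b::real_inner"
  assumes "inj f" "independent (range f)"
  shows "cross_gram f f \<noteq> 0"
proof
  let ?A = "(\<chi> k l. f k \<bullet> f l) :: real^'k^'k"
  assume "cross_gram f f = 0"
  then have "\<not> invertible ?A" by (simp add: cross_gram_def invertible_det_nz)
  then have "\<not> (\<exists>B. B ** ?A = mat 1)"
    by (metis invertible_def matrix_left_right_inverse)
  then obtain v where v: "?A *v v = 0" "v \<noteq> 0" using matrix_left_invertible_ker by blast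
  define y where "y = (\<Sum>l\<in>UNIV. v $ l *\<^sub>R f l)"
  have "f k \<bullet> y = 0" for k
  proof -
    have "f k \<bullet> y = (?A *v v) $ k"
      by (simp add: y_def inner_sum_right matrix_vector_mult_def mult.commute)
    then show ?thesis using v by simp
  qed
  then have "y \<bullet> y = 0" unfolding y_def by (simp add: inner_sum_left)
  then have "y = 0" by simp
  moreover have "y = (\<Sum>b\<in>range f. v $ (inv f b) *\<^sub>R b)"
    unfolding y_def by (subst sum.reindex[OF assms(1)]) (simp add: inv_f_f[OF assms(1)])
  ultimately have *: "v $ (inv f b) = 0" if "b \<in> range f" for b
    using independentD[OF assms(2) _ order_refl, of "\<lambda>b. v $ (inv f b)"] that by auto
  have "v $ k = 0" for k using *[of "f k"] inv_f_f[OF assms(1), of k] by simp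
  then show False using v(2) by (simp add: vec_eq_iff)
qed

lemma continuous_on_cross_gram:
  fixes F G :: "'k::finite \<Rightarrow> 'a::topological_space \<Rightarrow> 'b::real_inner"
  assumes "\<And>k. continuous_on S (F k)" "\<And>k. continuous_on S (G k)"
  shows "continuous_on S (\<lambda>z. cross_gram (\<lambda>k. F k z) (\<lambda>k. G k z))"
  unfolding cross_gram_def det_def
  by (intro continuous_intros) (use assms in \<open>auto intro!: continuous_intros\<close>)

text \<open>The Gram determinant of \<open>F\<close> against a fixed family is not infinitely flat on the hyperplane
  \<open>z\<^sub>i = 0\<close>. Orthogonalise the members of \<open>F\<close> one by one; one which becomes zero on the hyperplane
  can be divided by \<open>z\<^sub>i\<close>, which lowers the order of vanishing of that determinant.\<close>

lemma exists_orthogonal_frame_near_hyperplane: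
  fixes F G :: "'k::finite \<Rightarrow> real^'n::finite \<Rightarrow> 'b::euclidean_space"
  assumes "open S" "z0 \<in> S" "z0 $ i = 0"
    and "\<And>k. smooth_on S (F k)" "\<And>k. continuous_on S (G k)"
    and "\<And>k z. k \<in> J \<Longrightarrow> z \<in> S \<Longrightarrow> F k z \<noteq> 0"
    and "\<And>k l z. k \<in> J \<Longrightarrow> l \<in> J \<Longrightarrow> k \<noteq> l \<Longrightarrow> z \<in> S \<Longrightarrow> F k z \<bullet> F l z = 0"
    and "continuous_on S w" "\<And>z. z \<in> S \<Longrightarrow> w z \<noteq> 0"
    and "\<And>z. z \<in> S \<Longrightarrow> z $ i \<noteq> 0 \<Longrightarrow> cross_gram (\<lambda>k. F k z) (\<lambda>k. G k z) = (z $ i) ^ e * w z"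
  shows "\<exists>S' (F' :: 'k \<Rightarrow> real^'n \<Rightarrow> 'b). open S' \<and> S' \<subseteq> S \<and> (\<exists>z\<in>S'. z $ i = 0) \<and> (\<forall>k. smooth_on S' (F' k)) \<and>
           (\<forall>z\<in>S'. \<forall>k. F' k z \<noteq> 0) \<and> (\<forall>z\<in>S'. \<forall>k l. k \<noteq> l \<longrightarrow> F' k z \<bullet> F' l z = 0) \<and>
           (\<forall>z\<in>S'. z $ i \<noteq> 0 \<longrightarrow> span (range (\<lambda>k. F' k z)) = span (range (\<lambda>k. F k z)))"
  using assms
\<comment> \<open>\<open>J\<close> collects the members that are already nonzero and mutually
  orthogonal on \<open>S\<close>. Each round either enlarges \<open>J\<close> or lowers the exponent
  \<open>e\<close> and keeps \<open>J\<close>.\<close>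
proof (induction "e + card (- J)" arbitrary: e J S F z0 rule: less_induct)
  case less
  note S = less.prems(1) and F = less.prems(4) and nz = less.prems(6) and orth = less.prems(7)
  show ?case
  proof (cases "J = UNIV")
    case True
    show ?thesis
      by (rule exI[of _ S], rule exI[of _ F]) (use less.prems True in auto)
  next
    case False
    then obtain k where k: "k \<notin> J" by auto
    \<comment> \<open>The orthogonal projection of \<open>F k\<close> to the span of the finished
      members; it is smooth because these have no zeros in \<open>S\<close>.\<close>
    define p where "p = (\<lambda>z. \<Sum>j\<in>J. ((F k z \<bullet> F j z) / (F j z \<bullet> F j z)) *\<^sub>R F j z)"
    define F1 where "F1 = F(k := (\<lambda>z. F k z - p z))"
    have F1_at: "(\<lambda>j. F1 j z) = (\<lambda>j. F j z)(k := F k z - p z)" for z by (auto simp: F1_def)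
    have p_smooth: "smooth_on S p"
      unfolding p_def
      by (intro smooth_on_sum smooth_on_scaleR smooth_on_divide smooth_on_inner S F) (use nz in auto)
    have F1: "smooth_on S (F1 j)" for j
      using F p_smooth by (auto simp: F1_def intro: smooth_on_diff[OF S])
    have p_span: "p z \<in> span ((\<lambda>j. F j z) ` (- {k}))" for z
      unfolding p_def using k by (intro span_sum span_scale span_base) auto
    have span1: "span (range (\<lambda>j. F1 j z)) = span (range (\<lambda>j. F j z))" for z
      unfolding F1_at by (rule span_range_update_diff[OF p_span])
    have gram1: "cross_gram (\<lambda>j. F1 j z) (\<lambda>j. G j z) = cross_gram (\<lambda>j. F j z) (\<lambda>j. G j z)" for z
      unfolding F1_at by (rule cross_gram_update_diff[OF p_span])
    have orth1: "F1 k z \<bullet> F j z = 0" if "j \<in> J" "z \<in> S" for j z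
    proof -
      have "p z \<bullet> F j z = (\<Sum>l\<in>J. ((F k z \<bullet> F l z) / (F l z \<bullet> F l z)) * (F l z \<bullet> F j z))"
        by (simp add: p_def inner_sum_left)
      also have "\<dots> = (\<Sum>l\<in>J. if l = j then F k z \<bullet> F j z else 0)"
        by (rule sum.cong) (use that nz[OF that] orth[OF _ that(1) _ that(2)] in auto)
      also have "\<dots> = F k z \<bullet> F j z" using that by simp
      finally show ?thesis by (simp add: F1_def inner_diff_left)
    qed
    show ?thesis
    proof (cases "\<exists>z1\<in>S. z1 $ i = 0 \<and> F1 k z1 \<noteq> 0")
      case True
      then obtain z1 where z1: "z1 \<in> S" "z1 $ i = 0" "F1 k z1 \<noteq> 0" by blast
      \<comment> \<open>The new base point \<open>z1\<close> keeps the shrunken set in contact with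
        the hyperplane; the old \<open>z0\<close> may be lost.\<close>
      define S2 where "S2 = S \<inter> F1 k -` (- {0})"
      have "open S2" unfolding S2_def
        by (rule continuous_open_preimage[OF smooth_on_imp_continuous_on[OF F1] S]) auto
      have sub: "S2 \<subseteq> S" by (auto simp: S2_def)
      have "- J = insert k (- insert k J)" using k by auto
      then have "card (- insert k J) < card (- J)"
        using card_insert_disjoint[of "- insert k J" k] by auto
      then have "\<exists>S' (F' :: 'k \<Rightarrow> real^'n \<Rightarrow> 'b). open S' \<and> S' \<subseteq> S2 \<and> (\<exists>z\<in>S'. z $ i = 0) \<and> (\<forall>k. smooth_on S' (F' k)) \<and>
           (\<forall>z\<in>S'. \<forall>k. F' k z \<noteq> 0) \<and> (\<forall>z\<in>S'. \<forall>k l. k \<noteq> l \<longrightarrow> F' k z \<bullet> F' l z = 0) \<and>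
           (\<forall>z\<in>S'. z $ i \<noteq> 0 \<longrightarrow> span (range (\<lambda>k. F' k z)) = span (range (\<lambda>k. F1 k z)))"
        (is "\<exists>S' F'. ?P S' F'")
      proof (intro less.hyps[of e "insert k J" S2 z1])
        show "F1 a z \<noteq> 0" if "a \<in> insert k J" "z \<in> S2" for a z
          using that nz[of a z] by (cases "a = k") (auto simp: S2_def F1_def)
        show "F1 a z \<bullet> F1 b z = 0" if "a \<in> insert k J" "b \<in> insert k J" "a \<noteq> b" "z \<in> S2" for a b z
          using that orth[of a b z] orth1[of a z] orth1[of b z] sub
          by (cases "a = k"; cases "b = k") (auto simp: F1_def inner_commute)
        show "cross_gram (\<lambda>k. F1 k z) (\<lambda>k. G k z) = (z $ i) ^ e * w z" if "z \<in> S2" "z $ i \<noteq> 0" for z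
          using less.prems(10)[of z] that sub gram1 by auto
      qed (use less.prems z1 \<open>open S2\<close> sub smooth_on_subset[OF F1 sub] in \<open>auto simp: S2_def intro: continuous_on_subset\<close>)
      then obtain S' F' where "?P S' F'" by (elim exE)
      then show ?thesis
        by (intro exI[of _ S'], intro exI[of _ F']) (use sub span1 in auto)
    next
      case False
      then have van: "F1 k z = 0" if "z \<in> S" "z $ i = 0" for z using that by blast
      \<comment> \<open>Since \<open>k\<close> is not in \<open>J\<close>, the finished members are
        untouched. The span is preserved only where \<open>z\<^sub>i\<close> is nonzero, which is
        all that the conclusion asks for.\<close>
      define F2 where "F2 = F1(k := coord_quot i (F1 k))"
      have F2_at: "(\<lambda>j. F2 j z) = (\<lambda>j. F1 j z)(k := coord_quot i (F1 k) z)" for z by (auto simp: F2_def)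
      have F2: "smooth_on S (F2 j)" for j
        using F1 van by (auto simp: F2_def intro!: smooth_on_coord_quot[OF S])
      have quot: "F1 k z = (z $ i) *\<^sub>R coord_quot i (F1 k) z" if "z \<in> S" for z
        using coord_quot_mult[of z i "F1 k"] van[OF that] by simp
      have span2: "span (range (\<lambda>j. F2 j z)) = span (range (\<lambda>j. F j z))" if "z \<in> S" "z $ i \<noteq> 0" for z
        unfolding F2_at span1[symmetric]
        by (rule span_range_update_scale[of "\<lambda>j. F1 j z" k, OF quot[OF that(1)] that(2)])
      have gram2: "cross_gram (\<lambda>j. F j z) (\<lambda>j. G j z) = z $ i * cross_gram (\<lambda>j. F2 j z) (\<lambda>j. G j z)"
        if "z \<in> S" for z
        unfolding F2_at gram1[symmetric]
        by (rule cross_gram_update_scale[of "\<lambda>j. F1 j z" k, OF quot[OF that(1)]])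
      show ?thesis
      proof (cases e)
        \<comment> \<open>With exponent zero there is nothing left to divide: off the hyperplane
          \<open>z\<^sub>i\<close> times the new determinant equals \<open>w\<close>, and continuity
          at \<open>z0\<close> would force \<open>w z0 = 0\<close>.\<close>
        case 0
        have "z0 $ i * cross_gram (\<lambda>j. F2 j z0) (\<lambda>j. G j z0) = w z0"
        proof (rule eq_if_eq_off_hyperplane[OF S _ less.prems(8) less.prems(2)])
          show "continuous_on S (\<lambda>z. z $ i * cross_gram (\<lambda>j. F2 j z) (\<lambda>j. G j z))"
            by (intro continuous_intros continuous_on_cross_gram smooth_on_imp_continuous_on[OF F2] less.prems(5))
          show "z $ i * cross_gram (\<lambda>j. F2 j z) (\<lambda>j. G j z) = w z" if "z \<in> S" "z $ i \<noteq> 0" for z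
            using less.prems(10)[OF that] gram2[OF that(1)] 0 by simp
        qed
        then show ?thesis using less.prems(3) less.prems(9)[OF less.prems(2)] by simp
      next
        case (Suc e')
        have "\<exists>S' (F' :: 'k \<Rightarrow> real^'n \<Rightarrow> 'b). open S' \<and> S' \<subseteq> S \<and> (\<exists>z\<in>S'. z $ i = 0) \<and> (\<forall>k. smooth_on S' (F' k)) \<and>
           (\<forall>z\<in>S'. \<forall>k. F' k z \<noteq> 0) \<and> (\<forall>z\<in>S'. \<forall>k l. k \<noteq> l \<longrightarrow> F' k z \<bullet> F' l z = 0) \<and>
           (\<forall>z\<in>S'. z $ i \<noteq> 0 \<longrightarrow> span (range (\<lambda>k. F' k z)) = span (range (\<lambda>k. F2 k z)))"
          (is "\<exists>S' F'. ?P S' F'")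
        proof (intro less.hyps[of e' J S z0])
          have F2J: "F2 j = F j" if "j \<in> J" for j using that k by (auto simp: F2_def F1_def)
          show "F2 a z \<noteq> 0" if "a \<in> J" "z \<in> S" for a z
            using that nz[of a z] F2J by simp
          show "F2 a z \<bullet> F2 b z = 0" if "a \<in> J" "b \<in> J" "a \<noteq> b" "z \<in> S" for a b z
            using that orth[of a b z] F2J by simp
          show "cross_gram (\<lambda>k. F2 k z) (\<lambda>k. G k z) = (z $ i) ^ e' * w z" if "z \<in> S" "z $ i \<noteq> 0" for z
            using less.prems(10)[OF that] gram2[OF that(1)] Suc that by simp
        qed (use less.prems F2 Suc in auto)
        then obtain S' F' where *: "?P S' F'" by (elim exE)
        then have sub: "S' \<subseteq> S" by (elim conjE)
        show ?thesis
          by (intro exI[of _ S'], intro exI[of _ F']) (use * span2 sub in auto)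
      qed
    qed
  qed
qed

section \<open>Lagrangian subspaces\<close>

text \<open>Twice the pairing of generalised tangent vectors, read in coordinates.\<close>

definition copairing :: "(real^'n::finite) \<times> (real^'n) \<Rightarrow> (real^'n::finite) \<times> (real^'n) \<Rightarrow> real" where
  "copairing x y = snd x \<bullet> fst y + snd y \<bullet> fst x"

text \<open>For this form of signature \<open>(n, n)\<close>, being one's own orthogonal is the same
  as being maximally isotropic, but it replaces a quantification over larger subspaces by
  equations.\<close>

definition lagrangian :: "((real^'n::finite) \<times> (real^'n)) set \<Rightarrow> bool" where
  "lagrangian K \<longleftrightarrow> K = {x. \<forall>y\<in>K. copairing x y = 0}"

lemma copairing_commute: "copairing x y = copairing y x"
  by (simp add: copairing_def)

lemma copairing_inner_swap: "copairing x y = x \<bullet> prod.swap y"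
  by (simp add: copairing_def inner_prod_def inner_commute)

lemma linear_swap: "linear (prod.swap :: ('a::real_vector) \<times> 'a \<Rightarrow> _)"
  by (auto intro!: linearI simp: prod.swap_def)

lemma bounded_bilinear_copairing: "bounded_bilinear copairing"
proof -
  have s: "bounded_linear (prod.swap :: (real^'n) \<times> (real^'n) \<Rightarrow> _)"
    using linear_swap linear_conv_bounded_linear by blast
  show ?thesis unfolding copairing_inner_swap
    using bounded_bilinear.comp[OF bounded_bilinear_inner bounded_linear_ident s] .
qed

interpretation copairing: bounded_bilinear copairing
  by (rule bounded_bilinear_copairing)


lemma subspace_copairing_orthogonal: "subspace {x. \<forall>y\<in>K. copairing x y = 0}"
  by (auto simp: subspace_def copairing.zero_left copairing.add_left copairing.scaleR_left)

text \<open>Swapping the two components turns the form into the Euclidean inner product on a space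
  of dimension \<open>2n\<close>, where the dimension of orthogonal complements is known.\<close>

lemma dim_copairing_orthogonal:
  fixes K :: "((real^'n::finite) \<times> (real^'n)) set"
  assumes "subspace K"
  shows "dim {x. \<forall>y\<in>K. copairing x y = 0} + dim K = 2 * CARD('n)"
proof -
  have "subspace (prod.swap ` K)" by (rule linear_subspace_image[OF linear_swap assms])
  from dim_subspace_orthogonal_to_vectors[OF this subspace_UNIV]
  have "dim {x. \<forall>y\<in>K. orthogonal (prod.swap y) x} + dim (prod.swap ` K) = 2 * CARD('n)"
    by (simp add: dim_UNIV)
  moreover have "dim (prod.swap ` K) = dim K"
    by (rule dim_image_eq[OF linear_swap]) (auto simp: inj_on_def prod_eq_iff)
  ultimately show ?thesis by (simp add: orthogonal_def copairing_inner_swap inner_commute)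
qed

lemma lagrangian_mem_iff:
  assumes "lagrangian K"
  shows "x \<in> K \<longleftrightarrow> (\<forall>y\<in>K. copairing x y = 0)"
proof -
  have "x \<in> K \<longleftrightarrow> x \<in> {x. \<forall>y\<in>K. copairing x y = 0}"
    using assms unfolding lagrangian_def by (rule arg_cong)
  then show ?thesis by simp
qed

lemma lagrangian_subspace:
  assumes "lagrangian K"
  shows "subspace K"
  by (subst assms[unfolded lagrangian_def]) (rule subspace_copairing_orthogonal)

lemma lagrangian_dim:
  fixes K :: "((real^'n::finite) \<times> (real^'n)) set"
  assumes "lagrangian K"
  shows "dim K = CARD('n)"
proof -
  have "dim K = dim {x. \<forall>y\<in>K. copairing x y = 0}"
    using assms unfolding lagrangian_def by (rule arg_cong)
  then show ?thesis using dim_copairing_orthogonal[OF lagrangian_subspace[OF assms]] by linarith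
qed

text \<open>An isotropic subspace lies in its orthogonal; in dimension \<open>n\<close> the two have
  equal dimension and so coincide.\<close>

lemma lagrangianI_dim:
  fixes K :: "((real^'n::finite) \<times> (real^'n)) set"
  assumes "subspace K" "dim K = CARD('n)" "\<And>x y. x \<in> K \<Longrightarrow> y \<in> K \<Longrightarrow> copairing x y = 0"
  shows "lagrangian K"
  unfolding lagrangian_def
proof (rule subspace_dim_equal[OF assms(1) subspace_copairing_orthogonal])
  show "dim {x. \<forall>y\<in>K. copairing x y = 0} \<le> dim K"
    using dim_copairing_orthogonal[OF assms(1)] assms(2) by simp
qed (use assms(3) in auto)

lemma copairing_span:
  assumes "\<And>x y. x \<in> X \<Longrightarrow> y \<in> Y \<Longrightarrow> copairing x y = 0" "x \<in> span X" "y \<in> span Y"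
  shows "copairing x y = 0"
proof -
  have "span X \<subseteq> {x. \<forall>y\<in>Y. copairing x y = 0}"
    by (rule span_minimal[OF _ subspace_copairing_orthogonal]) (use assms(1) in auto)
  moreover have "span Y \<subseteq> {y. \<forall>x\<in>span X. copairing y x = 0}"
    by (rule span_minimal[OF _ subspace_copairing_orthogonal])
      (use calculation in \<open>auto simp: copairing_commute\<close>)
  ultimately show ?thesis using assms(2,3) by (auto simp: copairing_commute)
qed

lemma lagrangian_span_frame:
  fixes f :: "'n::finite \<Rightarrow> (real^'n) \<times> (real^'n)"
  assumes "inj f" "independent (range f)" "\<And>k l. copairing (f k) (f l) = 0"
  shows "lagrangian (span (range f))"
proof (rule lagrangianI_dim)
  show "dim (span (range f)) = CARD('n)"
    using dim_span_eq_card_independent[OF assms(2)] card_image[OF assms(1)] by simp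
  show "copairing x y = 0" if "x \<in> span (range f)" "y \<in> span (range f)" for x y
    by (rule copairing_span[OF _ that]) (use assms(3) in auto)
qed simp

text \<open>Turns membership into the vanishing of pairings with generators, a condition that passes
  to limits.\<close>

lemma lagrangian_span_mem:
  assumes "lagrangian (span X)"
  shows "x \<in> span X \<longleftrightarrow> (\<forall>y\<in>X. copairing x y = 0)"
proof
  show "\<forall>y\<in>X. copairing x y = 0" if "x \<in> span X"
    using lagrangian_mem_iff[OF assms] that span_base by blast
  assume "\<forall>y\<in>X. copairing x y = 0"
  then have "copairing x y = 0" if "y \<in> span X" for y
    using copairing_span[of "{x}" X x y] that span_base[of x "{x}"] by auto
  then show "x \<in> span X" using lagrangian_mem_iff[OF assms] by blast
qed

text \<open>Any covector annihilating the projection of a maximal isotropic \<open>K\<close> to the vector part lies in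
  \<open>K\<close>, so that this projection contains the vector part of everything orthogonal to \<open>K\<close>.\<close>

lemma lagrangian_if_maximal:
  fixes K :: "((real^'n::finite) \<times> (real^'n)) set"
  assumes "subspace K" "\<And>x y. x \<in> K \<Longrightarrow> y \<in> K \<Longrightarrow> copairing x y = 0"
    and max: "\<And>K'. subspace K' \<Longrightarrow> (\<And>x y. x \<in> K' \<Longrightarrow> y \<in> K' \<Longrightarrow> copairing x y = 0) \<Longrightarrow> K \<subseteq> K' \<Longrightarrow> K' = K"
  shows "lagrangian K"
  unfolding lagrangian_def
proof (intro subset_antisym subsetI)
  fix x assume "x \<in> {x. \<forall>y\<in>K. copairing x y = 0}"
  then have x: "\<And>y. y \<in> K \<Longrightarrow> copairing x y = 0" by blast
  have ann: "(0, \<eta>) \<in> K" if \<eta>: "\<And>y. y \<in> K \<Longrightarrow> \<eta> \<bullet> fst y = 0" for \<eta>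
  proof -
    have "copairing a b = 0" if "a \<in> insert (0, \<eta>) K" "b \<in> insert (0, \<eta>) K" for a b
      using that
      by (elim insertE) (simp_all add: copairing_def[of _ "(0, \<eta>)"] copairing_def[of "(0, \<eta>)"] assms(2) \<eta>)
    then have "span (insert (0, \<eta>) K) = K"
      using max[OF subspace_span copairing_span[of "insert (0, \<eta>) K" "insert (0, \<eta>) K"]]
        span_superset[of "insert (0, \<eta>) K"] by blast
    moreover have "(0, \<eta>) \<in> span (insert (0, \<eta>) K)" by (rule span_base) simp
    ultimately show ?thesis by simp
  qed
  define P where "P = fst ` K"
  have P: "subspace P" unfolding P_def
    by (rule linear_subspace_image[OF _ assms(1)]) (simp add: linear_fst)
  have "fst x \<in> P\<^sup>\<bottom>\<^sup>\<bottom>"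
  proof -
    have "\<eta> \<bullet> fst x = 0" if "\<eta> \<in> P\<^sup>\<bottom>" for \<eta>
      using x[OF ann[of \<eta>]] that
      by (auto simp: orthogonal_comp_def orthogonal_def P_def copairing_def inner_commute)
    then show ?thesis by (auto simp: orthogonal_comp_def orthogonal_def)
  qed
  then have "fst x \<in> P" by (simp add: orthogonal_comp_self[OF P])
  then obtain \<xi> where \<xi>: "(fst x, \<xi>) \<in> K" by (auto simp: P_def)
  have "(0, snd x - \<xi>) \<in> K"
  proof (rule ann)
    fix y assume y: "y \<in> K"
    show "(snd x - \<xi>) \<bullet> fst y = 0"
      using x[OF y] assms(2)[OF \<xi> y] by (simp add: copairing_def inner_diff_left)
  qed
  then have "(fst x, \<xi>) + (0, snd x - \<xi>) \<in> K" by (rule subspace_add[OF assms(1) \<xi>])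
  then show "x \<in> K" by simp
qed (use assms(2) in auto)

lemma lagrangian_maximal:
  assumes "lagrangian K" "K \<subseteq> K'" "\<And>x y. x \<in> K' \<Longrightarrow> y \<in> K' \<Longrightarrow> copairing x y = 0"
  shows "K' = K"
  using assms(2,3) lagrangian_mem_iff[OF assms(1)] by blast

section \<open>Charts and tangent spaces\<close>

lemma inv_chart_apply: "is_chart c \<Longrightarrow> q \<in> fst c \<Longrightarrow> inv_chart c (snd c q) = q"
  by (simp add: is_chart_def inv_chart_def)

lemma transition_apply: "is_chart c \<Longrightarrow> q \<in> fst c \<Longrightarrow> transition c d (snd c q) = snd d q"
  by (simp add: transition_def inv_chart_apply)

lemma compatible_commute: "compatible c d \<Longrightarrow> compatible d c"
  unfolding compatible_def by (simp add: Int_commute)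

lemma chart_image_eq_preimage:
  assumes "is_chart c" "is_chart d" "Q \<subseteq> fst d"
  shows "snd c ` (fst c \<inter> Q) = snd c ` (fst c \<inter> fst d) \<inter> transition c d -` (snd d ` Q)"
proof -
  have inj: "inj_on (snd d) (fst d)" using assms(2) by (simp add: is_chart_def)
  show ?thesis
  proof (intro subset_antisym subsetI)
    fix u assume "u \<in> snd c ` (fst c \<inter> Q)"
    then obtain q where "q \<in> fst c" "q \<in> Q" "u = snd c q" by blast
    then show "u \<in> snd c ` (fst c \<inter> fst d) \<inter> transition c d -` (snd d ` Q)"
      using assms(3) by (auto simp: transition_apply[OF assms(1)])
  next
    fix u assume "u \<in> snd c ` (fst c \<inter> fst d) \<inter> transition c d -` (snd d ` Q)"
    then obtain q q' where q: "q \<in> fst c" "q \<in> fst d" "u = snd c q" "q' \<in> Q" "snd d q = snd d q'"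
      by (auto simp: transition_apply[OF assms(1)])
    then have "q = q'" using inj_onD[OF inj, of q q'] assms(3) by blast
    then show "u \<in> snd c ` (fst c \<inter> Q)" using q by blast
  qed
qed

lemma open_chart_image:
  assumes "is_chart c" "is_chart d" "compatible c d" "Q \<subseteq> fst d" "open (snd d ` Q)"
  shows "open (snd c ` (fst c \<inter> Q))"
  unfolding chart_image_eq_preimage[OF assms(1,2,4)]
  using assms(3,5) smooth_on_imp_continuous_on
  by (intro continuous_open_preimage) (auto simp: compatible_def)

lemma compatible_trans_at:
  assumes "is_chart c" "is_chart d" "is_chart g" "compatible c g" "compatible g d"
  shows "open (snd c ` (fst c \<inter> (fst g \<inter> fst d)))"
    and "smooth_on (snd c ` (fst c \<inter> (fst g \<inter> fst d))) (transition c d)"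
proof -
  have g: "open (snd g ` (fst g \<inter> fst d))" using assms(5) by (simp add: compatible_def)
  show op: "open (snd c ` (fst c \<inter> (fst g \<inter> fst d)))"
    by (rule open_chart_image[OF assms(1,3,4) _ g]) auto
  have "smooth_on (snd c ` (fst c \<inter> (fst g \<inter> fst d))) (\<lambda>u. transition g d (transition c g u))"
  proof (rule smooth_on_compose[where f = "transition g d" and g = "transition c g", OF op g])
    show "smooth_on (snd g ` (fst g \<inter> fst d)) (transition g d)"
      using assms(5) by (simp add: compatible_def)
    show "smooth_on (snd c ` (fst c \<inter> (fst g \<inter> fst d))) (transition c g)"
      using assms(4) unfolding compatible_def by (blast intro: smooth_on_subset)
  qed (auto simp: transition_apply[OF assms(1)])
  then show "smooth_on (snd c ` (fst c \<inter> (fst g \<inter> fst d))) (transition c d)"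
    by (subst smooth_on_cong[OF op, of _ "\<lambda>u. transition g d (transition c g u)"])
      (auto simp: transition_apply[OF assms(1)] transition_apply[OF assms(3)])
qed

text \<open>Smoothness of a transition map is local, and near a point in the domain of
  \<open>g\<close> the map factors through \<open>g\<close>. This compares two charts that are only
  known to be compatible with a covering family.\<close>

lemma compatible_if_covered:
  assumes "is_chart c" "is_chart d" "\<And>g. g \<in> G \<Longrightarrow> is_chart g \<and> compatible c g \<and> compatible d g"
    and "fst c \<inter> fst d \<subseteq> (\<Union>g\<in>G. fst g)"
  shows "compatible c d"
proof -
  have *: "open (snd a ` (fst a \<inter> fst b)) \<and> smooth_on (snd a ` (fst a \<inter> fst b)) (transition a b)"
    if ab: "a = c \<and> b = d \<or> a = d \<and> b = c" for a b
  proof -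
    have T: "\<exists>T. open T \<and> x \<in> T \<and> T \<subseteq> snd a ` (fst a \<inter> fst b) \<and> smooth_on T (transition a b)"
      if x: "x \<in> snd a ` (fst a \<inter> fst b)" for x
    proof -
      obtain q where q: "q \<in> fst a" "q \<in> fst b" "x = snd a q" using x by auto
      then have "q \<in> fst c \<inter> fst d" using ab by auto
      then obtain g where g: "g \<in> G" "q \<in> fst g" using assms(4) by blast
      have "is_chart a" "is_chart b" "is_chart g" "compatible a g" "compatible g b"
        using ab assms(1,2) assms(3)[OF g(1)] compatible_commute[of c g] compatible_commute[of d g] by auto
      from compatible_trans_at[OF this] show ?thesis
        using q g by (intro exI[of _ "snd a ` (fst a \<inter> (fst g \<inter> fst b))"]) auto
    qed
    have "smooth_on (snd a ` (fst a \<inter> fst b)) (transition a b)"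
      by (rule smooth_on_local) (use T in blast)
    moreover have "open (snd a ` (fst a \<inter> fst b))"
      by (subst open_subopen) (use T in blast)
    ultimately show ?thesis by blast
  qed
  show ?thesis
    using *[of c d] *[of d c] unfolding compatible_def by (simp add: Int_commute)
qed

text \<open>Any two members of the maximal atlas are compared through the charts of
  \<open>G\<close>, which cover \<open>X\<close>. The blowup atlas is defined as such a maximal
  atlas.\<close>

lemma smooth_atlas_maximal_atlas:
  assumes "smooth_atlas X G"
  shows "smooth_atlas X (maximal_atlas X G)" "G \<subseteq> maximal_atlas X G"
    "maximal_atlas X (maximal_atlas X G) = maximal_atlas X G"
proof -
  have G: "\<And>g. g \<in> G \<Longrightarrow> is_chart g" "(\<Union>c\<in>G. fst c) = X" "\<And>c d. c \<in> G \<Longrightarrow> d \<in> G \<Longrightarrow> compatible c d"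
    using assms by (auto simp: smooth_atlas_def)
  have max: "fst c \<subseteq> X" "is_chart c" "\<And>d. d \<in> B \<Longrightarrow> compatible c d" if "c \<in> maximal_atlas X B" for c B
    using that unfolding maximal_atlas_def by blast+
  have maxI: "c \<in> maximal_atlas X B" if "fst c \<subseteq> X" "is_chart c" "\<And>d. d \<in> B \<Longrightarrow> compatible c d" for c B
    using that unfolding maximal_atlas_def by blast
  show sub: "G \<subseteq> maximal_atlas X G"
    using G by (intro subsetI maxI) blast+
  have comp: "compatible c d" if "c \<in> maximal_atlas X G" "d \<in> maximal_atlas X G" for c d
  proof (rule compatible_if_covered[OF max(2)[OF that(1)] max(2)[OF that(2)], of G])
    show "fst c \<inter> fst d \<subseteq> (\<Union>g\<in>G. fst g)" using max(1)[OF that(1)] G(2) by blast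
  qed (use G(1) max(3)[OF that(1)] max(3)[OF that(2)] in blast)
  have "(\<Union>c\<in>maximal_atlas X G. fst c) = X"
    using sub G(2) max(1) by blast
  then show "smooth_atlas X (maximal_atlas X G)"
    using comp max(2) unfolding smooth_atlas_def by blast
  show "maximal_atlas X (maximal_atlas X G) = maximal_atlas X G"
  proof (intro subset_antisym subsetI)
    fix c assume "c \<in> maximal_atlas X (maximal_atlas X G)"
    from max[OF this] show "c \<in> maximal_atlas X G" using sub by (intro maxI) blast+
  next
    fix c assume "c \<in> maximal_atlas X G"
    then show "c \<in> maximal_atlas X (maximal_atlas X G)" using max comp by (intro maxI) blast+
  qed
qed

section \<open>Tangent, cotangent and generalised tangent vectors in coordinates\<close>

definition jac :: "('a, 'n::finite) chart \<Rightarrow> ('a, 'n) chart \<Rightarrow> 'a \<Rightarrow> real^'n \<Rightarrow> real^'n" where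
  "jac c d q = frechet_derivative (transition c d) (at (snd c q))"

text \<open>Vectors are pushed by \<open>D\<close> and covectors pulled back along
  \<open>D'\<close>. For a change of charts \<open>D'\<close> is the inverse of \<open>D\<close>;
  keeping it as a separate argument also admits pairs that are inverse only up to a scalar factor,
  as in \<open>gen_pull\<close>.\<close>

definition transfer :: "(real^'n \<Rightarrow> real^'n) \<Rightarrow> (real^'n \<Rightarrow> real^'n) \<Rightarrow>
    (real^'n::finite) \<times> (real^'n) \<Rightarrow> (real^'n) \<times> (real^'n)" where
  "transfer D D' x = (D (fst x), \<chi> k. snd x \<bullet> D' (axis k 1))"

lemma inner_eq_sum_axis: "(\<Sum>k\<in>UNIV. w $ k * f (axis k 1)) = f w"
  if "linear f" for f :: "real^'n::finite \<Rightarrow> real"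
proof -
  have "f w = f (\<Sum>k\<in>UNIV. w $ k *\<^sub>R axis k 1)"
    by (simp add: basis_expansion scalar_mult_eq_scaleR[symmetric])
  then show ?thesis by (simp add: linear_sum[OF that] linear_scale[OF that])
qed

lemma linear_inner_compose: "linear D \<Longrightarrow> linear (\<lambda>w. \<alpha> \<bullet> D w)"
  for D :: "'a::real_vector \<Rightarrow> 'b::real_inner"
  by (auto intro!: linearI simp: linear_add linear_scale inner_add_right)

lemma inner_vec_lambda_linear:
  fixes D :: "real^'n::finite \<Rightarrow> real^'m::finite"
  assumes "linear D"
  shows "(\<chi> k. \<alpha> \<bullet> D (axis k 1)) \<bullet> w = \<alpha> \<bullet> D w"
proof -
  have "(\<chi> k. \<alpha> \<bullet> D (axis k 1)) \<bullet> w = (\<Sum>k\<in>UNIV. w $ k * (\<alpha> \<bullet> D (axis k 1)))"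
    by (simp add: inner_vec_def mult.commute)
  then show ?thesis
    using inner_eq_sum_axis[OF linear_inner_compose[OF assms], of w \<alpha>] by simp
qed

lemma transfer_inverse:
  assumes "linear D'" "\<And>w. D' (D w) = w"
  shows "transfer D' D (transfer D D' x) = x"
  by (simp add: transfer_def inner_vec_lambda_linear[OF assms(1)] assms(2) prod_eq_iff vec_eq_iff inner_axis)

lemma linear_transfer: "linear D \<Longrightarrow> linear (transfer D D')"
  by (auto intro!: linearI simp: transfer_def linear_add linear_scale inner_add_left vec_eq_iff)

definition cov_of :: "('a, 'n::finite) chart set \<Rightarrow> ('a, 'n) chart \<Rightarrow> 'a \<Rightarrow> real^'n \<Rightarrow> ('a, 'n) cotvec" where
  "cov_of A c q \<alpha> = (\<lambda>v. if v \<in> tangent_space A q then \<alpha> \<bullet> v c else 0)"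

text \<open>Inverse to \<open>gen_coords\<close> for a chart around \<open>q\<close>; it carries
  subspaces and sections back from coordinates.\<close>

definition gen_of :: "('a, 'n::finite) chart set \<Rightarrow> ('a, 'n) chart \<Rightarrow> 'a \<Rightarrow> (real^'n) \<times> (real^'n) \<Rightarrow> ('a, 'n) gvec" where
  "gen_of A c q x = (tangent_of A c q (fst x), cov_of A c q (snd x))"

locale atlas_on =
  fixes M :: "'a set" and A :: "('a, 'n::finite) chart set"
  assumes atlas: "smooth_atlas M A"
begin

lemma chart: "c \<in> A \<Longrightarrow> is_chart c"
  and compat: "c \<in> A \<Longrightarrow> d \<in> A \<Longrightarrow> compatible c d"
  and cover: "(\<Union>c\<in>A. fst c) = M"
  using atlas by (auto simp: smooth_atlas_def)

lemma inv_apply [simp]: "c \<in> A \<Longrightarrow> q \<in> fst c \<Longrightarrow> inv_chart c (snd c q) = q"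
  by (simp add: inv_chart_apply chart)

lemma open_domain: "c \<in> A \<Longrightarrow> open (snd c ` fst c)"
  using chart by (simp add: is_chart_def)

lemma trans_apply: "c \<in> A \<Longrightarrow> q \<in> fst c \<Longrightarrow> transition c d (snd c q) = snd d q"
  by (simp add: transition_apply chart)

lemma open_overlap: "c \<in> A \<Longrightarrow> d \<in> A \<Longrightarrow> open (snd c ` (fst c \<inter> fst d))"
  and smooth_transition: "c \<in> A \<Longrightarrow> d \<in> A \<Longrightarrow> smooth_on (snd c ` (fst c \<inter> fst d)) (transition c d)"
  using compat by (auto simp: compatible_def)

lemma transition_has_derivative:
  assumes "c \<in> A" "d \<in> A" "q \<in> fst c" "q \<in> fst d"
  shows "(transition c d has_derivative jac c d q) (at (snd c q))"
  unfolding jac_def using smooth_on_has_derivative[OF smooth_transition[OF assms(1,2)]] assms by auto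

lemma linear_jac:
  assumes "c \<in> A" "d \<in> A" "q \<in> fst c" "q \<in> fst d"
  shows "linear (jac c d q)"
  using transition_has_derivative[OF assms] has_derivative_linear by blast

lemma jac_self:
  assumes "c \<in> A" "q \<in> fst c"
  shows "jac c c q w = w"
proof -
  have "frechet_derivative (transition c c) (at (snd c q)) = frechet_derivative (\<lambda>x. x) (at (snd c q))"
    by (rule frechet_derivative_cong_open[OF open_domain[OF assms(1)]]) (use assms in \<open>auto simp: trans_apply\<close>)
  then show ?thesis by (simp add: jac_def)
qed

lemma jac_jac:
  assumes "c \<in> A" "d \<in> A" "e \<in> A" "q \<in> fst c" "q \<in> fst d" "q \<in> fst e"
  shows "jac d e q (jac c d q w) = jac c e q w"
proof -
  have "((\<lambda>u. transition d e (transition c d u)) has_derivative (\<lambda>w. jac d e q (jac c d q w))) (at (snd c q))"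
    using has_derivative_compose[OF transition_has_derivative[of c d q], of "transition d e" "jac d e q"]
      transition_has_derivative[of d e q] assms by (simp add: trans_apply)
  moreover have "frechet_derivative (\<lambda>u. transition d e (transition c d u)) (at (snd c q)) = jac c e q"
    unfolding jac_def
    by (rule frechet_derivative_cong_open[OF open_overlap[OF assms(1,2)]]) (use assms in \<open>auto simp: trans_apply\<close>)
  ultimately show ?thesis using frechet_derivative_at by metis
qed

lemma jac_inverse:
  assumes "c \<in> A" "d \<in> A" "q \<in> fst c" "q \<in> fst d"
  shows "jac d c q (jac c d q w) = w"
  using jac_jac[of c d c] jac_self assms by simp

lemma tangent_of_apply:
  assumes "d \<in> A" "q \<in> fst d"
  shows "tangent_of A c q w d = jac c d q w"
  using assms by (simp add: tangent_of_def jac_def)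

lemma tangent_of_self: "c \<in> A \<Longrightarrow> q \<in> fst c \<Longrightarrow> tangent_of A c q w c = w"
  by (simp add: tangent_of_apply jac_self)

lemma tangent_of_in:
  assumes "c \<in> A" "q \<in> fst c"
  shows "tangent_of A c q w \<in> tangent_space A q"
  unfolding tangent_space_def
  using assms by (auto simp: tangent_of_apply jac_jac simp flip: jac_def) (auto simp: tangent_of_def)

lemma tangent_eq:
  assumes "c \<in> A" "q \<in> fst c" "v \<in> tangent_space A q"
  shows "v = tangent_of A c q (v c)"
proof
  fix d
  show "v d = tangent_of A c q (v c) d"
  proof (cases "d \<in> A \<and> q \<in> fst d")
    case True
    then have "v d = frechet_derivative (transition c d) (at (snd c q)) (v c)"
      using assms unfolding tangent_space_def by blast
    then show ?thesis using True by (simp add: tangent_of_def)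
  next
    case False
    then have "v d = 0" using assms(3) unfolding tangent_space_def by blast
    then show ?thesis using False by (auto simp: tangent_of_def)
  qed
qed

lemma tangent_eqI:
  assumes "c \<in> A" "q \<in> fst c" "v \<in> tangent_space A q" "w \<in> tangent_space A q" "v c = w c"
  shows "v = w"
  using tangent_eq[OF assms(1,2,3)] tangent_eq[OF assms(1,2,4)] assms(5) by metis

lemma tangent_jac:
  assumes "c \<in> A" "d \<in> A" "q \<in> fst c" "q \<in> fst d" "v \<in> tangent_space A q"
  shows "v d = jac c d q (v c)"
  using assms unfolding tangent_space_def jac_def by blast

lemma tangent_of_change:
  assumes "c \<in> A" "d \<in> A" "q \<in> fst c" "q \<in> fst d"
  shows "tangent_of A d q (jac c d q w) = tangent_of A c q w"
  by (rule tangent_eqI[of d]) (use assms in \<open>auto simp: tangent_of_in tangent_of_apply jac_self\<close>)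

lemma lincomb_in:
  assumes "v \<in> tangent_space A q" "w \<in> tangent_space A q"
  shows "lincomb a v b w \<in> tangent_space A q"
proof (cases "\<exists>c\<in>A. q \<in> fst c")
  case True
  show ?thesis
    unfolding tangent_space_def
  proof (intro CollectI conjI ballI impI allI)
    fix c d assume cd: "c \<in> A" "d \<in> A" "q \<in> fst c \<inter> fst d"
    then show "lincomb a v b w d = frechet_derivative (transition c d) (at (snd c q)) (lincomb a v b w c)"
      using linear_jac[of c d q] tangent_jac[of c d q] assms
      by (simp add: lincomb_def linear_add linear_scale flip: jac_def)
  qed (use assms in \<open>auto simp: lincomb_def tangent_space_def\<close>)
next
  \<comment> \<open>Without a chart around \<open>q\<close> the tangent space consists of the zero
    family alone.\<close>
  case False
  then show ?thesis using assms by (auto simp: tangent_space_def lincomb_def)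
qed

lemma lincomb_tangent_of:
  assumes "c \<in> A" "q \<in> fst c"
  shows "lincomb a (tangent_of A c q v) b (tangent_of A c q w) = tangent_of A c q (a *\<^sub>R v + b *\<^sub>R w)"
proof (rule tangent_eqI[OF assms lincomb_in])
  show "lincomb a (tangent_of A c q v) b (tangent_of A c q w) c = tangent_of A c q (a *\<^sub>R v + b *\<^sub>R w) c"
    using assms by (simp add: lincomb_def tangent_of_self)
qed (use assms in \<open>auto intro: tangent_of_in\<close>)

lemma cotangent_linear:
  assumes "c \<in> A" "q \<in> fst c" "\<xi> \<in> cotangent_space A q"
  shows "linear (\<lambda>w. \<xi> (tangent_of A c q w))"
proof -
  have *: "\<xi> (tangent_of A c q (a *\<^sub>R v + b *\<^sub>R w)) = a * \<xi> (tangent_of A c q v) + b * \<xi> (tangent_of A c q w)" for a b v w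
    using assms(3) tangent_of_in[OF assms(1,2)] unfolding cotangent_space_def
    by (auto simp flip: lincomb_tangent_of[OF assms(1,2)])
  show ?thesis using *[of 1 _ 1] *[of _ _ 0] by (intro linearI) auto
qed

lemma cotangent_apply:
  assumes "c \<in> A" "q \<in> fst c" "\<xi> \<in> cotangent_space A q"
  shows "\<xi> (tangent_of A c q w) = (\<chi> k. \<xi> (tangent_of A c q (axis k 1))) \<bullet> w"
  using inner_eq_sum_axis[OF cotangent_linear[OF assms], of w] by (simp add: inner_vec_def mult.commute)

lemma cov_of_in:
  shows "cov_of A c q \<alpha> \<in> cotangent_space A q"
  unfolding cotangent_space_def cov_of_def
  using lincomb_in by (auto simp: lincomb_def inner_add_right)

lemma gen_of_in: "c \<in> A \<Longrightarrow> q \<in> fst c \<Longrightarrow> gen_of A c q x \<in> gen_tangent_space A q"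
  by (simp add: gen_of_def gen_tangent_space_def tangent_of_in cov_of_in)

lemma gen_coords_gen_of: "c \<in> A \<Longrightarrow> q \<in> fst c \<Longrightarrow> gen_coords A c q (gen_of A c q x) = x"
  by (auto simp: gen_coords_def gen_of_def cov_of_def tangent_of_self tangent_of_in vec_eq_iff inner_axis prod_eq_iff)

lemma gen_coords_inj:
  assumes "c \<in> A" "q \<in> fst c" "x \<in> gen_tangent_space A q" "y \<in> gen_tangent_space A q"
    and eq: "gen_coords A c q x = gen_coords A c q y"
  shows "x = y"
proof (rule prod_eqI)
  have x: "fst x \<in> tangent_space A q" "snd x \<in> cotangent_space A q"
    and y: "fst y \<in> tangent_space A q" "snd y \<in> cotangent_space A q"
    using assms by (auto simp: gen_tangent_space_def)
  show "fst x = fst y"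
    using eq by (intro tangent_eqI[OF assms(1,2) x(1) y(1)]) (simp add: gen_coords_def)
  show "snd x = snd y"
  proof
    fix v
    show "snd x v = snd y v"
    proof (cases "v \<in> tangent_space A q")
      case True
      then show ?thesis
        using tangent_eq[OF assms(1,2) True] cotangent_apply[OF assms(1,2) x(2), of "v c"]
          cotangent_apply[OF assms(1,2) y(2), of "v c"] eq by (simp add: gen_coords_def)
    next
      case False
      then show ?thesis using x(2) y(2) by (simp add: cotangent_space_def)
    qed
  qed
qed

lemma gen_of_gen_coords:
  assumes "c \<in> A" "q \<in> fst c" "x \<in> gen_tangent_space A q"
  shows "gen_of A c q (gen_coords A c q x) = x"
  by (rule gen_coords_inj[OF assms(1,2)]) (use assms in \<open>auto simp: gen_of_in gen_coords_gen_of\<close>)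

lemma pairing_coords:
  assumes "c \<in> A" "q \<in> fst c" "x \<in> gen_tangent_space A q" "y \<in> gen_tangent_space A q"
  shows "pairing x y = copairing (gen_coords A c q x) (gen_coords A c q y) / 2"
proof -
  have x: "fst x \<in> tangent_space A q" "snd x \<in> cotangent_space A q"
    and y: "fst y \<in> tangent_space A q" "snd y \<in> cotangent_space A q"
    using assms by (auto simp: gen_tangent_space_def)
  show ?thesis
    using cotangent_apply[OF assms(1,2) x(2), of "fst y c"] cotangent_apply[OF assms(1,2) y(2), of "fst x c"]
      tangent_eq[OF assms(1,2) x(1)] tangent_eq[OF assms(1,2) y(1)]
    by (simp add: pairing_def copairing_def gen_coords_def)
qed

lemma gen_coords_change:
  assumes "c \<in> A" "d \<in> A" "q \<in> fst c" "q \<in> fst d" "x \<in> gen_tangent_space A q"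
  shows "gen_coords A d q x = transfer (jac c d q) (jac d c q) (gen_coords A c q x)"
proof -
  have x: "fst x \<in> tangent_space A q" "snd x \<in> cotangent_space A q"
    using assms by (auto simp: gen_tangent_space_def)
  have "snd x (tangent_of A d q w) = (\<chi> k. snd x (tangent_of A c q (axis k 1))) \<bullet> jac d c q w" for w
    using cotangent_apply[OF assms(1,3) x(2), of "jac d c q w"] tangent_of_change[OF assms(2,1,4,3), of w] by simp
  then show ?thesis
    using tangent_jac[OF assms(1-4) x(1)] by (simp add: gen_coords_def transfer_def)
qed

lemma gen_coords_lincomb:
  "gen_coords A c q (lincomb a (fst x) b (fst y), (\<lambda>v. a * snd x v + b * snd y v))
    = a *\<^sub>R gen_coords A c q x + b *\<^sub>R gen_coords A c q y"
  by (simp add: gen_coords_def lincomb_def vec_eq_iff)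

lemma gen_lincomb_in:
  assumes "x \<in> gen_tangent_space A q" "y \<in> gen_tangent_space A q"
  shows "(lincomb a (fst x) b (fst y), (\<lambda>v. a * snd x v + b * snd y v)) \<in> gen_tangent_space A q"
  using assms lincomb_in unfolding gen_tangent_space_def cotangent_space_def
  by (auto simp: algebra_simps)

lemma is_subspace_coords:
  assumes "c \<in> A" "q \<in> fst c" "K \<subseteq> gen_tangent_space A q"
  shows "is_subspace K \<longleftrightarrow> subspace (gen_coords A c q ` K)"
proof
  assume K: "is_subspace K"
  then obtain x0 where "x0 \<in> K" by (auto simp: is_subspace_def)
  have cl: "a *\<^sub>R gen_coords A c q x + b *\<^sub>R gen_coords A c q y \<in> gen_coords A c q ` K"
    if "x \<in> K" "y \<in> K" for a b x y
    using K that unfolding is_subspace_def by (auto simp flip: gen_coords_lincomb)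
  show "subspace (gen_coords A c q ` K)"
    using cl[OF \<open>x0 \<in> K\<close> \<open>x0 \<in> K\<close>, of 0 0] cl[of _ _ 1 1] cl[of _ _ _ 0]
    by (auto simp: subspace_def)
next
  assume S: "subspace (gen_coords A c q ` K)"
  show "is_subspace K"
    unfolding is_subspace_def
  proof (intro conjI ballI allI)
    show "K \<noteq> {}" using subspace_0[OF S] by auto
    fix x y a b assume xy: "x \<in> K" "y \<in> K"
    let ?z = "(lincomb a (fst x) b (fst y), (\<lambda>v. a * snd x v + b * snd y v))"
    have "gen_coords A c q ?z \<in> gen_coords A c q ` K"
      unfolding gen_coords_lincomb using S xy by (auto intro!: subspace_add subspace_scale)
    then obtain z where z: "gen_coords A c q ?z = gen_coords A c q z" "z \<in> K" by (rule imageE)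
    have "?z = z"
      by (rule gen_coords_inj[OF assms(1,2) _ _ z(1)]; (rule gen_lincomb_in)?) (use xy z assms(3) in blast)+
    then show "?z \<in> K" using z(2) by (simp only:)
  qed
qed

lemma isotropic_coords:
  assumes "c \<in> A" "q \<in> fst c"
  shows "isotropic A q K \<longleftrightarrow> K \<subseteq> gen_tangent_space A q \<and> subspace (gen_coords A c q ` K) \<and>
    (\<forall>x\<in>gen_coords A c q ` K. \<forall>y\<in>gen_coords A c q ` K. copairing x y = 0)"
proof (cases "K \<subseteq> gen_tangent_space A q")
  case True
  have "pairing x y = 0 \<longleftrightarrow> copairing (gen_coords A c q x) (gen_coords A c q y) = 0" if "x \<in> K" "y \<in> K" for x y
    by (subst pairing_coords[OF assms]) (use True that in auto)
  then show ?thesis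
    using is_subspace_coords[OF assms True] True unfolding isotropic_def by simp
qed (simp add: isotropic_def)

lemma gen_coords_image_gen_of: "c \<in> A \<Longrightarrow> q \<in> fst c \<Longrightarrow> gen_coords A c q ` gen_of A c q ` K = K"
  by (simp add: image_image gen_coords_gen_of)

text \<open>Coordinates are injective on the generalised tangent space and inverted by
  \<open>gen_of\<close>, so isotropic enlargements correspond to each other on both sides.\<close>

lemma maximally_isotropic_coords:
  assumes "c \<in> A" "q \<in> fst c"
  shows "maximally_isotropic A q K \<longleftrightarrow> K \<subseteq> gen_tangent_space A q \<and> lagrangian (gen_coords A c q ` K)"
proof
  assume K: "maximally_isotropic A q K"
  then have iso: "isotropic A q K" by (simp add: maximally_isotropic_def)
  have "lagrangian (gen_coords A c q ` K)"
  proof (rule lagrangian_if_maximal)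
    fix K' assume K': "subspace K'" "\<And>x y. x \<in> K' \<Longrightarrow> y \<in> K' \<Longrightarrow> copairing x y = 0" "gen_coords A c q ` K \<subseteq> K'"
    have "isotropic A q (gen_of A c q ` K')"
      unfolding isotropic_coords[OF assms] gen_coords_image_gen_of[OF assms]
      using K' gen_of_in[OF assms] by auto
    moreover have "K \<subseteq> gen_of A c q ` K'"
    proof
      fix x assume "x \<in> K"
      then have "x \<in> gen_tangent_space A q" "gen_coords A c q x \<in> K'"
        using iso K'(3) unfolding isotropic_def by blast+
      then have "gen_of A c q (gen_coords A c q x) = x" "gen_coords A c q x \<in> K'"
        using gen_of_gen_coords[OF assms] by blast+
      then show "x \<in> gen_of A c q ` K'" by (metis imageI)
    qed
    ultimately have "gen_of A c q ` K' = K" using K by (auto simp: maximally_isotropic_def)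
    then show "K' = gen_coords A c q ` K" using gen_coords_image_gen_of[OF assms] by metis
  qed (use iso isotropic_coords[OF assms] in auto)
  then show "K \<subseteq> gen_tangent_space A q \<and> lagrangian (gen_coords A c q ` K)"
    using iso by (simp add: isotropic_def)
next
  assume K: "K \<subseteq> gen_tangent_space A q \<and> lagrangian (gen_coords A c q ` K)"
  then have "isotropic A q K"
    unfolding isotropic_coords[OF assms] using lagrangian_subspace lagrangian_mem_iff by blast
  moreover have "K' = K" if K': "isotropic A q K'" "K \<subseteq> K'" for K'
  proof -
    have "gen_coords A c q ` K' = gen_coords A c q ` K"
      by (rule lagrangian_maximal) (use K K' isotropic_coords[OF assms] in auto)
    moreover have "K' \<subseteq> gen_tangent_space A q" using K'(1) by (simp add: isotropic_def)
    ultimately have "K' \<subseteq> K"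
      using K gen_coords_inj[OF assms] by (smt (verit) image_iff subset_iff)
    then show ?thesis using K'(2) by blast
  qed
  ultimately show "maximally_isotropic A q K" by (auto simp: maximally_isotropic_def)
qed

section \<open>The topology of an atlas\<close>

lemma openin_iff: "openin (atlas_topology A) W \<longleftrightarrow> W \<subseteq> M \<and> (\<forall>c\<in>A. open (snd c ` (fst c \<inter> W)))"
  using openin_atlas_topology[of A W] chart cover by auto

lemma openin_chart_preimage:
  assumes "c \<in> A" "open O1" "O1 \<subseteq> snd c ` fst c"
  shows "openin (atlas_topology A) {q \<in> fst c. snd c q \<in> O1}"
  unfolding openin_iff
proof (intro conjI ballI)
  show "{q \<in> fst c. snd c q \<in> O1} \<subseteq> M" using assms(1) cover by auto
  fix d assume d: "d \<in> A"
  show "open (snd d ` (fst d \<inter> {q \<in> fst c. snd c q \<in> O1}))"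
  proof (rule open_chart_image[OF chart[OF d] chart[OF assms(1)] compat[OF d assms(1)]])
    have "snd c ` {q \<in> fst c. snd c q \<in> O1} = O1" using assms(3) by auto
    then show "open (snd c ` {q \<in> fst c. snd c q \<in> O1})" using assms(2) by simp
  qed auto
qed

lemma openin_domain: "c \<in> A \<Longrightarrow> openin (atlas_topology A) (fst c)"
  using openin_chart_preimage[of c "snd c ` fst c"] open_domain[of c]
  by (metis (no_types, lifting) Collect_cong Collect_mem_eq imageI order_refl)

lemma topspace_atlas: "topspace (atlas_topology A) = M"
proof -
  have "openin (atlas_topology A) M"
    using openin_domain cover openin_Union[of "fst ` A"] by auto
  then show ?thesis using openin_iff by (metis openin_subset openin_topspace subset_antisym)
qed

lemma open_image: "openin (atlas_topology A) W \<Longrightarrow> c \<in> A \<Longrightarrow> open (snd c ` (fst c \<inter> W))"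
  by (simp add: openin_iff)

text \<open>A restricted chart is compatible with the atlas, so maximality returns it to
  \<open>A\<close>. Charts of the complement of \<open>N\<close> arise in this way.\<close>

lemma restrict_chart:
  assumes "maximal_atlas M A = A" "c \<in> A" "openin (atlas_topology A) W"
  shows "(fst c \<inter> W, snd c) \<in> A"
proof -
  let ?r = "(fst c \<inter> W, snd c)"
  have r: "is_chart ?r"
    using open_image[OF assms(3,2)] chart[OF assms(2)] by (auto simp: is_chart_def inj_on_def)
  have inv: "inv_chart ?r u = inv_chart c u" if u: "u \<in> snd c ` (fst c \<inter> W)" for u
  proof -
    obtain q where "q \<in> fst c \<inter> W" "u = snd c q" using u by blast
    then show ?thesis using inv_chart_apply[OF r, of q] assms(2) by simp
  qed
  have "compatible ?r d" if d: "d \<in> A" for d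
    unfolding compatible_def
  proof (intro conjI)
    have I: "openin (atlas_topology A) (W \<inter> fst d)" "openin (atlas_topology A) (fst c \<inter> W)"
      using openin_domain[OF d] openin_domain[OF assms(2)] assms(3) by auto
    show o1: "open (snd ?r ` (fst ?r \<inter> fst d))"
      using open_image[OF I(1) assms(2)] by (simp add: Int_assoc)
    show o2: "open (snd d ` (fst ?r \<inter> fst d))"
      using open_image[OF I(2) d] by (simp add: Int_commute)
    have "smooth_on (snd c ` (fst c \<inter> W \<inter> fst d)) (transition c d)"
      by (rule smooth_on_subset[OF smooth_transition[OF assms(2) d]]) auto
    then show "smooth_on (snd ?r ` (fst ?r \<inter> fst d)) (transition ?r d)"
      by (subst smooth_on_cong[OF o1, of _ "transition c d"]) (auto simp: transition_def inv)
    have "smooth_on (snd d ` (fst ?r \<inter> fst d)) (transition d c)"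
      by (rule smooth_on_subset[OF smooth_transition[OF d assms(2)]]) auto
    then show "smooth_on (snd d ` (fst ?r \<inter> fst d)) (transition d ?r)"
      by (simp add: transition_def)
  qed
  moreover have "fst ?r \<subseteq> M" using assms(2) cover by auto
  ultimately have "?r \<in> maximal_atlas M A" using r by (auto simp: maximal_atlas_def)
  then show ?thesis using assms(1) by simp
qed

end

section \<open>Frames\<close>

text \<open>The set \<open>X\<close> is where \<open>L\<close> is allowed to be undefined.\<close>

definition local_frame ::
  "('a, 'n::finite) chart set \<Rightarrow> ('a \<Rightarrow> ('a, 'n) gvec set) \<Rightarrow> 'a set \<Rightarrow> ('a, 'n) chart \<Rightarrow>
   (real^'n) set \<Rightarrow> ('n \<Rightarrow> real^'n \<Rightarrow> (real^'n) \<times> (real^'n)) \<Rightarrow> bool" where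
  "local_frame A L X c O1 e \<longleftrightarrow>
     c \<in> A \<and> open O1 \<and> O1 \<subseteq> snd c ` fst c \<and> (\<forall>k. smooth_on O1 (e k)) \<and>
     (\<forall>u\<in>O1. inj (\<lambda>k. e k u) \<and> independent (range (\<lambda>k. e k u)) \<and>
        (inv_chart c u \<notin> X \<longrightarrow>
           gen_coords A c (inv_chart c u) ` L (inv_chart c u) = span (range (\<lambda>k. e k u))))"

lemma local_frameD:
  assumes "local_frame A L X c O1 e"
  shows "c \<in> A" "open O1" "O1 \<subseteq> snd c ` fst c" "smooth_on O1 (e k)"
    "u \<in> O1 \<Longrightarrow> inj (\<lambda>k. e k u)" "u \<in> O1 \<Longrightarrow> independent (range (\<lambda>k. e k u))"
    "u \<in> O1 \<Longrightarrow> inv_chart c u \<notin> X \<Longrightarrow>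
       gen_coords A c (inv_chart c u) ` L (inv_chart c u) = span (range (\<lambda>k. e k u))"
  using assms unfolding local_frame_def by blast+

context atlas_on
begin

text \<open>Rewrites in the coordinates of \<open>d\<close> a local section \<open>s\<close> given
  in those of \<open>c\<close>. The Jacobians vary with the point and act on varying vectors, hence
  the appeal to \<open>smooth_on_frechet_apply\<close>.\<close>

lemma smooth_on_transfer:
  assumes "c \<in> A" "d \<in> A" "open O2" "O2 \<subseteq> snd d ` (fst c \<inter> fst d)" "smooth_on O1 s"
    and "open O1" "transition d c ` O2 \<subseteq> O1"
  shows "smooth_on O2 (\<lambda>u. transfer (jac c d (inv_chart d u)) (jac d c (inv_chart d u)) (s (transition d c u)))"
proof -
  have tr: "smooth_on O2 (transition d c)"
    by (rule smooth_on_subset[OF smooth_transition[OF assms(2,1)]]) (use assms(4) in auto)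
  have st: "smooth_on O2 (\<lambda>u. s (transition d c u))"
    by (rule smooth_on_compose[OF assms(3,6,7,5) tr])
  have im: "transition d c ` O2 \<subseteq> snd c ` (fst c \<inter> fst d)"
    using assms(4) by (auto simp: trans_apply[OF assms(2)])
  have "smooth_on O2 (\<lambda>u. frechet_derivative (transition c d) (at (transition d c u)) (fst (s (transition d c u))))"
    by (rule smooth_on_frechet_apply[OF assms(3) open_overlap[OF assms(1,2)] im smooth_transition[OF assms(1,2)] tr
          smooth_on_fst[OF assms(3) st]])
  moreover have "smooth_on O2 (\<lambda>u. \<chi> k. snd (s (transition d c u)) \<bullet> frechet_derivative (transition d c) (at u) (axis k 1))"
    by (intro smooth_on_vec_lambda smooth_on_inner smooth_on_snd[OF assms(3) st] smooth_on_frechet[OF tr] assms(3))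
  ultimately have "smooth_on O2 (\<lambda>u. (frechet_derivative (transition c d) (at (transition d c u)) (fst (s (transition d c u))),
      \<chi> k. snd (s (transition d c u)) \<bullet> frechet_derivative (transition d c) (at u) (axis k 1)))"
    by (rule smooth_on_Pair[OF assms(3)])
  moreover have "snd d (inv_chart d u) = u" "snd c (inv_chart d u) = transition d c u" if "u \<in> O2" for u
    using that assms(2,4) by (auto simp: trans_apply)
  ultimately show ?thesis
    by (subst smooth_on_cong[OF assms(3)]) (auto simp: transfer_def jac_def)
qed

text \<open>At each point \<open>transfer\<close> is an isomorphism, inverted by the opposite
  Jacobians, so independence and spans survive the change of chart.\<close>

lemma local_frame_change:
  assumes lf: "local_frame A L X c O1 e" and d: "d \<in> A"
    and gen: "\<And>q. q \<in> fst c \<Longrightarrow> q \<notin> X \<Longrightarrow> L q \<subseteq> gen_tangent_space A q"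
  shows "local_frame A L X d (snd d ` (fst d \<inter> {q \<in> fst c. snd c q \<in> O1}))
    (\<lambda>k u. transfer (jac c d (inv_chart d u)) (jac d c (inv_chart d u)) (e k (transition d c u)))"
    (is "local_frame A L X d ?O ?e")
  unfolding local_frame_def
proof (intro conjI allI ballI impI)
  have c: "c \<in> A" "open O1" "O1 \<subseteq> snd c ` fst c" "\<And>k. smooth_on O1 (e k)"
    using local_frameD[OF lf] by blast+
  show op: "open ?O" by (rule open_image[OF openin_chart_preimage[OF c(1-3)] d])
  show "smooth_on ?O (?e k)" for k
    by (rule smooth_on_transfer[OF c(1) d op _ c(4) c(2)]) (auto simp: trans_apply[OF d])
  fix u assume "u \<in> ?O"
  then obtain q where q: "q \<in> fst d" "q \<in> fst c" "snd c q \<in> O1" "u = snd d q" by blast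
  let ?T = "transfer (jac c d q) (jac d c q)"
  have T: "linear ?T" by (rule linear_transfer[OF linear_jac[OF c(1) d q(2,1)]])
  have Tinv: "transfer (jac d c q) (jac c d q) (?T x) = x" for x
    by (rule transfer_inverse[OF linear_jac[OF d c(1) q(1,2)] jac_inverse[OF c(1) d q(2,1)]])
  have injT: "inj ?T" by (rule inj_on_inverseI[of _ "transfer (jac d c q) (jac c d q)"]) (rule Tinv)
  have e: "inj (\<lambda>k. e k (snd c q))" "independent (range (\<lambda>k. e k (snd c q)))"
    "q \<notin> X \<Longrightarrow> gen_coords A c q ` L q = span (range (\<lambda>k. e k (snd c q)))"
    using local_frameD(5,6)[OF lf q(3)] local_frameD(7)[OF lf q(3)] c(1) q(2) by simp_all
  have eu: "?e k u = ?T (e k (snd c q))" for k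
    using q d by (simp add: trans_apply)
  have ran: "range (\<lambda>k. ?e k u) = ?T ` range (\<lambda>k. e k (snd c q))"
    unfolding eu by auto
  show "inj (\<lambda>k. ?e k u)"
    unfolding eu using inj_compose[OF injT e(1)] by (simp add: o_def)
  show "independent (range (\<lambda>k. ?e k u))"
    unfolding ran by (rule linear_independent_injective_image[OF T e(2)]) (use injT in \<open>auto intro: inj_on_subset\<close>)
  assume X: "inv_chart d u \<notin> X"
  then have qX: "q \<notin> X" using q d by simp
  have "gen_coords A d q ` L q = ?T ` gen_coords A c q ` L q"
    unfolding image_image
    by (rule image_cong[OF refl], rule gen_coords_change[OF c(1) d q(2,1)]) (use gen[OF q(2) qX] in blast)
  then show "gen_coords A d (inv_chart d u) ` L (inv_chart d u) = span (range (\<lambda>k. ?e k u))"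
    unfolding ran linear_span_image[OF T] using e(3)[OF qX] q d by simp
qed (use d in auto)

lemma local_frame_in_chart:
  assumes "local_frame A L X c O1 e" "q \<in> fst c" "snd c q \<in> O1" "d \<in> A" "q \<in> fst d"
    and "\<And>q. q \<in> fst c \<Longrightarrow> q \<notin> X \<Longrightarrow> L q \<subseteq> gen_tangent_space A q"
  obtains O2 e2 where "local_frame A L X d O2 e2" "snd d q \<in> O2"
    "\<And>k. e2 k (snd d q) = transfer (jac c d q) (jac d c q) (e k (snd c q))"
    "O2 = snd d ` (fst d \<inter> {q \<in> fst c. snd c q \<in> O1})"
proof (rule that[OF local_frame_change[OF assms(1,4,6)]])
  show "snd d q \<in> snd d ` (fst d \<inter> {q \<in> fst c. snd c q \<in> O1})" using assms by blast
  show "transfer (jac c d (inv_chart d (snd d q))) (jac d c (inv_chart d (snd d q))) (e k (transition d c (snd d q)))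
      = transfer (jac c d q) (jac d c q) (e k (snd c q))" for k
    using assms(4,5) by (simp add: trans_apply)
qed auto

text \<open>Maximal isotropy fixes the rank of the subbundle to \<open>n\<close>. Frames can
  therefore be indexed by the type \<open>'n\<close> itself, and their Gram matrices are square
  matrices over that type.\<close>

lemma dirac_local_frame:
  assumes "smooth_subbundle A W L" "\<And>q. q \<in> W \<Longrightarrow> maximally_isotropic A q (L q)" "q0 \<in> W"
  obtains c O1 e where "local_frame A L {} c O1 e" "q0 \<in> fst c" "snd c q0 \<in> O1" "O1 \<subseteq> snd c ` (fst c \<inter> W)"
proof -
  obtain c O1 r and e :: "nat \<Rightarrow> real^'n \<Rightarrow> (real^'n) \<times> (real^'n)" where
    c: "c \<in> A" "q0 \<in> fst c" "open O1" "snd c q0 \<in> O1" "O1 \<subseteq> snd c ` (fst c \<inter> W)"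
    and e: "\<And>j. j < r \<Longrightarrow> smooth_on O1 (e j)"
      "\<And>u. u \<in> O1 \<Longrightarrow> inj_on (\<lambda>j. e j u) {..<r}"
      "\<And>u. u \<in> O1 \<Longrightarrow> independent ((\<lambda>j. e j u) ` {..<r})"
      "\<And>u. u \<in> O1 \<Longrightarrow> gen_coords A c (inv_chart c u) ` L (inv_chart c u) = span ((\<lambda>j. e j u) ` {..<r})"
    using assms(1,3) unfolding smooth_subbundle_def by metis
  let ?u = "snd c q0"
  have "lagrangian (span ((\<lambda>j. e j ?u) ` {..<r}))"
    using maximally_isotropic_coords[OF c(1,2)] assms(2)[OF assms(3)] e(4)[OF c(4)] c(1,2) by simp
  from lagrangian_dim[OF this] have "card ((\<lambda>j. e j ?u) ` {..<r}) = CARD('n)"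
    using dim_span_eq_card_independent[OF e(3)[OF c(4)]] by simp
  then have r: "r = CARD('n)" using card_image[OF e(2)[OF c(4)]] by simp
  then obtain h where h: "bij_betw h (UNIV :: 'n set) {..<r}"
    by (metis card_lessThan finite_class.finite_UNIV finite_lessThan finite_same_card_bij)
  have hr: "h k < r" for k using h by (auto simp: bij_betw_def)
  have ran: "range (\<lambda>k. e (h k) u) = (\<lambda>j. e j u) ` {..<r}" for u
  proof -
    have "{..<r} = range h" using h by (simp add: bij_betw_def)
    then show ?thesis by (simp only: image_image)
  qed
  have "local_frame A L {} c O1 (\<lambda>k. e (h k))"
    unfolding local_frame_def ran
  proof (intro conjI ballI impI allI)
    fix u assume u: "u \<in> O1"
    show "inj (\<lambda>k. e (h k) u)"
      using h e(2)[OF u] hr by (auto simp: bij_betw_def inj_on_def)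
  qed (use c e hr in auto)
  then show thesis using c that by blast
qed

lemma smooth_subbundleI:
  assumes "\<And>q. q \<in> W \<Longrightarrow> L q \<subseteq> gen_tangent_space A q"
    and "\<And>q. q \<in> W \<Longrightarrow> \<exists>c O1 e. local_frame A L {} c O1 e \<and> q \<in> fst c \<and> snd c q \<in> O1 \<and> O1 \<subseteq> snd c ` (fst c \<inter> W)"
  shows "smooth_subbundle A W L"
  unfolding smooth_subbundle_def
proof (intro conjI ballI)
  fix q assume "q \<in> W"
  from assms(2)[OF this] obtain c O1 e where lf: "local_frame A L {} c O1 e"
    and q: "q \<in> fst c" "snd c q \<in> O1" "O1 \<subseteq> snd c ` (fst c \<inter> W)"
    by blast
  obtain h where h: "bij_betw h {..<CARD('n)} (UNIV :: 'n set)"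
    by (metis card_lessThan finite_class.finite_UNIV finite_lessThan finite_same_card_bij)
  have ran: "(\<lambda>j. e (h j) u) ` {..<CARD('n)} = range (\<lambda>k. e k u)" for u
  proof -
    have "range (\<lambda>k. e k u) = (\<lambda>k. e k u) ` h ` {..<CARD('n)}" using h by (simp add: bij_betw_def)
    then show ?thesis by (simp add: image_image)
  qed
  have inj: "inj_on (\<lambda>j. e (h j) u) {..<CARD('n)}" if "u \<in> O1" for u
    using comp_inj_on[OF bij_betw_imp_inj_on[OF h] inj_on_subset[OF local_frameD(5)[OF lf that] subset_UNIV]]
    by (simp add: o_def)
  show "\<exists>c\<in>A. \<exists>O1 r. \<exists>e :: nat \<Rightarrow> real^'n \<Rightarrow> (real^'n) \<times> (real^'n).
        q \<in> fst c \<and> open O1 \<and> snd c q \<in> O1 \<and> O1 \<subseteq> snd c ` (fst c \<inter> W) \<and>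
        (\<forall>j<r. smooth_on O1 (e j)) \<and>
        (\<forall>u\<in>O1. inj_on (\<lambda>j. e j u) {..<r} \<and> independent ((\<lambda>j. e j u) ` {..<r}) \<and>
           gen_coords A c (inv_chart c u) ` L (inv_chart c u) = span ((\<lambda>j. e j u) ` {..<r}))"
  proof (rule bexI[of _ c], rule exI[of _ O1], rule exI[of _ "CARD('n)"], rule exI[of _ "\<lambda>j. e (h j)"])
    show "q \<in> fst c \<and> open O1 \<and> snd c q \<in> O1 \<and> O1 \<subseteq> snd c ` (fst c \<inter> W) \<and>
        (\<forall>j<CARD('n). smooth_on O1 (e (h j))) \<and>
        (\<forall>u\<in>O1. inj_on (\<lambda>j. e (h j) u) {..<CARD('n)} \<and> independent ((\<lambda>j. e (h j) u) ` {..<CARD('n)}) \<and>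
           gen_coords A c (inv_chart c u) ` L (inv_chart c u) = span ((\<lambda>j. e (h j) u) ` {..<CARD('n)}))"
      unfolding ran using local_frameD[OF lf] q inj by simp
    show "c \<in> A" using local_frameD(1)[OF lf] .
  qed
qed (use assms(1) in auto)

section \<open>Differential forms and the bracket in coordinates\<close>

text \<open>Linearity is part of the definition in the first slot only; antisymmetry moves it to the
  other two.\<close>

lemma form_coords_trilinear:
  assumes "alternating_trilinear_on (tangent_space A q) (H q)" "c \<in> A" "q \<in> fst c"
  shows "linear (\<lambda>x. form_coords A H c (snd c q) x y z)" "linear (\<lambda>y. form_coords A H c (snd c q) x y z)"
    "linear (\<lambda>z. form_coords A H c (snd c q) x y z)"
proof -
  let ?h = "form_coords A H c (snd c q)"
  note T = tangent_of_in[OF assms(2,3)]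
  let ?T = "tangent_space A q"
  have alt: "H q v u w = - H q u v w" "H q u w v = - H q u v w"
    "H q (lincomb a u b u') v w = a * H q u v w + b * H q u' v w"
    if "u \<in> ?T" "v \<in> ?T" "w \<in> ?T" "u' \<in> ?T" for u v w u' a b
    using assms(1) that unfolding alternating_trilinear_on_def by blast+
  have h: "?h x y z = H q (tangent_of A c q x) (tangent_of A c q y) (tangent_of A c q z)" for x y z
    using assms(2,3) by (simp add: form_coords_def)
  have sw: "?h y x z = - ?h x y z" "?h x z y = - ?h x y z" for x y z
    unfolding h by (rule alt(1)[OF T T T T] alt(2)[OF T T T T])+
  have lin: "?h (a *\<^sub>R x + b *\<^sub>R x') y z = a * ?h x y z + b * ?h x' y z" for a b x x' y z
    unfolding h lincomb_tangent_of[OF assms(2,3), symmetric] by (rule alt(3)[OF T T T T])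
  show 1: "linear (\<lambda>x. ?h x y z)" for y z
  proof (rule linearI)
    show "?h (x + x') y z = ?h x y z + ?h x' y z" for x x' using lin[of 1 x 1 x' y z] by simp
    show "?h (r *\<^sub>R x) y z = r *\<^sub>R ?h x y z" for r x using lin[of r x 0 x y z] by simp
  qed
  have eq: "(\<lambda>y. - ?h y x z) = (\<lambda>y. ?h x y z)" for x z by (rule ext) (rule sw(1)[symmetric])
  show 2: "linear (\<lambda>y. ?h x y z)" for x z
    by (rule subst[where P = linear, OF eq linear_compose_neg[OF 1]])
  have eq: "(\<lambda>z. - ?h x z y) = (\<lambda>z. ?h x y z)" for x y by (rule ext) (rule sw(2)[symmetric])
  show "linear (\<lambda>z. ?h x y z)" for x y
    by (rule subst[where P = linear, OF eq linear_compose_neg[OF 2]])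
qed

lemma smooth_on_form_coords:
  fixes g :: "'x::real_normed_vector \<Rightarrow> real^'n"
  assumes H: "smooth_three_form A W H" and c: "c \<in> A" and W: "openin (atlas_topology A) W"
    and S: "open S" "g ` S \<subseteq> snd c ` (fst c \<inter> W)" "smooth_on S g"
    and w: "smooth_on S w1" "smooth_on S w2" "smooth_on S w3"
  shows "smooth_on S (\<lambda>z. form_coords A H c (g z) (w1 z) (w2 z) (w3 z))"
proof -
  have ex: "form_coords A H c (g z) (w1 z) (w2 z) (w3 z)
     = (\<Sum>i\<in>Basis. (w1 z \<bullet> i) *\<^sub>R (\<Sum>j\<in>Basis. (w2 z \<bullet> j) *\<^sub>R (\<Sum>k\<in>Basis. (w3 z \<bullet> k) *\<^sub>R form_coords A H c (g z) i j k)))"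
    if z: "z \<in> S" for z
  proof -
    obtain q where q: "q \<in> fst c" "q \<in> W" "g z = snd c q" using S(2) z by blast
    have alt: "alternating_trilinear_on (tangent_space A q) (H q)"
      using H q(2) unfolding smooth_three_form_def by blast
    note lin = form_coords_trilinear[where H = H and q = q, OF alt c q(1)]
    let ?h = "form_coords A H c (snd c q)"
    have "?h (w1 z) (w2 z) (w3 z) = (\<Sum>i\<in>Basis. (w1 z \<bullet> i) *\<^sub>R ?h i (w2 z) (w3 z))"
      by (rule linear_basis_expansion[OF lin(1)])
    moreover have "?h i (w2 z) (w3 z) = (\<Sum>j\<in>Basis. (w2 z \<bullet> j) *\<^sub>R ?h i j (w3 z))" for i
      by (rule linear_basis_expansion[OF lin(2)])
    moreover have "?h i j (w3 z) = (\<Sum>k\<in>Basis. (w3 z \<bullet> k) *\<^sub>R ?h i j k)" for i j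
      by (rule linear_basis_expansion[OF lin(3)])
    ultimately show ?thesis unfolding q(3) by (simp only:)
  qed
  have "smooth_on S (\<lambda>z. form_coords A H c (g z) i j k)" for i j k
  proof (rule smooth_on_compose[OF S(1) open_image[OF W c] S(2) _ S(3)])
    show "smooth_on (snd c ` (fst c \<inter> W)) (\<lambda>u. form_coords A H c u i j k)"
      using H c unfolding smooth_three_form_def by blast
  qed
  then have "smooth_on S (\<lambda>z. \<Sum>i\<in>Basis. (w1 z \<bullet> i) *\<^sub>R (\<Sum>j\<in>Basis. (w2 z \<bullet> j) *\<^sub>R (\<Sum>k\<in>Basis. (w3 z \<bullet> k) *\<^sub>R form_coords A H c (g z) i j k)))"
    by (intro smooth_on_sum smooth_on_scaleR smooth_on_inner S(1) w smooth_on_const)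
  then show ?thesis by (subst smooth_on_cong[OF S(1) ex])
qed

lemma smooth_on_twisted_bracket:
  assumes H: "smooth_three_form A W H" and c: "c \<in> A" and W: "openin (atlas_topology A) W"
    and S: "open S" "S \<subseteq> snd c ` (fst c \<inter> W)" and s: "smooth_on S s" "smooth_on S t"
  shows "smooth_on S (twisted_bracket (form_coords A H c) s t)"
proof -
  note f = smooth_on_fst[OF S(1)] and g = smooth_on_snd[OF S(1)]
  have D: "smooth_on S (\<lambda>u. frechet_derivative f (at u) (w u))"
    if "smooth_on S f" "smooth_on S w" for f w :: "real^'n \<Rightarrow> real^'n"
    by (rule smooth_on_frechet_apply[OF S(1,1) _ that(1) _ that(2)]) (use S(1) in auto)
  have "smooth_on S (\<lambda>u. form_coords A H c u (fst (s u)) (fst (t u)) (axis k 1))" for k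
    by (rule smooth_on_form_coords[OF H c W S(1) _ _ f[OF s(1)] f[OF s(2)]]) (use S in auto)
  then show ?thesis
    unfolding twisted_bracket_def lie_bracket_def lie_derivative_def exterior_derivative_def Let_def o_def
    by (intro smooth_on_Pair smooth_on_add smooth_on_diff smooth_on_vec_lambda smooth_on_inner smooth_on_nth
        D f g s S(1) smooth_on_const)
qed

end

text \<open>The sections enter through their germs at \<open>u\<close>, the twist only through its
  value at \<open>u\<close>.\<close>

lemma twisted_bracket_cong:
  assumes "open S" "u \<in> S" "\<And>x. x \<in> S \<Longrightarrow> s x = s' x" "\<And>x. x \<in> S \<Longrightarrow> t x = t' x"
    and "\<And>x y z. h u x y z = h' u x y z"
  shows "twisted_bracket h s t u = twisted_bracket h' s' t' u"
proof -
  have eq: "frechet_derivative (\<lambda>x. fst (s x)) (at u) = frechet_derivative (\<lambda>x. fst (s' x)) (at u)"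
    "frechet_derivative (\<lambda>x. snd (s x)) (at u) = frechet_derivative (\<lambda>x. snd (s' x)) (at u)"
    "frechet_derivative (\<lambda>x. fst (t x)) (at u) = frechet_derivative (\<lambda>x. fst (t' x)) (at u)"
    "frechet_derivative (\<lambda>x. snd (t x)) (at u) = frechet_derivative (\<lambda>x. snd (t' x)) (at u)"
    by (rule frechet_derivative_cong_open[OF assms(1,2)]; simp add: assms(3,4))+
  have "s u = s' u" "t u = t' u" using assms by auto
  then show ?thesis
    by (simp add: twisted_bracket_def lie_bracket_def lie_derivative_def exterior_derivative_def Let_def o_def eq assms(5))
qed

section \<open>Extending a Dirac structure over a thin set\<close>

context atlas_on
begin

text \<open>The set where \<open>f\<close> is nonzero is open and corresponds to an open subset of
  \<open>X\<close>, which must be empty. All identities valid off the divisor are carried across it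
  by this lemma.\<close>

lemma zero_if_zero_off_thin:
  fixes f :: "real^'n \<Rightarrow> real"
  assumes thin: "\<And>W. openin (atlas_topology A) W \<Longrightarrow> W \<subseteq> X \<Longrightarrow> W = {}"
    and c: "c \<in> A" and S: "open S" "S \<subseteq> snd c ` fst c" "continuous_on S f"
    and f: "\<And>u. u \<in> S \<Longrightarrow> inv_chart c u \<notin> X \<Longrightarrow> f u = 0" and u: "u \<in> S"
  shows "f u = 0"
proof (rule ccontr)
  assume nz: "f u \<noteq> 0"
  define T where "T = S \<inter> f -` (- {0})"
  have T: "open T" unfolding T_def by (rule continuous_open_preimage[OF S(3,1)]) auto
  have TS: "T \<subseteq> S" by (auto simp: T_def)
  let ?W = "{q \<in> fst c. snd c q \<in> T}"
  have "openin (atlas_topology A) ?W"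
    by (rule openin_chart_preimage[OF c T]) (use TS S(2) in blast)
  moreover have "?W \<subseteq> X"
  proof
    fix q assume "q \<in> ?W"
    then show "q \<in> X" using f[of "snd c q"] c by (auto simp: T_def)
  qed
  ultimately have "?W = {}" by (rule thin)
  moreover obtain q where "q \<in> fst c" "u = snd c q" using S(2) u by blast
  ultimately show False using nz u by (auto simp: T_def)
qed

lemma closed_three_form_subset:
  assumes "closed_three_form A W H" "openin (atlas_topology A) W'" "W' \<subseteq> W"
  shows "closed_three_form A W' H"
proof -
  have sub: "snd c ` (fst c \<inter> W') \<subseteq> snd c ` (fst c \<inter> W)" for c :: "('a, 'n) chart" using assms(3) by blast
  show ?thesis
    using assms(1,3) sub smooth_on_subset[OF _ sub]
    unfolding closed_three_form_def smooth_three_form_def by (meson subsetD)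
qed

end

text \<open>The situation on the blowup in abstract form, with \<open>X\<close> in the role of the
  exceptional divisor: \<open>thin\<close> says that \<open>X\<close> has empty interior, and the
  form is closed on the whole manifold, so that only the subbundle remains to be extended.\<close>

locale dirac_off = atlas_on M A for M :: "'a set" and A :: "('a, 'n::finite) chart set" +
  fixes X :: "'a set" and H :: "('a, 'n) three_form" and L :: "'a \<Rightarrow> ('a, 'n) gvec set"
  assumes thin: "\<And>W. openin (atlas_topology A) W \<Longrightarrow> W \<subseteq> X \<Longrightarrow> W = {}"
    and dirac: "twisted_dirac A (M - X) H L"
    and closed_form: "closed_three_form A M H"
begin

definition regular_set :: "'a set" where
  "regular_set = {q. \<exists>c O1 e. local_frame A L X c O1 e \<and> q \<in> fst c \<and> snd c q \<in> O1}"

text \<open>A union over all frames around \<open>q\<close> in all charts;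
  \<open>frame_unique\<close> shows that each of them contributes the same subspace.\<close>

definition frame_limit :: "'a \<Rightarrow> ('a, 'n) gvec set" where
  "frame_limit q = {x \<in> gen_tangent_space A q. \<exists>c O1 e. local_frame A L X c O1 e \<and> q \<in> fst c \<and>
     snd c q \<in> O1 \<and> gen_coords A c q x \<in> span (range (\<lambda>k. e k (snd c q)))}"

lemma max_off: "q \<in> M - X \<Longrightarrow> maximally_isotropic A q (L q)"
  using dirac by (simp add: twisted_dirac_def)

lemma gen_off: "c \<in> A \<Longrightarrow> q \<in> fst c \<Longrightarrow> q \<notin> X \<Longrightarrow> L q \<subseteq> gen_tangent_space A q"
  and lagrangian_off: "c \<in> A \<Longrightarrow> q \<in> fst c \<Longrightarrow> q \<notin> X \<Longrightarrow> lagrangian (gen_coords A c q ` L q)"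
  using max_off[of q] maximally_isotropic_coords[of c q "L q"] cover by auto

text \<open>Off \<open>X\<close> both frames span the same Lagrangian space, so their pairings
  vanish there and by continuity also on \<open>X\<close>. For a single frame this is isotropy of
  the limit, for two frames it gives uniqueness.\<close>

lemma frame_copairing:
  assumes "local_frame A L X c O1 e" "local_frame A L X c O2 e'" "u \<in> O1" "u \<in> O2"
  shows "copairing (e k u) (e' l u) = 0"
proof -
  note e = local_frameD[OF assms(1)] and e' = local_frameD[OF assms(2)]
  show ?thesis
  proof (rule zero_if_zero_off_thin[where S = "O1 \<inter> O2" and f = "\<lambda>u. copairing (e k u) (e' l u)", OF thin e(1)])
    show "continuous_on (O1 \<inter> O2) (\<lambda>u. copairing (e k u) (e' l u))"
      by (rule copairing.continuous_on)
        (rule continuous_on_subset[OF smooth_on_imp_continuous_on[OF e(4)]] continuous_on_subset[OF smooth_on_imp_continuous_on[OF e'(4)]]; simp)+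
    fix u assume u: "u \<in> O1 \<inter> O2" "inv_chart c u \<notin> X"
    then obtain q where q: "q \<in> fst c" "u = snd c q" using e(3) by blast
    then have qX: "q \<notin> X" using u(2) e(1) by simp
    let ?K = "gen_coords A c q ` L q"
    have "?K = span (range (\<lambda>k. e k u))" "?K = span (range (\<lambda>k. e' k u))"
      using e(7)[of u] e'(7)[of u] u q e(1) by simp_all
    then have "e k u \<in> ?K" "e' l u \<in> ?K" by (auto intro: span_base)
    then show "copairing (e k u) (e' l u) = 0"
      using lagrangian_mem_iff[OF lagrangian_off[OF e(1) q(1) qX]] by blast
  qed (use e e' assms in auto)
qed

lemma frame_lagrangian:
  assumes "local_frame A L X c O1 e" "u \<in> O1"
  shows "lagrangian (span (range (\<lambda>k. e k u)))"
  by (rule lagrangian_span_frame[OF local_frameD(5)[OF assms] local_frameD(6)[OF assms]])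
    (rule frame_copairing[OF assms(1,1,2,2)])

text \<open>Each frame is orthogonal to the other, and a Lagrangian span contains whatever is
  orthogonal to it.\<close>

lemma frame_unique:
  assumes "local_frame A L X c O1 e" "local_frame A L X c O2 e'" "u \<in> O1" "u \<in> O2"
  shows "span (range (\<lambda>k. e k u)) = span (range (\<lambda>k. e' k u))"
proof -
  have "e k u \<in> span (range (\<lambda>k. e' k u))" for k
    unfolding lagrangian_span_mem[OF frame_lagrangian[OF assms(2,4)]]
    using frame_copairing[OF assms] by blast
  moreover have "e' k u \<in> span (range (\<lambda>k. e k u))" for k
    unfolding lagrangian_span_mem[OF frame_lagrangian[OF assms(1,3)]]
    using frame_copairing[OF assms(2,1,4,3)] by blast
  ultimately show ?thesis by (auto simp: span_eq)
qed

text \<open>A vector coming from a frame in another chart \<open>d\<close> is moved to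
  \<open>c\<close> together with that frame, where the two spans can be compared.\<close>

lemma frame_limit_coords:
  assumes lf: "local_frame A L X c O1 e" and q: "q \<in> fst c" "snd c q \<in> O1"
  shows "gen_coords A c q ` frame_limit q = span (range (\<lambda>k. e k (snd c q)))"
proof (intro subset_antisym subsetI)
  note c = local_frameD(1)[OF lf]
  fix y assume "y \<in> span (range (\<lambda>k. e k (snd c q)))"
  then have "gen_of A c q y \<in> frame_limit q"
    unfolding frame_limit_def using gen_of_in[OF c q(1), of y] gen_coords_gen_of[OF c q(1), of y] lf q
    by (intro CollectI conjI, simp, intro exI[of _ c] exI[of _ O1], intro exI[of _ e]) simp
  then show "y \<in> gen_coords A c q ` frame_limit q"
    using gen_coords_gen_of[OF c q(1), of y] by (metis imageI)
next
  note c = local_frameD(1)[OF lf]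
  fix y assume "y \<in> gen_coords A c q ` frame_limit q"
  then obtain x where x: "x \<in> frame_limit q" "y = gen_coords A c q x" by blast
  then obtain d O2 e2 where d: "local_frame A L X d O2 e2" "q \<in> fst d" "snd d q \<in> O2"
    and xs: "x \<in> gen_tangent_space A q" "gen_coords A d q x \<in> span (range (\<lambda>k. e2 k (snd d q)))"
    unfolding frame_limit_def by blast
  note dA = local_frameD(1)[OF d(1)]
  let ?T = "transfer (jac d c q) (jac c d q)"
  have T: "linear ?T" by (rule linear_transfer[OF linear_jac[OF dA c d(2) q(1)]])
  obtain O3 e3 where e3: "local_frame A L X c O3 e3" "snd c q \<in> O3"
    "\<And>k. e3 k (snd c q) = ?T (e2 k (snd d q))"
    by (rule local_frame_in_chart[OF d c q(1) gen_off[OF dA]], assumption+, rule that)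
  have "y = ?T (gen_coords A d q x)"
    unfolding x(2) by (rule gen_coords_change[OF dA c d(2) q(1) xs(1)])
  also have "\<dots> \<in> ?T ` span (range (\<lambda>k. e2 k (snd d q)))" using xs(2) by blast
  also have "\<dots> = span (range (\<lambda>k. e3 k (snd c q)))"
    unfolding linear_span_image[OF T, symmetric] e3(3) image_image ..
  also have "\<dots> = span (range (\<lambda>k. e k (snd c q)))"
    by (rule frame_unique[OF e3(1) lf e3(2) q(2)])
  finally show "y \<in> span (range (\<lambda>k. e k (snd c q)))" .
qed

lemma frame_limit_gen: "frame_limit q \<subseteq> gen_tangent_space A q"
  by (auto simp: frame_limit_def)

lemma local_frame_frame_limit:
  assumes lf: "local_frame A L X c O1 e"
  shows "local_frame A frame_limit {} c O1 e"
proof -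
  note e = local_frameD[OF lf]
  have "gen_coords A c (inv_chart c u) ` frame_limit (inv_chart c u) = span (range (\<lambda>k. e k u))"
    if u: "u \<in> O1" for u
  proof -
    obtain q where q: "q \<in> fst c" "u = snd c q" using e(3) u by blast
    then show ?thesis using frame_limit_coords[OF lf q(1)] u e(1) by simp
  qed
  then show ?thesis using e unfolding local_frame_def by blast
qed

lemma off_frame:
  assumes "q \<in> M - X"
  obtains c O1 e where "local_frame A L X c O1 e" "q \<in> fst c" "snd c q \<in> O1"
proof -
  have "smooth_subbundle A (M - X) L" using dirac by (simp add: twisted_dirac_def)
  obtain c O1 e where
    c: "local_frame A L {} c O1 e" "q \<in> fst c" "snd c q \<in> O1"
    by (rule dirac_local_frame[OF \<open>smooth_subbundle A (M - X) L\<close> max_off assms], assumption, rule that)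
  have "local_frame A L X c O1 e"
    using local_frameD[OF c(1)] unfolding local_frame_def by simp
  then show thesis by (rule that[OF _ c(2,3)])
qed

lemma regular_superset: "M - X \<subseteq> regular_set"
  unfolding regular_set_def using off_frame by blast

lemma frame_limit_eq:
  assumes "q \<in> M - X"
  shows "frame_limit q = L q"
proof -
  obtain c O1 e where lf: "local_frame A L X c O1 e" and q: "q \<in> fst c" "snd c q \<in> O1"
    using off_frame[OF assms] .
  note c = local_frameD(1)[OF lf]
  have "gen_coords A c q ` frame_limit q = gen_coords A c q ` L q"
    using frame_limit_coords[OF lf q] local_frameD(7)[OF lf q(2)] assms c q by simp
  moreover have "inj_on (gen_coords A c q) (gen_tangent_space A q)"
    using gen_coords_inj[OF c q(1)] by (rule inj_onI)
  moreover have "L q \<subseteq> gen_tangent_space A q" using gen_off[OF c q(1)] assms by blast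
  ultimately show ?thesis using inj_on_image_eq_iff[of "gen_coords A c q"] frame_limit_gen by blast
qed

lemma frame_regular: "local_frame A L X c O1 e \<Longrightarrow> O1 \<subseteq> snd c ` (fst c \<inter> regular_set)"
  using local_frameD(3)[of A L X c O1 e] unfolding regular_set_def by blast

lemma openin_regular_set: "openin (atlas_topology A) regular_set"
proof (subst openin_subopen, intro ballI)
  fix q assume "q \<in> regular_set"
  then obtain c O1 e where lf: "local_frame A L X c O1 e" and q: "q \<in> fst c" "snd c q \<in> O1"
    unfolding regular_set_def by blast
  have "openin (atlas_topology A) {q \<in> fst c. snd c q \<in> O1}"
    by (rule openin_chart_preimage[OF local_frameD(1-3)[OF lf]])
  moreover have "{q \<in> fst c. snd c q \<in> O1} \<subseteq> regular_set" unfolding regular_set_def using lf by blast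
  ultimately show "\<exists>T. openin (atlas_topology A) T \<and> q \<in> T \<and> T \<subseteq> regular_set"
    using q by blast
qed

lemma regular_subset: "regular_set \<subseteq> M"
  using openin_regular_set openin_iff by blast

lemma frame_limit_smooth: "smooth_subbundle A regular_set frame_limit"
proof (rule smooth_subbundleI[OF frame_limit_gen])
  fix q assume "q \<in> regular_set"
  then obtain c O1 e where lf: "local_frame A L X c O1 e" and q: "q \<in> fst c" "snd c q \<in> O1"
    unfolding regular_set_def by blast
  then show "\<exists>c O1 e. local_frame A frame_limit {} c O1 e \<and> q \<in> fst c \<and> snd c q \<in> O1 \<and>
      O1 \<subseteq> snd c ` (fst c \<inter> regular_set)"
    using local_frame_frame_limit[OF lf] frame_regular[OF lf] by blast
qed

lemma frame_limit_maximal: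
  assumes "q \<in> regular_set"
  shows "maximally_isotropic A q (frame_limit q)"
proof -
  obtain c O1 e where lf: "local_frame A L X c O1 e" and q: "q \<in> fst c" "snd c q \<in> O1"
    using assms unfolding regular_set_def by blast
  show ?thesis
    unfolding maximally_isotropic_coords[OF local_frameD(1)[OF lf] q(1)] frame_limit_coords[OF lf q]
    using frame_limit_gen frame_lagrangian[OF lf q(2)] by blast
qed

text \<open>The coordinate bracket of two smooth sections is smooth across \<open>X\<close> and lies
  in \<open>L\<close> off \<open>X\<close>. Its pairings with a frame thus vanish everywhere, and
  orthogonality to a Lagrangian span is membership in it.\<close>

lemma frame_limit_involutive: "involutive A regular_set H frame_limit"
  unfolding involutive_def
proof (intro allI impI ballI, elim conjE)
  fix W \<sigma> \<tau> c q
  assume W: "openin (atlas_topology A) W" "W \<subseteq> regular_set"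
    and st: "smooth_section A W frame_limit \<sigma>" "smooth_section A W frame_limit \<tau>"
    and c: "c \<in> A" and q: "q \<in> fst c \<inter> W"
  let ?br = "twisted_bracket (form_coords A H c) (section_coords A c \<sigma>) (section_coords A c \<tau>)"
  obtain d O2 e2 where d: "local_frame A L X d O2 e2" "q \<in> fst d" "snd d q \<in> O2"
    using q W(2) unfolding regular_set_def by blast
  obtain O1 e where lf: "local_frame A L X c O1 e" and qO: "snd c q \<in> O1"
  proof (rule local_frame_in_chart[OF d c IntD1[OF q] gen_off[OF local_frameD(1)[OF d(1)]]])
    fix O1 e assume "local_frame A L X c O1 e" "snd c q \<in> O1"
    then show thesis by (rule that)
  qed assumption+
  note e = local_frameD[OF lf]
  define S where "S = O1 \<inter> snd c ` (fst c \<inter> W)"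
  have S: "open S" unfolding S_def using e(2) open_image[OF W(1) c] by blast
  have smH: "smooth_three_form A M H" using closed_form by (simp add: closed_three_form_def)
  have secs: "smooth_on S (section_coords A c \<sigma>)" "smooth_on S (section_coords A c \<tau>)"
    using st c unfolding smooth_section_def S_def by (auto intro: smooth_on_subset)
  have "openin (atlas_topology A) M" using topspace_atlas openin_topspace by metis
  then have br: "smooth_on S ?br"
    by (rule smooth_on_twisted_bracket[OF smH c _ S _ secs])
      (use W(1) openin_iff in \<open>auto simp: S_def\<close>)
  have qS: "snd c q \<in> S" using q qO by (auto simp: S_def)
  have "copairing (?br (snd c q)) (e k (snd c q)) = 0" for k
  proof (rule zero_if_zero_off_thin[where f = "\<lambda>u. copairing (?br u) (e k u)", OF thin c S])
    show "continuous_on S (\<lambda>u. copairing (?br u) (e k u))"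
      by (rule copairing.continuous_on[OF smooth_on_imp_continuous_on[OF br]
            continuous_on_subset[OF smooth_on_imp_continuous_on[OF e(4)]]]) (auto simp: S_def)
    fix u assume u: "u \<in> S" "inv_chart c u \<notin> X"
    then obtain b where b: "b \<in> fst c" "b \<in> W" "u = snd c b" by (auto simp: S_def)
    have bX: "b \<notin> X" using u b c by simp
    \<comment> \<open>Involutivity of \<open>L\<close> concerns sections over arbitrary open sets,
      so it applies to the restrictions of \<open>\<sigma>\<close> and \<open>\<tau>\<close> to the
      part of \<open>W\<close> off \<open>X\<close>.\<close>
    let ?W' = "W \<inter> (M - X)"
    have "openin (atlas_topology A) ?W'" "?W' \<subseteq> M - X"
      using W(1) dirac by (auto simp: twisted_dirac_def)
    moreover have "smooth_section A ?W' L \<rho>" if \<rho>: "smooth_section A W frame_limit \<rho>" for \<rho>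
      unfolding smooth_section_def
    proof (intro conjI ballI)
      show "\<rho> x \<in> L x" if x: "x \<in> ?W'" for x
        using \<rho> x frame_limit_eq[of x] unfolding smooth_section_def by blast
      show "smooth_on (snd a ` (fst a \<inter> ?W')) (section_coords A a \<rho>)" if a: "a \<in> A" for a
        by (rule smooth_on_subset[of "snd a ` (fst a \<inter> W)"]) (use \<rho> a in \<open>auto simp: smooth_section_def\<close>)
    qed
    moreover have "involutive A (M - X) H L" using dirac by (simp add: twisted_dirac_def)
    moreover have "b \<in> fst c \<inter> ?W'" using b bX c cover by blast
    ultimately have "?br (snd c b) \<in> gen_coords A c b ` L b"
      using st c unfolding involutive_def by blast
    moreover have "gen_coords A c b ` L b = span (range (\<lambda>k. e k u))"
      using e(7)[of u] u b c by (simp add: S_def)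
    ultimately show "copairing (?br u) (e k u) = 0"
      using lagrangian_span_mem[OF frame_lagrangian[OF lf, of u]] u(1) unfolding b(3)[symmetric] S_def by blast
  qed (use qS in \<open>auto simp: S_def\<close>)
  then have "?br (snd c q) \<in> span (range (\<lambda>k. e k (snd c q)))"
    unfolding lagrangian_span_mem[OF frame_lagrangian[OF lf qO]] by blast
  then show "?br (snd c q) \<in> gen_coords A c q ` frame_limit q"
    using frame_limit_coords[OF lf _ qO] q by simp
qed

theorem frame_limit_dirac: "twisted_dirac A regular_set H frame_limit"
  unfolding twisted_dirac_def
  using openin_regular_set closed_three_form_subset[OF closed_form openin_regular_set regular_subset]
    frame_limit_smooth frame_limit_maximal frame_limit_involutive by blast

end

section \<open>Smooth maps and pullbacks\<close>

text \<open>Source and target share the dimension, as is the case for the blowdown. Continuity is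
  encoded by \<open>open_preimage\<close>, chart by chart.\<close>

locale smooth_map_between = B: atlas_on X B + A: atlas_on M A
  for X :: "'b set" and B :: "('b, 'n::finite) chart set" and M :: "'a set" and A :: "('a, 'n) chart set" +
  fixes f :: "'b \<Rightarrow> 'a"
  assumes maps: "\<And>b. b \<in> X \<Longrightarrow> f b \<in> M"
    and open_preimage: "\<And>c a. c \<in> B \<Longrightarrow> a \<in> A \<Longrightarrow> open (snd c ` {b \<in> fst c. f b \<in> fst a})"
    and smooth: "\<And>c a. c \<in> B \<Longrightarrow> a \<in> A \<Longrightarrow>
      smooth_on (snd c ` {b \<in> fst c. f b \<in> fst a}) (\<lambda>u. snd a (f (inv_chart c u)))"
begin

definition mjac :: "('b, 'n) chart \<Rightarrow> ('a, 'n) chart \<Rightarrow> 'b \<Rightarrow> real^'n \<Rightarrow> real^'n" where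
  "mjac c a b = frechet_derivative (\<lambda>u. snd a (f (inv_chart c u))) (at (snd c b))"

lemma mjac_has_derivative:
  assumes "c \<in> B" "b \<in> fst c" "a \<in> A" "f b \<in> fst a"
  shows "((\<lambda>u. snd a (f (inv_chart c u))) has_derivative mjac c a b) (at (snd c b))"
  unfolding mjac_def by (rule smooth_on_has_derivative[OF smooth[OF assms(1,3)]]) (use assms in auto)

lemma linear_mjac:
  assumes "c \<in> B" "b \<in> fst c" "a \<in> A" "f b \<in> fst a"
  shows "linear (mjac c a b)"
  using mjac_has_derivative[OF assms] has_derivative_linear by blast

lemma mjac_jac:
  assumes "c \<in> B" "d \<in> B" "b \<in> fst c" "b \<in> fst d" "a \<in> A" "f b \<in> fst a"
  shows "mjac d a b (jac c d b w) = mjac c a b w"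
proof -
  have "((\<lambda>u. snd a (f (inv_chart d (transition c d u)))) has_derivative (\<lambda>w. mjac d a b (jac c d b w))) (at (snd c b))"
    by (rule has_derivative_compose[OF B.transition_has_derivative[OF assms(1-4)],
          where g = "\<lambda>u. snd a (f (inv_chart d u))" and g' = "mjac d a b"])
      (use mjac_has_derivative[OF assms(2,4,5,6)] assms(1,3) in \<open>simp add: B.trans_apply\<close>)
  then have "frechet_derivative (\<lambda>u. snd a (f (inv_chart d (transition c d u)))) (at (snd c b)) = (\<lambda>w. mjac d a b (jac c d b w))"
    by (rule frechet_derivative_at[symmetric])
  moreover have "frechet_derivative (\<lambda>u. snd a (f (inv_chart d (transition c d u)))) (at (snd c b)) = mjac c a b"
    unfolding mjac_def
    by (rule frechet_derivative_cong_open[OF B.open_overlap[OF assms(1,2)]])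
      (use assms in \<open>auto simp: B.trans_apply\<close>)
  ultimately show ?thesis by metis
qed

lemma jac_mjac:
  assumes "c \<in> B" "b \<in> fst c" "a \<in> A" "a' \<in> A" "f b \<in> fst a" "f b \<in> fst a'"
  shows "jac a a' (f b) (mjac c a b w) = mjac c a' b w"
proof -
  have *: "((\<lambda>u. transition a a' (snd a (f (inv_chart c u)))) has_derivative (\<lambda>w. jac a a' (f b) (mjac c a b w))) (at (snd c b))"
    by (rule has_derivative_compose[OF mjac_has_derivative[OF assms(1,2,3,5)]])
      (use A.transition_has_derivative[OF assms(3,4,5,6)] assms(1,2) in simp)
  have eq: "frechet_derivative (\<lambda>u. transition a a' (snd a (f (inv_chart c u)))) (at (snd c b)) = mjac c a' b"
    unfolding mjac_def
    by (rule frechet_derivative_cong_open[OF open_preimage[OF assms(1,3)]])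
      (use assms in \<open>auto simp: A.trans_apply\<close>)
  show ?thesis using frechet_derivative_at[OF *] eq by metis
qed

text \<open>\<open>tangent_map\<close> computes in an unspecified chart around \<open>b\<close>; the
  two chain rules \<open>mjac_jac\<close> and \<open>jac_mjac\<close> show that every pair of charts
  yields the same vector.\<close>

lemma tangent_map_apply:
  assumes "c \<in> B" "b \<in> fst c" "a \<in> A" "f b \<in> fst a"
  shows "tangent_map B A f b (tangent_of B c b w) = tangent_of A a (f b) (mjac c a b w)"
proof
  fix a'
  have sc: "some_chart B b \<in> B" "b \<in> fst (some_chart B b)"
    using someI[of "\<lambda>c. c \<in> B \<and> b \<in> fst c" c] assms(1,2) by (auto simp: some_chart_def)
  show "tangent_map B A f b (tangent_of B c b w) a' = tangent_of A a (f b) (mjac c a b w) a'"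
  proof (cases "a' \<in> A \<and> f b \<in> fst a'")
    case True
    then have "tangent_map B A f b (tangent_of B c b w) a' = mjac (some_chart B b) a' b (jac c (some_chart B b) b w)"
      by (simp add: tangent_map_def mjac_def o_def Let_def B.tangent_of_apply[OF sc])
    then show ?thesis
      using True mjac_jac[OF assms(1) sc(1) assms(2) sc(2)] jac_mjac[OF assms(1,2,3) _ assms(4)]
      by (simp add: A.tangent_of_apply)
  qed (auto simp: tangent_map_def tangent_of_def)
qed

lemma chart_at:
  assumes "b \<in> fst c" "c \<in> B"
  obtains a where "a \<in> A" "f b \<in> fst a"
  using maps[of b] assms B.cover A.cover by blast

lemma cotangent_map_apply:
  assumes "c \<in> B" "b \<in> fst c" "a \<in> A" "f b \<in> fst a" "\<xi> \<in> cotangent_space A (f b)"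
  shows "cotangent_map B A f b \<xi> =
    cov_of B c b (\<chi> k. (\<chi> j. \<xi> (tangent_of A a (f b) (axis j 1))) \<bullet> mjac c a b (axis k 1))"
proof
  fix v
  show "cotangent_map B A f b \<xi> v =
    cov_of B c b (\<chi> k. (\<chi> j. \<xi> (tangent_of A a (f b) (axis j 1))) \<bullet> mjac c a b (axis k 1)) v"
  proof (cases "v \<in> tangent_space B b")
    case True
    have "\<xi> (tangent_map B A f b v) = \<xi> (tangent_of A a (f b) (mjac c a b (v c)))"
      using B.tangent_eq[OF assms(1,2) True] tangent_map_apply[OF assms(1-4), of "v c"] by simp
    also have "\<dots> = (\<chi> j. \<xi> (tangent_of A a (f b) (axis j 1))) \<bullet> mjac c a b (v c)"
      by (rule A.cotangent_apply[OF assms(3-5)])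
    finally show ?thesis
      using True by (simp add: cotangent_map_def cov_of_def inner_vec_lambda_linear[OF linear_mjac[OF assms(1-4)]])
  qed (simp add: cotangent_map_def cov_of_def)
qed

lemma pullback_dirac_gen:
  assumes "c \<in> B" "b \<in> fst c"
  shows "pullback_dirac B A f L b \<subseteq> gen_tangent_space B b"
proof -
  obtain a where a: "a \<in> A" "f b \<in> fst a" by (rule chart_at[OF assms(2,1)])
  show ?thesis
  proof
    fix x assume "x \<in> pullback_dirac B A f L b"
    then obtain v \<xi> where "v \<in> tangent_space B b" "\<xi> \<in> cotangent_space A (f b)" "x = (v, cotangent_map B A f b \<xi>)"
      unfolding pullback_dirac_def by blast
    then show "x \<in> gen_tangent_space B b"
      by (simp add: gen_tangent_space_def cotangent_map_apply[OF assms a] B.cov_of_in)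
  qed
qed

lemma pullback_dirac_coords:
  assumes "c \<in> B" "b \<in> fst c" "a \<in> A" "f b \<in> fst a" "L (f b) \<subseteq> gen_tangent_space A (f b)"
  shows "gen_coords B c b ` pullback_dirac B A f L b =
    {(w, \<chi> k. \<eta> \<bullet> mjac c a b (axis k 1)) | w \<eta>. (mjac c a b w, \<eta>) \<in> gen_coords A a (f b) ` L (f b)}"
    (is "?l = ?r")
proof (intro subset_antisym subsetI)
  fix x assume "x \<in> ?l"
  then obtain v \<xi> where v: "v \<in> tangent_space B b" and \<xi>: "\<xi> \<in> cotangent_space A (f b)"
    and L: "(tangent_map B A f b v, \<xi>) \<in> L (f b)"
    and x: "x = gen_coords B c b (v, cotangent_map B A f b \<xi>)"
    unfolding pullback_dirac_def by blast
  define \<alpha> where "\<alpha> = (\<chi> j. \<xi> (tangent_of A a (f b) (axis j 1)))"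
  have ve: "v = tangent_of B c b (v c)" by (rule B.tangent_eq[OF assms(1,2) v])
  have tm: "tangent_map B A f b v = tangent_of A a (f b) (mjac c a b (v c))"
    using tangent_map_apply[OF assms(1-4), of "v c"] ve by simp
  have "(v, cotangent_map B A f b \<xi>) = gen_of B c b (v c, \<chi> k. \<alpha> \<bullet> mjac c a b (axis k 1))"
    unfolding cotangent_map_apply[OF assms(1-4) \<xi>] gen_of_def \<alpha>_def using ve by simp
  then have "x = (v c, \<chi> k. \<alpha> \<bullet> mjac c a b (axis k 1))"
    unfolding x by (simp only: B.gen_coords_gen_of[OF assms(1,2)])
  moreover have "gen_coords A a (f b) (tangent_map B A f b v, \<xi>) = (mjac c a b (v c), \<alpha>)"
    unfolding tm by (simp add: gen_coords_def \<alpha>_def A.tangent_of_self[OF assms(3,4)])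
  ultimately show "x \<in> ?r" using L by (metis (mono_tags, lifting) imageI mem_Collect_eq)
next
  fix x assume "x \<in> ?r"
  then obtain w \<eta> y where x: "x = (w, \<chi> k. \<eta> \<bullet> mjac c a b (axis k 1))"
    and y: "y \<in> L (f b)" "(mjac c a b w, \<eta>) = gen_coords A a (f b) y" by blast
  let ?v = "tangent_of B c b w"
  have yg: "y \<in> gen_tangent_space A (f b)" using y(1) assms(5) by blast
  then have yt: "fst y \<in> tangent_space A (f b)" "snd y \<in> cotangent_space A (f b)"
    by (auto simp: gen_tangent_space_def)
  have f1: "fst y a = mjac c a b w" and f2: "\<eta> = (\<chi> j. snd y (tangent_of A a (f b) (axis j 1)))"
    using y(2) by (simp_all add: gen_coords_def)
  have "fst y = tangent_map B A f b ?v"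
    using A.tangent_eq[OF assms(3,4) yt(1)] tangent_map_apply[OF assms(1-4), of w] f1 by simp
  then have "(tangent_map B A f b ?v, snd y) \<in> L (f b)" using y(1) by (metis prod.collapse)
  then have "(?v, cotangent_map B A f b (snd y)) \<in> pullback_dirac B A f L b"
    unfolding pullback_dirac_def using yt(2) B.tangent_of_in[OF assms(1,2)] by blast
  moreover have "gen_coords B c b (?v, cotangent_map B A f b (snd y)) = x"
    unfolding cotangent_map_apply[OF assms(1-4) yt(2)] x f2
    using B.gen_coords_gen_of[OF assms(1,2), of "(w, _)"] by (simp add: gen_of_def)
  ultimately show "x \<in> ?l" by (metis imageI)
qed

lemma pullback_form_coords:
  assumes "c \<in> B" "b \<in> fst c" "a \<in> A" "f b \<in> fst a"
  shows "form_coords B (pullback_three_form B A f H) c (snd c b) x y z =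
    form_coords A H a (snd a (f b)) (mjac c a b x) (mjac c a b y) (mjac c a b z)"
  using assms by (simp add: form_coords_def pullback_three_form_def tangent_map_apply[OF assms] Let_def)

lemma pullback_form_smooth:
  assumes H: "smooth_three_form A M H"
  shows "smooth_three_form B X (pullback_three_form B A f H)"
  unfolding smooth_three_form_def
proof (intro conjI ballI allI)
  fix b assume "b \<in> X"
  then obtain c where c: "c \<in> B" "b \<in> fst c" using B.cover by blast
  obtain a where a: "a \<in> A" "f b \<in> fst a" by (rule chart_at[OF c(2,1)])
  have alt: "alternating_trilinear_on (tangent_space A (f b)) (H (f b))"
    using H maps[OF \<open>b \<in> X\<close>] unfolding smooth_three_form_def by blast
  have tm: "tangent_map B A f b v \<in> tangent_space A (f b)"
    "tangent_map B A f b (lincomb r v s w) = lincomb r (tangent_map B A f b v) s (tangent_map B A f b w)"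
    if v: "v \<in> tangent_space B b" and w: "w \<in> tangent_space B b" for v w r s
  proof -
    have ve: "v = tangent_of B c b (v c)" and we: "w = tangent_of B c b (w c)"
      by (rule B.tangent_eq[OF c v] B.tangent_eq[OF c w])+
    have tv: "tangent_map B A f b v = tangent_of A a (f b) (mjac c a b (v c))"
      and tw: "tangent_map B A f b w = tangent_of A a (f b) (mjac c a b (w c))"
      using tangent_map_apply[OF c a, of "v c"] tangent_map_apply[OF c a, of "w c"] ve we by simp_all
    show "tangent_map B A f b v \<in> tangent_space A (f b)"
      unfolding tv by (rule A.tangent_of_in[OF a])
    have "lincomb r v s w = tangent_of B c b (r *\<^sub>R v c + s *\<^sub>R w c)"
      using B.lincomb_tangent_of[OF c, of r "v c" s "w c"] ve we by simp
    then show "tangent_map B A f b (lincomb r v s w) = lincomb r (tangent_map B A f b v) s (tangent_map B A f b w)"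
      unfolding tv tw A.lincomb_tangent_of[OF a]
      using linear_mjac[OF c a] by (simp add: tangent_map_apply[OF c a] linear_add linear_scale)
  qed
  show "alternating_trilinear_on (tangent_space B b) (pullback_three_form B A f H b)"
    unfolding alternating_trilinear_on_def pullback_three_form_def
  proof (intro ballI conjI allI)
    fix u v w assume u: "u \<in> tangent_space B b" and v: "v \<in> tangent_space B b" and w: "w \<in> tangent_space B b"
    note T = tm(1)[OF u u] tm(1)[OF v v] tm(1)[OF w w]
    show "H (f b) (tangent_map B A f b v) (tangent_map B A f b u) (tangent_map B A f b w) =
        - H (f b) (tangent_map B A f b u) (tangent_map B A f b v) (tangent_map B A f b w)"
      and "H (f b) (tangent_map B A f b u) (tangent_map B A f b w) (tangent_map B A f b v) =
        - H (f b) (tangent_map B A f b u) (tangent_map B A f b v) (tangent_map B A f b w)"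
      using alt T unfolding alternating_trilinear_on_def by blast+
    fix u' r s assume u': "u' \<in> tangent_space B b"
    show "H (f b) (tangent_map B A f b (lincomb r u s u')) (tangent_map B A f b v) (tangent_map B A f b w) =
        r * H (f b) (tangent_map B A f b u) (tangent_map B A f b v) (tangent_map B A f b w) +
        s * H (f b) (tangent_map B A f b u') (tangent_map B A f b v) (tangent_map B A f b w)"
      unfolding tm(2)[OF u u'] using alt T tm(1)[OF u' u'] unfolding alternating_trilinear_on_def by blast
  qed
next
  fix c x y z assume c: "c \<in> B"
  show "smooth_on (snd c ` (fst c \<inter> X)) (\<lambda>u. form_coords B (pullback_three_form B A f H) c u x y z)"
  proof (rule smooth_on_local)
    fix u assume "u \<in> snd c ` (fst c \<inter> X)"
    then obtain b where b: "b \<in> fst c" "u = snd c b" by blast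
    obtain a where a: "a \<in> A" "f b \<in> fst a" by (rule chart_at[OF b(1) c])
    let ?T = "snd c ` {b \<in> fst c. f b \<in> fst a}"
    let ?g = "\<lambda>u. snd a (f (inv_chart c u))"
    note T = open_preimage[OF c a(1)] and g = smooth[OF c a(1)]
    have "openin (atlas_topology A) M" using A.topspace_atlas openin_topspace by metis
    then have "smooth_on ?T (\<lambda>u. form_coords A H a (?g u) (frechet_derivative ?g (at u) x)
        (frechet_derivative ?g (at u) y) (frechet_derivative ?g (at u) z))"
      by (rule A.smooth_on_form_coords[OF H a(1) _ T _ g smooth_on_frechet[OF g] smooth_on_frechet[OF g] smooth_on_frechet[OF g]])
        (use c A.cover a(1) in auto)
    then have "smooth_on ?T (\<lambda>u. form_coords B (pullback_three_form B A f H) c u x y z)"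
      by (subst smooth_on_cong[OF T]) (use c a in \<open>auto simp: pullback_form_coords mjac_def\<close>)
    then show "\<exists>T. open T \<and> u \<in> T \<and> smooth_on T (\<lambda>u. form_coords B (pullback_three_form B A f H) c u x y z)"
      using T b a by blast
  qed
qed

end

text \<open>A smooth map which, over an open set \<open>W\<close> with thin complement, is the identity in suitable
  coordinates. This makes the naturality of all constructions under diffeomorphisms trivial.\<close>

locale chartwise_identity = smooth_map_between X B M A f
  for X :: "'b set" and B :: "('b, 'n::finite) chart set" and M :: "'a set" and A :: "('a, 'n) chart set"
    and f :: "'b \<Rightarrow> 'a" +
  fixes W :: "'b set"
  assumes openW: "openin (atlas_topology B) W"
    and thin: "\<And>T. openin (atlas_topology B) T \<Longrightarrow> T \<subseteq> X - W \<Longrightarrow> T = {}"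
    and ident: "\<And>c. c \<in> B \<Longrightarrow> \<exists>a\<in>A. fst a = f ` (fst c \<inter> W) \<and> (\<forall>b\<in>fst c \<inter> W. snd a (f b) = snd c b)"
    and open_map: "\<And>T. openin (atlas_topology B) T \<Longrightarrow> T \<subseteq> W \<Longrightarrow> openin (atlas_topology A) (f ` T)"
begin

lemma ident_chart:
  assumes "c \<in> B"
  obtains a where "a \<in> A" "fst a = f ` (fst c \<inter> W)" "\<And>b. b \<in> fst c \<Longrightarrow> b \<in> W \<Longrightarrow> snd a (f b) = snd c b"
    "snd a ` fst a = snd c ` (fst c \<inter> W)"
    "\<And>b w. b \<in> fst c \<Longrightarrow> b \<in> W \<Longrightarrow> mjac c a b w = w"
proof -
  obtain a where a: "a \<in> A" "fst a = f ` (fst c \<inter> W)" "\<And>b. b \<in> fst c \<Longrightarrow> b \<in> W \<Longrightarrow> snd a (f b) = snd c b"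
    using ident[OF assms] by blast
  have "mjac c a b w = w" if b: "b \<in> fst c" "b \<in> W" for b w
  proof -
    have "mjac c a b = frechet_derivative (\<lambda>u. u) (at (snd c b))"
      unfolding mjac_def
      by (rule frechet_derivative_cong_open[OF B.open_image[OF openW assms]])
        (use b a assms in auto)
    then show ?thesis by simp
  qed
  moreover have "snd a ` fst a = snd c ` (fst c \<inter> W)"
    unfolding a(2) image_image by (rule image_cong) (use a(3) in auto)
  ultimately show thesis using a that by blast
qed

lemma W_sub: "W \<subseteq> X"
  using openW B.openin_iff by blast

lemma pullback_dirac_ident:
  assumes "c \<in> B" "b \<in> fst c" "b \<in> W" "a \<in> A" "f b \<in> fst a" "\<And>w. mjac c a b w = w"
    and "L (f b) \<subseteq> gen_tangent_space A (f b)"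
  shows "gen_coords B c b ` pullback_dirac B A f L b = gen_coords A a (f b) ` L (f b)"
proof -
  have "(\<chi> k. \<eta> \<bullet> axis k 1) = \<eta>" for \<eta> :: "real^'n" by (simp add: vec_eq_iff inner_axis)
  then show ?thesis
    unfolding pullback_dirac_coords[where L = L, OF assms(1,2,4,5,7)] assms(6) by auto
qed

lemma form_coords_ident:
  assumes "c \<in> B" "b \<in> fst c" "b \<in> W" "a \<in> A" "f b \<in> fst a" "\<And>w. mjac c a b w = w" "snd a (f b) = snd c b"
  shows "form_coords B (pullback_three_form B A f H) c (snd c b) x y z = form_coords A H a (snd c b) x y z"
  unfolding pullback_form_coords[OF assms(1,2,4,5)] assms(6,7) ..

text \<open>In matching charts over \<open>W\<close> the coefficients of the pullback are those of
  \<open>H\<close>, so its exterior derivative vanishes over \<open>W\<close>; the coefficients of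
  that derivative are continuous, which settles the thin rest.\<close>

lemma pullback_form_closed:
  assumes H: "closed_three_form A M H"
  shows "closed_three_form B X (pullback_three_form B A f H)"
  unfolding closed_three_form_def
proof (intro conjI ballI allI)
  let ?H = "pullback_three_form B A f H"
  have smH: "smooth_three_form A M H" using H by (simp add: closed_three_form_def)
  show sm: "smooth_three_form B X ?H" by (rule pullback_form_smooth[OF smH])
  fix c u a0 a1 a2 a3 assume c: "c \<in> B" and u: "u \<in> snd c ` (fst c \<inter> X)"
  let ?F = "\<lambda>(h :: real^'n \<Rightarrow> real^'n \<Rightarrow> real^'n \<Rightarrow> real^'n \<Rightarrow> real) u. frechet_derivative (\<lambda>x. h x a1 a2 a3) (at u) a0
      - frechet_derivative (\<lambda>x. h x a0 a2 a3) (at u) a1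
      + frechet_derivative (\<lambda>x. h x a0 a1 a3) (at u) a2
      - frechet_derivative (\<lambda>x. h x a0 a1 a2) (at u) a3"
  let ?D = "snd c ` fst c"
  have cX: "fst c \<inter> X = fst c" using B.cover c by blast
  have sc: "smooth_on ?D (\<lambda>x. form_coords B ?H c x y1 y2 y3)" for y1 y2 y3
    using sm c cX unfolding smooth_three_form_def by metis
  show "?F (form_coords B ?H c) u = 0"
  proof (rule B.zero_if_zero_off_thin[where f = "?F (form_coords B ?H c)" and S = ?D, OF thin c B.open_domain[OF c]])
    show "continuous_on ?D (?F (form_coords B ?H c))"
      by (intro continuous_intros smooth_on_imp_continuous_on smooth_on_frechet sc)
    fix v assume v: "v \<in> ?D" "inv_chart c v \<notin> X - W"
    then obtain b where b: "b \<in> fst c" "v = snd c b" by blast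
    then have bW: "b \<in> W" using v c cX by auto
    obtain a where a: "a \<in> A" "fst a = f ` (fst c \<inter> W)" "\<And>b. b \<in> fst c \<Longrightarrow> b \<in> W \<Longrightarrow> snd a (f b) = snd c b"
      "snd a ` fst a = snd c ` (fst c \<inter> W)" "\<And>b w. b \<in> fst c \<Longrightarrow> b \<in> W \<Longrightarrow> mjac c a b w = w"
      by (rule ident_chart[OF c]) (rule that)
    have "form_coords B ?H c x y1 y2 y3 = form_coords A H a x y1 y2 y3" if x: "x \<in> snd c ` (fst c \<inter> W)" for x y1 y2 y3
    proof -
      obtain b where "b \<in> fst c" "b \<in> W" "x = snd c b" using x by blast
      then show ?thesis using form_coords_ident[OF c _ _ a(1) _ a(5) a(3)] a(2) by simp
    qed
    then have fd: "frechet_derivative (\<lambda>x. form_coords B ?H c x y1 y2 y3) (at v) = frechet_derivative (\<lambda>x. form_coords A H a x y1 y2 y3) (at v)" for y1 y2 y3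
      by (intro frechet_derivative_cong_open[OF B.open_image[OF openW c]]) (use b bW in auto)
    have "v \<in> snd a ` (fst a \<inter> M)" using a(1,4) A.cover b bW by blast
    then have "?F (form_coords A H a) v = 0"
      using H a(1) unfolding closed_three_form_def by blast
    then show "?F (form_coords B ?H c) v = 0" unfolding fd .
  qed (use u in auto)
qed

lemma pullback_maximal:
  assumes "twisted_dirac A M H L" "b \<in> W"
  shows "maximally_isotropic B b (pullback_dirac B A f L b)"
proof -
  obtain c where c: "c \<in> B" "b \<in> fst c" using assms(2) W_sub B.cover by blast
  obtain a where a: "a \<in> A" "fst a = f ` (fst c \<inter> W)" "\<And>b w. b \<in> fst c \<Longrightarrow> b \<in> W \<Longrightarrow> mjac c a b w = w"
    by (rule ident_chart[OF c(1)]) (rule that)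
  have fa: "f b \<in> fst a" using a(2) c(2) assms(2) by blast
  have "maximally_isotropic A (f b) (L (f b))"
    using assms maps W_sub by (auto simp: twisted_dirac_def)
  then have L: "L (f b) \<subseteq> gen_tangent_space A (f b)" "lagrangian (gen_coords A a (f b) ` L (f b))"
    using A.maximally_isotropic_coords[OF a(1) fa] by blast+
  then show ?thesis
    unfolding B.maximally_isotropic_coords[OF c] pullback_dirac_ident[where L = L, OF c assms(2) a(1) fa a(3)[OF c(2) assms(2)] L(1)]
    using pullback_dirac_gen[OF c] by blast
qed

text \<open>A frame of \<open>L\<close> in the chart \<open>a\<close> is, with the same coordinate
  functions, a frame of the pullback in the chart \<open>c\<close>.\<close>

lemma pullback_smooth:
  assumes D: "twisted_dirac A M H L"
  shows "smooth_subbundle B W (pullback_dirac B A f L)"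
proof (rule B.smooth_subbundleI)
  fix b assume b: "b \<in> W"
  then obtain c where c: "c \<in> B" "b \<in> fst c" using W_sub B.cover by blast
  show "pullback_dirac B A f L b \<subseteq> gen_tangent_space B b" by (rule pullback_dirac_gen[OF c])
  obtain a where a: "a \<in> A" "fst a = f ` (fst c \<inter> W)" "\<And>b. b \<in> fst c \<Longrightarrow> b \<in> W \<Longrightarrow> snd a (f b) = snd c b"
      "snd a ` fst a = snd c ` (fst c \<inter> W)" "\<And>b w. b \<in> fst c \<Longrightarrow> b \<in> W \<Longrightarrow> mjac c a b w = w"
    by (rule ident_chart[OF c(1)]) (rule that)
  have fa: "f b \<in> fst a" using a(2) c(2) b by blast
  have L: "smooth_subbundle A M L" "\<And>q. q \<in> M \<Longrightarrow> maximally_isotropic A q (L q)"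
    using D by (auto simp: twisted_dirac_def)
  have gen: "L q \<subseteq> gen_tangent_space A q" if "q \<in> fst d" "d \<in> A" for q d
    using L(1) A.cover that unfolding smooth_subbundle_def by blast
  have fM: "f b \<in> M" using maps W_sub b by blast
  obtain a0 O0 e0 where a0: "local_frame A L {} a0 O0 e0" "f b \<in> fst a0" "snd a0 (f b) \<in> O0"
    by (rule A.dirac_local_frame[OF L fM], assumption, rule that)
  obtain O1 e where e: "local_frame A L {} a O1 e" "snd a (f b) \<in> O1"
  proof (rule A.local_frame_in_chart[OF a0 a(1) fa])
    show "L q \<subseteq> gen_tangent_space A q" if "q \<in> fst a0" for q
      by (rule gen[OF that local_frameD(1)[OF a0(1)]])
    fix O1 e assume "local_frame A L {} a O1 e" "snd a (f b) \<in> O1"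
    then show thesis by (rule that)
  qed
  note eD = local_frameD[OF e(1)]
  have "local_frame B (pullback_dirac B A f L) {} c O1 e"
    unfolding local_frame_def
  proof (intro conjI ballI impI allI)
    show "O1 \<subseteq> snd c ` fst c" using eD(3) a(4) by blast
    fix u assume u: "u \<in> O1"
    then obtain b' where b': "b' \<in> fst c" "b' \<in> W" "u = snd c b'" using eD(3) a(4) by blast
    have fb': "f b' \<in> fst a" using b' a(2) by blast
    have iu: "inv_chart a u = f b'" using a(1) fb' a(3)[OF b'(1,2)] b'(3) by (metis A.inv_apply)
    have "gen_coords B c b' ` pullback_dirac B A f L b' = gen_coords A a (f b') ` L (f b')"
      by (rule pullback_dirac_ident[where L = L, OF c(1) b'(1,2) a(1) fb' a(5)[OF b'(1,2)] gen[OF fb' a(1)]])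
    also have "\<dots> = span (range (\<lambda>k. e k u))" using eD(7)[OF u] iu by simp
    finally show "gen_coords B c (inv_chart c u) ` pullback_dirac B A f L (inv_chart c u) = span (range (\<lambda>k. e k u))"
      using b' c(1) by simp
  qed (use c eD in auto)
  moreover have "snd c b \<in> O1" using e(2) a(3)[OF c(2) b] by simp
  moreover have "O1 \<subseteq> snd c ` (fst c \<inter> W)" using eD(3) a(4) by blast
  ultimately show "\<exists>c O1 e. local_frame B (pullback_dirac B A f L) {} c O1 e \<and> b \<in> fst c \<and> snd c b \<in> O1 \<and>
      O1 \<subseteq> snd c ` (fst c \<inter> W)"
    using c(2) by blast
qed

lemma pullback_involutive:
  assumes D: "twisted_dirac A M H L"
  shows "involutive B W (pullback_three_form B A f H) (pullback_dirac B A f L)"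
  unfolding involutive_def
proof (intro allI impI ballI, elim conjE)
  let ?H = "pullback_three_form B A f H" and ?L = "pullback_dirac B A f L"
  fix T \<sigma> \<tau> c b
  assume T: "openin (atlas_topology B) T" "T \<subseteq> W"
    and st: "smooth_section B T ?L \<sigma>" "smooth_section B T ?L \<tau>"
    and c: "c \<in> B" and b: "b \<in> fst c \<inter> T"
  obtain a where a: "a \<in> A" "fst a = f ` (fst c \<inter> W)" "\<And>b. b \<in> fst c \<Longrightarrow> b \<in> W \<Longrightarrow> snd a (f b) = snd c b"
      "snd a ` fst a = snd c ` (fst c \<inter> W)" "\<And>b w. b \<in> fst c \<Longrightarrow> b \<in> W \<Longrightarrow> mjac c a b w = w"
    by (rule ident_chart[OF c]) (rule that)
  have gen: "L q \<subseteq> gen_tangent_space A q" if "q \<in> fst a" for q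
    using D A.cover that a(1) unfolding smooth_subbundle_def twisted_dirac_def by blast
  let ?T = "f ` (fst c \<inter> T)"
  let ?S = "snd c ` (fst c \<inter> T)"
  have S: "open ?S" by (rule B.open_image[OF T(1) c])
  have openT: "openin (atlas_topology A) ?T"
    by (rule open_map) (use T B.openin_domain[OF c] in auto)
  have Ta: "?T \<subseteq> fst a" using a(2) T(2) by blast
  have aT: "snd a ` ?T = ?S" unfolding image_image by (rule image_cong) (use a(3) T(2) in auto)
  \<comment> \<open>\<open>push\<close> carries a section down to \<open>M\<close> by keeping its
    coordinate functions. In the chart \<open>a\<close> it looks as it did in \<open>c\<close>, so
    the two brackets agree; smoothness in the other charts of \<open>A\<close> comes from
    \<open>smooth_on_transfer\<close>.\<close>
  define push where "push = (\<lambda>\<rho> q. gen_of A a q (section_coords B c \<rho> (snd a q)))"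
  have push_coords: "gen_coords A a (f b') (push \<rho> (f b')) = gen_coords B c b' (\<rho> b')"
    if b': "b' \<in> fst c" "b' \<in> T" for b' \<rho>
  proof -
    have "f b' \<in> fst a" "snd a (f b') = snd c b'" using b' T(2) a(2,3) by blast+
    then show ?thesis
      using A.gen_coords_gen_of[OF a(1)] b' c by (simp add: push_def section_coords_def)
  qed
  have push_section: "smooth_section A ?T L (push \<rho>)" if \<rho>: "smooth_section B T ?L \<rho>" for \<rho>
    unfolding smooth_section_def
  proof (intro conjI ballI)
    fix q assume "q \<in> ?T"
    then obtain b' where b': "b' \<in> fst c" "b' \<in> T" "q = f b'" by blast
    have W: "b' \<in> W" and fa: "f b' \<in> fst a" using b' T(2) Ta by blast+
    have "\<rho> b' \<in> ?L b'" using \<rho> b'(2) by (simp add: smooth_section_def)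
    then have "gen_coords B c b' (\<rho> b') \<in> gen_coords A a (f b') ` L (f b')"
      unfolding pullback_dirac_ident[where L = L, OF c b'(1) W a(1) fa a(5)[OF b'(1) W] gen[OF fa], symmetric] by blast
    then obtain y where y: "y \<in> L (f b')" "gen_coords A a (f b') (push \<rho> (f b')) = gen_coords A a (f b') y"
      unfolding push_coords[OF b'(1,2), symmetric] by blast
    have "push \<rho> (f b') = y"
    proof (rule A.gen_coords_inj[OF a(1) fa _ _ y(2)])
      show "push \<rho> (f b') \<in> gen_tangent_space A (f b')"
        unfolding push_def by (rule A.gen_of_in[OF a(1) fa])
      show "y \<in> gen_tangent_space A (f b')" using y(1) gen[OF fa] by blast
    qed
    then show "push \<rho> q \<in> L q" using y(1) b'(3) by simp
  next
    fix d assume d: "d \<in> A"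
    let ?O = "snd d ` (fst d \<inter> ?T)"
    have O: "open ?O" by (rule A.open_image[OF openT d])
    have sm: "smooth_on ?S (section_coords B c \<rho>)" using \<rho> c by (simp add: smooth_section_def)
    have "smooth_on ?O (\<lambda>u. transfer (jac a d (inv_chart d u)) (jac d a (inv_chart d u)) (section_coords B c \<rho> (transition d a u)))"
    proof (rule A.smooth_on_transfer[OF a(1) d O _ sm S])
      show "transition d a ` ?O \<subseteq> ?S" unfolding aT[symmetric] using d by (auto simp: A.trans_apply)
      show "?O \<subseteq> snd d ` (fst a \<inter> fst d)" using Ta by blast
    qed
    moreover have "section_coords A d (push \<rho>) u =
        transfer (jac a d (inv_chart d u)) (jac d a (inv_chart d u)) (section_coords B c \<rho> (transition d a u))"
      if u: "u \<in> ?O" for u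
    proof -
      obtain q where q: "q \<in> fst d" "q \<in> ?T" "u = snd d q" using u by blast
      have qa: "q \<in> fst a" using q(2) Ta by blast
      have "gen_coords A d q (push \<rho> q) = transfer (jac a d q) (jac d a q) (gen_coords A a q (push \<rho> q))"
        by (rule A.gen_coords_change[OF a(1) d qa q(1)]) (simp add: push_def A.gen_of_in[OF a(1) qa])
      also have "gen_coords A a q (push \<rho> q) = section_coords B c \<rho> (snd a q)"
        unfolding push_def by (rule A.gen_coords_gen_of[OF a(1) qa])
      finally show ?thesis
        using q d by (simp add: section_coords_def[of A] A.trans_apply)
    qed
    ultimately show "smooth_on ?O (section_coords A d (push \<rho>))"
      by (subst smooth_on_cong[OF O]) auto
  qed
  have sec_eq: "section_coords A a (push \<rho>) u = section_coords B c \<rho> u" if u: "u \<in> ?S" for u \<rho>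
  proof -
    obtain b' where b': "b' \<in> fst c" "b' \<in> T" "u = snd c b'" using u by blast
    have "f b' \<in> fst a" "snd a (f b') = u" using b' T(2) a(2,3) by blast+
    then have "inv_chart a u = f b'" using a(1) by (metis A.inv_apply)
    then show ?thesis using push_coords[OF b'(1,2)] b' c by (simp add: section_coords_def)
  qed
  have bW: "b \<in> W" and bc: "b \<in> fst c" "b \<in> T" using b T(2) by blast+
  have fa: "f b \<in> fst a" using bc bW a(2) by blast
  have inv: "involutive A M H L" using D by (simp add: twisted_dirac_def)
  have "?T \<subseteq> M" using Ta a(1) A.cover by blast
  then have "twisted_bracket (form_coords A H a) (section_coords A a (push \<sigma>)) (section_coords A a (push \<tau>)) (snd a (f b))
      \<in> gen_coords A a (f b) ` L (f b)"
    using inv openT push_section[OF st(1)] push_section[OF st(2)] a(1) fa bc unfolding involutive_def by blast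
  moreover have "twisted_bracket (form_coords A H a) (section_coords A a (push \<sigma>)) (section_coords A a (push \<tau>)) (snd c b)
     = twisted_bracket (form_coords B ?H c) (section_coords B c \<sigma>) (section_coords B c \<tau>) (snd c b)"
  proof (rule twisted_bracket_cong[OF S])
    show "snd c b \<in> ?S" using bc by blast
    show "form_coords A H a (snd c b) x y z = form_coords B ?H c (snd c b) x y z" for x y z
      by (rule form_coords_ident[OF c bc(1) bW a(1) fa a(5)[OF bc(1) bW] a(3)[OF bc(1) bW], symmetric])
  qed (auto simp: sec_eq)
  ultimately show "twisted_bracket (form_coords B ?H c) (section_coords B c \<sigma>) (section_coords B c \<tau>) (snd c b)
      \<in> gen_coords B c b ` ?L b"
    unfolding pullback_dirac_ident[where L = L, OF c bc(1) bW a(1) fa a(5)[OF bc(1) bW] gen[OF fa]] a(3)[OF bc(1) bW] by simp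
qed

theorem pullback_twisted_dirac:
  assumes "twisted_dirac A M H L"
  shows "twisted_dirac B W (pullback_three_form B A f H) (pullback_dirac B A f L)"
proof -
  have "closed_three_form A M H" using assms by (simp add: twisted_dirac_def)
  from B.closed_three_form_subset[OF pullback_form_closed[OF this] openW W_sub]
  show ?thesis
    unfolding twisted_dirac_def
    using openW pullback_smooth[OF assms] pullback_maximal[OF assms] pullback_involutive[OF assms] by blast
qed

end

section \<open>The blowdown map in coordinates\<close>

definition blow :: "'n set \<Rightarrow> 'n \<Rightarrow> real^'n \<Rightarrow> real^'n::finite" where
  "blow S i z = (\<chi> j. if j \<in> S - {i} then z $ i * z $ j else z $ j)"

definition unblow :: "'n set \<Rightarrow> 'n \<Rightarrow> real^'n \<Rightarrow> real^'n::finite" where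
  "unblow S i x = (\<chi> j. if j \<in> S - {i} then x $ j / x $ i else x $ j)"

definition dblow :: "'n set \<Rightarrow> 'n \<Rightarrow> real^'n \<Rightarrow> real^'n \<Rightarrow> real^'n::finite" where
  "dblow S i z w = (\<chi> j. if j \<in> S - {i} then w $ i * z $ j + z $ i * w $ j else w $ j)"

text \<open>Over \<open>z\<^sub>i = 0\<close>, the normal direction represented by the point with coordinates \<open>z\<close>.\<close>

definition exc_dir :: "'n set \<Rightarrow> 'n \<Rightarrow> real^'n \<Rightarrow> real^'n::finite" where
  "exc_dir S i z = (\<chi> j. if j = i then 1 else if j \<in> S then z $ j else 0)"

lemma blow_unblow: "x $ i \<noteq> 0 \<Longrightarrow> blow S i (unblow S i x) = x"
  by (simp add: blow_def unblow_def vec_eq_iff)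

lemma unblow_blow: "z $ i \<noteq> 0 \<Longrightarrow> unblow S i (blow S i z) = z"
  by (simp add: blow_def unblow_def vec_eq_iff)

lemma blow_nth_i [simp]: "blow S i z $ i = z $ i"
  by (simp add: blow_def)

lemma blow_zero: "z $ i = 0 \<Longrightarrow> i \<in> S \<Longrightarrow> j \<in> S \<Longrightarrow> blow S i z $ j = 0"
  by (auto simp: blow_def)

text \<open>The link between division by \<open>z\<^sub>i\<close> and geometry: at a point of the
  divisor, the derivative of the blowdown across the divisor is the normal direction which that
  point represents.\<close>

lemma dblow_axis: "dblow S i z (axis i 1) = exc_dir S i z"
  by (auto simp: dblow_def exc_dir_def axis_def vec_eq_iff)

lemma smooth_on_if_const:
  "smooth_on S f \<Longrightarrow> smooth_on S g \<Longrightarrow> smooth_on S (\<lambda>x. if P then f x else g x)"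
  by (cases P) simp_all

lemma smooth_on_blow: "open O1 \<Longrightarrow> smooth_on O1 f \<Longrightarrow> smooth_on O1 (\<lambda>z. blow S i (f z))"
  unfolding blow_def
  by (intro smooth_on_vec_lambda smooth_on_if_const smooth_on_mult smooth_on_nth)

lemma smooth_on_unblow:
  assumes "open O1" "smooth_on O1 f" "\<And>z. z \<in> O1 \<Longrightarrow> f z $ i \<noteq> 0"
  shows "smooth_on O1 (\<lambda>z. unblow S i (f z))"
  unfolding unblow_def
  by (intro smooth_on_vec_lambda smooth_on_if_const smooth_on_divide smooth_on_nth assms)

lemma smooth_on_dblow:
  assumes "open O1" "smooth_on O1 f" "smooth_on O1 w"
  shows "smooth_on O1 (\<lambda>z. dblow S i (f z) (w z))"
  unfolding dblow_def
  by (intro smooth_on_vec_lambda smooth_on_if_const smooth_on_add smooth_on_mult smooth_on_nth assms)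

lemma blow_has_derivative: "(blow S i has_derivative dblow S i z) (at z)"
proof -
  have "((\<lambda>z. blow S i z $ j) has_derivative (\<lambda>w. dblow S i z w $ j)) (at z)" for j
  proof (cases "j \<in> S - {i}")
    case True
    have "((\<lambda>z. z $ i * z $ j) has_derivative (\<lambda>w. z $ i * w $ j + w $ i * z $ j)) (at z)"
      by (intro has_derivative_mult bounded_linear_imp_has_derivative bounded_linear_vec_nth)
    then show ?thesis using True by (simp add: blow_def dblow_def add.commute)
  next
    case False
    have "((\<lambda>z. z $ j) has_derivative (\<lambda>w. w $ j)) (at z)"
      by (intro bounded_linear_imp_has_derivative bounded_linear_vec_nth)
    moreover have "(\<lambda>z. blow S i z $ j) = (\<lambda>z. z $ j)" "(\<lambda>w. dblow S i z w $ j) = (\<lambda>w. w $ j)"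
      using False by (auto simp: blow_def dblow_def)
    ultimately show ?thesis by simp
  qed
  then have "((\<lambda>z. blow S i z \<bullet> b) has_derivative (\<lambda>w. dblow S i z w \<bullet> b)) (at z)" if "b \<in> Basis" for b
    using that by (auto simp: Basis_vec_def inner_axis)
  then show ?thesis by (subst has_derivative_componentwise_within) blast
qed

lemma linear_dblow: "linear (dblow S i z)"
  using blow_has_derivative has_derivative_linear by blast

text \<open>On the line through \<open>u\<close> in direction \<open>w\<close> the function is zero
  near \<open>u\<close>. Applied to components of a transition map, this shows that changes of
  submanifold charts preserve the tangent spaces of \<open>N\<close>.\<close>

lemma derivative_zero_along:
  fixes h :: "real^'n::finite \<Rightarrow> real"
  assumes "(h has_derivative D) (at u)" "open U" "u \<in> U"
    and "\<And>x. x \<in> U \<Longrightarrow> \<forall>j\<in>S. x $ j = 0 \<Longrightarrow> h x = 0"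
    and "\<forall>j\<in>S. u $ j = 0" "\<forall>j\<in>S. w $ j = 0"
  shows "D w = 0"
proof -
  let ?g = "\<lambda>t::real. u + t *\<^sub>R w"
  have "((\<lambda>t. h (?g t)) has_derivative (\<lambda>s. D (s *\<^sub>R w))) (at 0)"
    by (rule has_derivative_compose[where f = ?g and g = h])
      (use assms(1) in \<open>auto intro!: derivative_eq_intros\<close>)
  moreover have op: "open (?g -` U)"
    by (rule open_vimage[OF assms(2)]) (intro continuous_intros)
  have "((\<lambda>t. h (?g t)) has_derivative (\<lambda>_. 0)) (at 0)"
    by (rule has_derivative_transform_within_open[OF has_derivative_const[of 0] op]) (use assms in auto)
  ultimately have "(\<lambda>s. D (s *\<^sub>R w)) = (\<lambda>_. 0)" by (rule has_derivative_unique)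
  from fun_cong[OF this, of 1] show ?thesis by simp
qed

text \<open>One pair of charts around each point is enough, because every other pair differs from it
  by transition maps.\<close>

lemma smooth_map_betweenI:
  fixes B :: "('b, 'n::finite) chart set" and A :: "('a, 'n) chart set"
  assumes "atlas_on X B" "atlas_on M A"
    and loc: "\<And>b. b \<in> X \<Longrightarrow> \<exists>c\<in>B. \<exists>a\<in>A. \<exists>S. open S \<and> S \<subseteq> snd c ` fst c \<and> b \<in> fst c \<and> snd c b \<in> S \<and>
        (\<forall>u\<in>S. f (inv_chart c u) \<in> fst a) \<and> smooth_on S (\<lambda>u. snd a (f (inv_chart c u)))"
  shows "smooth_map_between X B M A f"
proof -
  interpret B: atlas_on X B by fact
  interpret A: atlas_on M A by fact
  have main: "\<exists>T. open T \<and> u \<in> T \<and> T \<subseteq> snd c' ` {b \<in> fst c'. f b \<in> fst a'} \<and>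
      smooth_on T (\<lambda>u. snd a' (f (inv_chart c' u)))"
    if c': "c' \<in> B" and a': "a' \<in> A" and u: "u \<in> snd c' ` {b \<in> fst c'. f b \<in> fst a'}" for c' a' u
  proof -
    obtain b where b: "b \<in> fst c'" "f b \<in> fst a'" "u = snd c' b" using u by blast
    then have "b \<in> X" using c' B.cover by blast
    then obtain c a S where c: "c \<in> B" "a \<in> A" "open S" "S \<subseteq> snd c ` fst c" "b \<in> fst c" "snd c b \<in> S"
      and fa: "\<And>u. u \<in> S \<Longrightarrow> f (inv_chart c u) \<in> fst a" and sm: "smooth_on S (\<lambda>u. snd a (f (inv_chart c u)))"
      using loc by meson
    let ?G = "\<lambda>u. snd a (f (inv_chart c u))"
    define S1 where "S1 = S \<inter> ?G -` (snd a ` (fst a \<inter> fst a'))"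
    have S1: "open S1" unfolding S1_def
      by (rule continuous_open_preimage[OF smooth_on_imp_continuous_on[OF sm] c(3) A.open_overlap[OF c(2) a']])
    \<comment> \<open>The part of \<open>c'\<close> where both changes of charts, from
      \<open>c'\<close> to \<open>c\<close> and from \<open>a\<close> to \<open>a'\<close>, are
      available.\<close>
    define T where "T = snd c' ` (fst c' \<inter> fst c) \<inter> transition c' c -` S1"
    have T: "open T" unfolding T_def
      by (rule continuous_open_preimage[OF smooth_on_imp_continuous_on[OF B.smooth_transition[OF c' c(1)]] B.open_overlap[OF c' c(1)] S1])
    have mem: "\<exists>b. b \<in> fst c' \<and> b \<in> fst c \<and> v = snd c' b \<and> snd c b \<in> S1 \<and> f b \<in> fst a \<and> f b \<in> fst a'"
      if v: "v \<in> T" for v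
    proof -
      obtain b where b: "b \<in> fst c'" "b \<in> fst c" "v = snd c' b" "snd c b \<in> S1"
        using v by (auto simp: T_def B.trans_apply[OF c'])
      then have "f b \<in> fst a" "snd a (f b) \<in> snd a ` (fst a \<inter> fst a')"
        using fa[of "snd c b"] c(1) by (auto simp: S1_def)
      moreover have "inj_on (snd a) (fst a)" using A.chart[OF c(2)] by (simp add: is_chart_def)
      ultimately have "f b \<in> fst a'" by (auto dest: inj_onD)
      then show ?thesis using b \<open>f b \<in> fst a\<close> by blast
    qed
    have "u \<in> T"
    proof -
      have "f b \<in> fst a" using fa[OF c(6)] c(1,5) by simp
      then have "snd c b \<in> S1" using c b by (auto simp: S1_def)
      then show ?thesis using b c(5) c' by (auto simp: T_def B.trans_apply)
    qed
    moreover have "T \<subseteq> snd c' ` {b \<in> fst c'. f b \<in> fst a'}" using mem by blast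
    moreover have "smooth_on T (\<lambda>u. snd a' (f (inv_chart c' u)))"
    proof -
      have im: "transition c' c ` T \<subseteq> S1" by (auto simp: T_def)
      have imG: "?G ` S1 \<subseteq> snd a ` (fst a \<inter> fst a')" by (auto simp: S1_def)
      have trT: "smooth_on T (transition c' c)"
        by (rule smooth_on_subset[OF B.smooth_transition[OF c' c(1)]]) (auto simp: T_def)
      have "smooth_on S1 ?G" by (rule smooth_on_subset[OF sm]) (auto simp: S1_def)
      from smooth_on_compose[OF S1 A.open_overlap[OF c(2) a'] imG A.smooth_transition[OF c(2) a'] this]
      have "smooth_on S1 (\<lambda>u. transition a a' (?G u))" .
      from smooth_on_compose[OF T S1 im this trT]
      have "smooth_on T (\<lambda>u. transition a a' (?G (transition c' c u)))" .
      moreover have "snd a' (f (inv_chart c' v)) = transition a a' (?G (transition c' c v))" if v: "v \<in> T" for v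
        using mem[OF v] c(1,2) c' by (auto simp: B.trans_apply A.trans_apply)
      ultimately show ?thesis by (subst smooth_on_cong[OF T])
    qed
    ultimately show ?thesis using T by blast
  qed
  show ?thesis
  proof
    show "f b \<in> M" if b: "b \<in> X" for b
    proof -
      obtain c a S where "c \<in> B" "a \<in> A" "b \<in> fst c" "snd c b \<in> S" "\<forall>u\<in>S. f (inv_chart c u) \<in> fst a"
        using loc[OF b] by meson
      then have "f b \<in> fst a" by force
      then show ?thesis using \<open>a \<in> A\<close> A.cover by blast
    qed
    fix c a assume ca: "c \<in> B" "a \<in> A"
    show "open (snd c ` {b \<in> fst c. f b \<in> fst a})"
      by (subst open_subopen) (use main[OF ca] in blast)
    show "smooth_on (snd c ` {b \<in> fst c. f b \<in> fst a}) (\<lambda>u. snd a (f (inv_chart c u)))"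
      by (rule smooth_on_local) (use main[OF ca] in blast)
  qed
qed

section \<open>Normal lines\<close>

locale closed_submanifold = atlas_on M A for M :: "'a set" and A :: "('a, 'n::finite) chart set" +
  fixes N :: "'a set"
  assumes maximal: "maximal_atlas M A = A"
    and submanifold: "closed_embedded_submanifold A N"
begin

lemma sub_chart_mem:
  assumes "submanifold_chart A N c S" "q \<in> fst c"
  shows "q \<in> N \<longleftrightarrow> (\<forall>j\<in>S. snd c q $ j = 0)"
  using assms unfolding submanifold_chart_def by blast

lemma sub_chart_in: "submanifold_chart A N c S \<Longrightarrow> c \<in> A"
  by (simp add: submanifold_chart_def)

text \<open>\<open>submanifold_tangent_space\<close> quantifies over all submanifold charts around
  \<open>q\<close>; this reduces the condition to a single one. The index sets of the two charts may
  differ.\<close>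

lemma sub_tangent_change:
  assumes c: "submanifold_chart A N c S" "q \<in> fst c" and d: "submanifold_chart A N d S'" "q \<in> fst d"
    and q: "q \<in> N" and v: "v \<in> tangent_space A q" "\<forall>j\<in>S. v c $ j = 0" and j: "j \<in> S'"
  shows "v d $ j = 0"
proof -
  note cA = sub_chart_in[OF c(1)] and dA = sub_chart_in[OF d(1)]
  let ?U = "snd c ` (fst c \<inter> fst d)"
  have "jac c d q (v c) $ j = 0"
  proof (rule derivative_zero_along[of "\<lambda>u. transition c d u $ j" "\<lambda>w. jac c d q w $ j" "snd c q" ?U S])
    show "((\<lambda>u. transition c d u $ j) has_derivative (\<lambda>w. jac c d q w $ j)) (at (snd c q))"
      by (rule bounded_linear.has_derivative[OF bounded_linear_vec_nth transition_has_derivative[OF cA dA c(2) d(2)]])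
    show "open ?U" by (rule open_overlap[OF cA dA])
    show "\<forall>j\<in>S. snd c q $ j = 0" using sub_chart_mem[OF c] q by blast
    fix x assume x: "x \<in> ?U" "\<forall>j\<in>S. x $ j = 0"
    then obtain q' where q': "q' \<in> fst c" "q' \<in> fst d" "x = snd c q'" by blast
    then have "q' \<in> N" using sub_chart_mem[OF c(1) q'(1)] x(2) by blast
    then show "transition c d x $ j = 0"
      using sub_chart_mem[OF d(1) q'(2)] j q' cA by (simp add: trans_apply)
  qed (use c d v in auto)
  then show ?thesis using tangent_jac[OF cA dA c(2) d(2) v(1)] by simp
qed

lemma sub_tangent_iff:
  assumes c: "submanifold_chart A N c S" "q \<in> fst c" and q: "q \<in> N"
  shows "v \<in> submanifold_tangent_space A N q \<longleftrightarrow> v \<in> tangent_space A q \<and> (\<forall>j\<in>S. v c $ j = 0)"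
  using sub_tangent_change[OF c _ _ q] c unfolding submanifold_tangent_space_def by blast

lemma scale_in: "v \<in> tangent_space A q \<Longrightarrow> (\<lambda>c. t *\<^sub>R v c) \<in> tangent_space A q"
  using lincomb_in[of v q v t 0] by (simp add: lincomb_def)

lemma normal_class_iff:
  assumes c: "submanifold_chart A N c S" "q \<in> fst c" and q: "q \<in> N" and v: "v \<in> tangent_space A q"
  shows "w \<in> normal_class A N q (\<lambda>c. t *\<^sub>R v c) \<longleftrightarrow> w \<in> tangent_space A q \<and> (\<forall>j\<in>S. w c $ j = t * v c $ j)"
proof -
  have "lincomb 1 w (- 1) (\<lambda>c. t *\<^sub>R v c) \<in> tangent_space A q" if "w \<in> tangent_space A q"
    by (rule lincomb_in[OF that scale_in[OF v]])
  then show ?thesis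
    unfolding normal_class_def sub_tangent_iff[OF c q] by (auto simp: lincomb_def)
qed

lemma Union_normal_line:
  assumes c: "submanifold_chart A N c S" "q \<in> fst c" and q: "q \<in> N" and v: "v \<in> tangent_space A q"
  shows "w \<in> \<Union>(normal_line A N q v) \<longleftrightarrow> w \<in> tangent_space A q \<and> (\<exists>t. t \<noteq> 0 \<and> (\<forall>j\<in>S. w c $ j = t * v c $ j))"
proof -
  have "w \<in> \<Union>(normal_line A N q v) \<longleftrightarrow> (\<exists>t. t \<noteq> 0 \<and> w \<in> normal_class A N q (\<lambda>c. t *\<^sub>R v c))"
    unfolding normal_line_def by blast
  then show ?thesis unfolding normal_class_iff[OF c q v] by blast
qed

lemma normal_line_eqI:
  assumes c: "submanifold_chart A N c S" "q \<in> fst c" and q: "q \<in> N"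
    and v: "v \<in> tangent_space A q" and w: "w \<in> tangent_space A q"
    and t: "t \<noteq> 0" "\<And>j. j \<in> S \<Longrightarrow> w c $ j = t * v c $ j"
  shows "normal_line A N q w = normal_line A N q v"
proof -
  have cl: "normal_class A N q (\<lambda>c. s *\<^sub>R w c) = normal_class A N q (\<lambda>c. (s * t) *\<^sub>R v c)" for s
    by (rule set_eqI) (simp add: normal_class_iff[OF c q v] normal_class_iff[OF c q w] t(2) mult.assoc)
  show ?thesis
  proof (intro subset_antisym subsetI)
    fix x assume "x \<in> normal_line A N q w"
    then show "x \<in> normal_line A N q v" unfolding normal_line_def cl using t(1) by force
  next
    fix x assume "x \<in> normal_line A N q v"
    then obtain r where r: "r \<noteq> 0" "x = normal_class A N q (\<lambda>c. r *\<^sub>R v c)" unfolding normal_line_def by blast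
    then have "x = normal_class A N q (\<lambda>c. (r / t) *\<^sub>R w c)" unfolding cl using t(1) by simp
    then show "x \<in> normal_line A N q w" unfolding normal_line_def using r(1) t(1) by force
  qed
qed

lemma proj_normal_iff:
  assumes c: "submanifold_chart A N c S" "q \<in> fst c" and q: "q \<in> N"
  shows "l \<in> proj_normal_space A N q \<longleftrightarrow>
    (\<exists>v\<in>tangent_space A q. (\<exists>j\<in>S. v c $ j \<noteq> 0) \<and> l = normal_line A N q v)"
  unfolding proj_normal_space_def using sub_tangent_iff[OF c q] by blast

lemma openin_off: "openin (atlas_topology A) (M - N)"
  using submanifold topspace_atlas openin_diff[of "atlas_topology A" M N]
  unfolding closed_embedded_submanifold_def by (metis openin_topspace)

end

section \<open>The smooth structure of the blowup\<close>

text \<open>Compatibility is verified one direction at a time, over ordered pairs of generating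
  charts.\<close>

definition half_compatible :: "('a, 'n::finite) chart \<Rightarrow> ('a, 'n) chart \<Rightarrow> bool" where
  "half_compatible c d \<longleftrightarrow>
     open (snd c ` (fst c \<inter> fst d)) \<and> smooth_on (snd c ` (fst c \<inter> fst d)) (transition c d)"

lemma compatible_half: "compatible c d \<longleftrightarrow> half_compatible c d \<and> half_compatible d c"
  unfolding compatible_def half_compatible_def by (auto simp: Int_commute)

lemma half_compatibleI:
  assumes "is_chart c" "open O1" "snd c ` (fst c \<inter> fst d) = O1" "smooth_on O1 \<phi>"
    and "\<And>b. b \<in> fst c \<Longrightarrow> b \<in> fst d \<Longrightarrow> snd d b = \<phi> (snd c b)"
  shows "half_compatible c d"
  unfolding half_compatible_def assms(3)
proof
  have "transition c d z = \<phi> z" if z: "z \<in> O1" for z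
  proof -
    obtain b where "b \<in> fst c" "b \<in> fst d" "z = snd c b" using z assms(3) by blast
    then show ?thesis using assms(5) transition_apply[OF assms(1)] by simp
  qed
  then show "smooth_on O1 (transition c d)"
    by (subst smooth_on_cong[OF assms(2), of _ \<phi>]) (auto intro: assms(4))
qed (rule assms(2))

text \<open>Agrees literally with the charts that \<open>blowup_atlas\<close> adds for the
  complement of \<open>N\<close>; the value \<open>0\<close> is taken outside the domain.\<close>

definition off_chart :: "('a, 'n::finite) chart \<Rightarrow> (('a, 'n) blowup_point, 'n) chart" where
  "off_chart d = (Inl ` fst d, case_sum (snd d) (\<lambda>_. 0))"

lemma off_chart_simps [simp]:
  "Inl q \<in> fst (off_chart d) \<longleftrightarrow> q \<in> fst d" "Inr x \<notin> fst (off_chart d)" "snd (off_chart d) (Inl q) = snd d q"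
  by (auto simp: off_chart_def)

lemma blowdown_simps [simp]: "blowdown (Inl q) = q" "blowdown (Inr (q, l)) = q"
  by (simp_all add: blowdown_def)

context closed_submanifold
begin

abbreviation "Bl \<equiv> blowup_set M A N"
abbreviation "Exc \<equiv> exceptional_divisor A N"
abbreviation "bchart \<equiv> blowup_chart A N"

text \<open>Inverse of the coordinate map of \<open>bchart c S i\<close>. Over
  \<open>z\<^sub>i = 0\<close> the line is given by its representative with \<open>i\<close>-th
  component one.\<close>

definition blow_point :: "('a, 'n) chart \<Rightarrow> 'n set \<Rightarrow> 'n \<Rightarrow> real^'n \<Rightarrow> ('a, 'n) blowup_point" where
  "blow_point c S i z = (let q = inv_chart c (blow S i z) in
     if z $ i = 0 then Inr (q, normal_line A N q (tangent_of A c q (exc_dir S i z))) else Inl q)"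

lemma bchart_Inl: "Inl q \<in> fst (bchart c S i) \<longleftrightarrow> q \<in> fst c \<and> q \<notin> N \<and> snd c q $ i \<noteq> 0"
  by (auto simp: blowup_chart_def)

lemma bchart_snd_Inl: "snd (bchart c S i) (Inl q) = unblow S i (snd c q)"
  by (simp add: blowup_chart_def unblow_def)

lemma bchart_Inr:
  assumes c: "submanifold_chart A N c S" "q \<in> fst c" and q: "q \<in> N" and i: "i \<in> S" and v: "v \<in> tangent_space A q"
  shows "Inr (q, normal_line A N q v) \<in> fst (bchart c S i) \<longleftrightarrow> v c $ i \<noteq> 0"
proof -
  have "Inr (q, normal_line A N q v) \<in> fst (bchart c S i) \<longleftrightarrow>
      normal_line A N q v \<in> proj_normal_space A N q \<and> (\<exists>w\<in>\<Union>(normal_line A N q v). w c $ i \<noteq> 0)"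
    using c(2) q by (auto simp: blowup_chart_def)
  also have "\<dots> \<longleftrightarrow> v c $ i \<noteq> 0"
  proof
    assume "normal_line A N q v \<in> proj_normal_space A N q \<and> (\<exists>w\<in>\<Union>(normal_line A N q v). w c $ i \<noteq> 0)"
    then obtain w where "w \<in> \<Union>(normal_line A N q v)" "w c $ i \<noteq> 0" by blast
    then obtain t where "w c $ i = t * v c $ i" unfolding Union_normal_line[OF c q v] using i by blast
    then show "v c $ i \<noteq> 0" using \<open>w c $ i \<noteq> 0\<close> by auto
  next
    assume vi: "v c $ i \<noteq> 0"
    have "v \<in> \<Union>(normal_line A N q v)"
      unfolding Union_normal_line[OF c q v] using v by (auto intro: exI[of _ 1])
    moreover have "normal_line A N q v \<in> proj_normal_space A N q"
      unfolding proj_normal_iff[OF c q] using v vi i by blast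
    ultimately show "normal_line A N q v \<in> proj_normal_space A N q \<and> (\<exists>w\<in>\<Union>(normal_line A N q v). w c $ i \<noteq> 0)"
      using vi by blast
  qed
  finally show ?thesis .
qed

text \<open>The representative picked by \<open>SOME\<close> is a nonzero multiple of
  \<open>v\<close> in the normal coordinates, so the quotients do not depend on the choice.\<close>

lemma bchart_snd_Inr:
  assumes c: "submanifold_chart A N c S" "q \<in> fst c" and q: "q \<in> N" and i: "i \<in> S" and v: "v \<in> tangent_space A q"
  shows "snd (bchart c S i) (Inr (q, normal_line A N q v)) =
    (\<chi> j. if j \<in> S - {i} then v c $ j / v c $ i else snd c q $ j)"
proof -
  define w where "w = (SOME w. w \<in> \<Union>(normal_line A N q v))"
  have "v \<in> \<Union>(normal_line A N q v)"
    unfolding Union_normal_line[OF c q v] using v by (auto intro: exI[of _ 1])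
  then have "w \<in> \<Union>(normal_line A N q v)" unfolding w_def by (rule someI[where P = "\<lambda>w. w \<in> \<Union>(normal_line A N q v)"])
  then obtain t where "t \<noteq> 0" "\<And>j. j \<in> S \<Longrightarrow> w c $ j = t * v c $ j"
    unfolding Union_normal_line[OF c q v] by blast
  then have w: "w c $ j / w c $ i = v c $ j / v c $ i" if "j \<in> S - {i}" for j
    using that i by simp
  have "snd (bchart c S i) (Inr (q, normal_line A N q v)) =
    (\<chi> j. if j \<in> S - {i} then w c $ j / w c $ i else snd c q $ j)"
    unfolding blowup_chart_def w_def by (simp only: snd_conv sum.case prod.case Let_def)
  then show ?thesis by (simp add: vec_eq_iff w)
qed

lemma bchart_cases:
  assumes c: "submanifold_chart A N c S" and i: "i \<in> S" and b: "b \<in> fst (bchart c S i)"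
  obtains (off) q where "b = Inl q" "q \<in> fst c" "q \<notin> N" "snd c q $ i \<noteq> 0"
  | (exc) q v where "b = Inr (q, normal_line A N q v)" "q \<in> fst c" "q \<in> N" "v \<in> tangent_space A q" "v c $ i \<noteq> 0"
proof (cases b)
  case (Inl q)
  then show thesis using b off by (auto simp: bchart_Inl)
next
  case (Inr x)
  then obtain q l where x: "x = (q, l)" "q \<in> fst c" "q \<in> N" "l \<in> proj_normal_space A N q"
    using b by (auto simp: blowup_chart_def)
  then obtain v where v: "v \<in> tangent_space A q" "l = normal_line A N q v"
    using proj_normal_iff[OF c x(2,3)] by blast
  have "v c $ i \<noteq> 0" using b bchart_Inr[OF c x(2,3) i v(1)] unfolding Inr x(1) v(2) by blast
  then show thesis using exc[of q v] x v Inr by simp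
qed

lemma blow_point:
  assumes c: "submanifold_chart A N c S" and i: "i \<in> S" and z: "blow S i z \<in> snd c ` fst c"
  shows "blow_point c S i z \<in> fst (bchart c S i)" "snd (bchart c S i) (blow_point c S i z) = z"
    "blowdown (blow_point c S i z) = inv_chart c (blow S i z)"
    "blow_point c S i z \<in> Exc \<longleftrightarrow> z $ i = 0" "inv_chart c (blow S i z) \<in> N \<longleftrightarrow> z $ i = 0"
proof -
  note cA = sub_chart_in[OF c]
  obtain q where q: "q \<in> fst c" "snd c q = blow S i z" using z by force
  have inv: "inv_chart c (blow S i z) = q" using cA q by (metis inv_apply)
  have N: "q \<in> N \<longleftrightarrow> z $ i = 0"
  proof
    assume "q \<in> N"
    then have "snd c q $ i = 0" using sub_chart_mem[OF c q(1)] i by blast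
    then show "z $ i = 0" using q(2) by simp
  next
    assume "z $ i = 0"
    then show "q \<in> N" using sub_chart_mem[OF c q(1)] q(2) blow_zero[of z i S] i by simp
  qed
  then show "inv_chart c (blow S i z) \<in> N \<longleftrightarrow> z $ i = 0" by (simp add: inv)
  show bd: "blowdown (blow_point c S i z) = inv_chart c (blow S i z)"
    by (simp add: blow_point_def Let_def)
  let ?v = "tangent_of A c q (exc_dir S i z)"
  have v: "?v \<in> tangent_space A q" by (rule tangent_of_in[OF cA q(1)])
  have vc: "?v c = exc_dir S i z" by (rule tangent_of_self[OF cA q(1)])
  have "blow_point c S i z \<in> fst (bchart c S i) \<and> snd (bchart c S i) (blow_point c S i z) = z
      \<and> (blow_point c S i z \<in> Exc \<longleftrightarrow> z $ i = 0)"
  proof (cases "z $ i = 0")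
    case True
    have p: "blow_point c S i z = Inr (q, normal_line A N q ?v)"
      by (simp add: blow_point_def inv True)
    have qN: "q \<in> N" using N True by blast
    have 1: "Inr (q, normal_line A N q ?v) \<in> fst (bchart c S i)"
      unfolding bchart_Inr[OF c q(1) qN i v] vc by (simp add: exc_dir_def)
    have "normal_line A N q ?v \<in> proj_normal_space A N q"
      unfolding proj_normal_iff[OF c q(1) qN] using v vc i by (auto simp: exc_dir_def intro!: bexI[of _ ?v] bexI[of _ i])
    then have 2: "Inr (q, normal_line A N q ?v) \<in> Exc" using qN by (auto simp: exceptional_divisor_def)
    have "snd (bchart c S i) (Inr (q, normal_line A N q ?v)) = z"
      unfolding bchart_snd_Inr[OF c q(1) qN i v] vc q(2) by (auto simp: vec_eq_iff exc_dir_def blow_def)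
    then show ?thesis unfolding p using 1 2 True by blast
  next
    case False
    have p: "blow_point c S i z = Inl q" by (simp add: blow_point_def inv False)
    have "q \<notin> N" using N False by blast
    then show ?thesis
      unfolding p using q False by (auto simp: bchart_Inl bchart_snd_Inl unblow_blow exceptional_divisor_def)
  qed
  then show "blow_point c S i z \<in> fst (bchart c S i)" "snd (bchart c S i) (blow_point c S i z) = z"
    "blow_point c S i z \<in> Exc \<longleftrightarrow> z $ i = 0" by blast+
qed

lemma bchart_point:
  assumes c: "submanifold_chart A N c S" and i: "i \<in> S" and b: "b \<in> fst (bchart c S i)"
  shows "blowdown b \<in> fst c" "snd c (blowdown b) = blow S i (snd (bchart c S i) b)"
    "blow_point c S i (snd (bchart c S i) b) = b"
proof -
  note cA = sub_chart_in[OF c]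
  let ?z = "snd (bchart c S i) b"
  have "blowdown b \<in> fst c \<and> snd c (blowdown b) = blow S i ?z \<and> blow_point c S i ?z = b"
    using c i b
  proof (cases rule: bchart_cases)
    case (off q)
    have z: "?z = unblow S i (snd c q)" unfolding off(1) by (rule bchart_snd_Inl)
    have bz: "blow S i ?z = snd c q" unfolding z by (rule blow_unblow[OF off(4)])
    have "?z $ i \<noteq> 0" unfolding z using off(4) by (simp add: unblow_def)
    then have "blow_point c S i ?z = b"
      unfolding blow_point_def Let_def bz using off cA by simp
    then show ?thesis unfolding bz using off by simp
  next
    case (exc q v)
    have z: "?z = (\<chi> j. if j \<in> S - {i} then v c $ j / v c $ i else snd c q $ j)"
      unfolding exc(1) by (rule bchart_snd_Inr[OF c exc(2,3) i exc(4)])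
    have q0: "snd c q $ j = 0" if "j \<in> S" for j
      using sub_chart_mem[OF c exc(2)] exc(3) that by blast
    have zi: "?z $ i = 0" unfolding z using q0[OF i] by simp
    have bz: "blow S i ?z = snd c q"
      unfolding blow_def zi unfolding z using q0 by (simp add: vec_eq_iff)
    let ?w = "tangent_of A c q (exc_dir S i ?z)"
    \<comment> \<open>In the normal coordinates \<open>exc_dir\<close> is \<open>v\<close> divided
      by its \<open>i\<close>-th component, and scaling does not change the line.\<close>
    have "normal_line A N q v = normal_line A N q ?w"
    proof (rule normal_line_eqI[OF c exc(2,3) tangent_of_in[OF cA exc(2)] exc(4,5)])
      show "v c $ j = v c $ i * ?w c $ j" if "j \<in> S" for j
        unfolding tangent_of_self[OF cA exc(2)] exc_dir_def unfolding z using that exc(5) by simp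
    qed
    then have "blow_point c S i ?z = b"
      unfolding blow_point_def Let_def bz zi using exc(1,2) cA by simp
    then show ?thesis unfolding bz using exc by simp
  qed
  then show "blowdown b \<in> fst c" "snd c (blowdown b) = blow S i ?z" "blow_point c S i ?z = b" by blast+
qed

lemma bchart_image:
  assumes c: "submanifold_chart A N c S" and i: "i \<in> S"
  shows "snd (bchart c S i) ` fst (bchart c S i) = blow S i -` (snd c ` fst c)"
proof (intro subset_antisym subsetI)
  fix z assume "z \<in> snd (bchart c S i) ` fst (bchart c S i)"
  then obtain b where b: "b \<in> fst (bchart c S i)" "z = snd (bchart c S i) b" by blast
  show "z \<in> blow S i -` (snd c ` fst c)"
    using bchart_point(1,2)[OF c i b(1)] unfolding b(2) by (metis imageI vimageI2)
next
  fix z assume "z \<in> blow S i -` (snd c ` fst c)"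
  then show "z \<in> snd (bchart c S i) ` fst (bchart c S i)"
    using blow_point(1,2)[OF c i, of z] by (metis image_eqI vimageD)
qed

lemma continuous_blow: "continuous_on UNIV (blow S i)"
  using smooth_on_imp_continuous_on[OF smooth_on_blow[of UNIV "\<lambda>z. z"]] by simp

lemma bchart_is_chart:
  assumes c: "submanifold_chart A N c S" and i: "i \<in> S"
  shows "is_chart (bchart c S i)"
  unfolding is_chart_def bchart_image[OF c i]
proof
  show "inj_on (snd (bchart c S i)) (fst (bchart c S i))"
    by (rule inj_on_inverseI[of _ "blow_point c S i"]) (rule bchart_point(3)[OF c i])
  show "open (blow S i -` snd c ` fst c)"
    by (rule open_vimage[OF open_domain[OF sub_chart_in[OF c]] continuous_blow])
qed

lemma inv_bchart:
  assumes c: "submanifold_chart A N c S" and i: "i \<in> S" and z: "blow S i z \<in> snd c ` fst c"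
  shows "inv_chart (bchart c S i) z = blow_point c S i z"
  using inv_chart_apply[OF bchart_is_chart[OF c i] blow_point(1)[OF c i z]] blow_point(2)[OF c i z] by simp

section \<open>Transition maps between the charts of the blowup\<close>

lemma transition_blow_has_derivative:
  assumes "c \<in> A" "d \<in> A" "q \<in> fst c" "q \<in> fst d" "snd c q = blow S i z"
  shows "((\<lambda>z. transition c d (blow S i z)) has_derivative (\<lambda>w. jac c d q (dblow S i z w))) (at z)"
  by (rule has_derivative_compose[OF blow_has_derivative])
    (use transition_has_derivative[OF assms(1-4)] assms(5) in simp)

text \<open>\<open>G j\<close> is the \<open>j\<close>-th coordinate in \<open>d\<close> divided by
  \<open>z\<^sub>i\<close>. On the divisor it is the \<open>j\<close>-th component in
  \<open>d\<close> of the normal direction, by \<open>dblow_axis\<close>; off the divisor it is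
  proportional to the coordinate itself. For \<open>j\<close> in \<open>S'\<close> the
  \<open>G j\<close> thus serve as homogeneous coordinates in both cases, and their quotients by
  \<open>G i'\<close> are the coordinates of the second chart.\<close>

lemma bchart_overlap:
  assumes c: "submanifold_chart A N c S" and i: "i \<in> S" and d: "submanifold_chart A N d S'" and i': "i' \<in> S'"
  defines "G \<equiv> \<lambda>j. coord_quot i (\<lambda>z. transition c d (blow S i z) $ j)"
  assumes z: "blow S i z \<in> snd c ` (fst c \<inter> fst d)"
  shows "blow_point c S i z \<in> fst (bchart d S' i') \<longleftrightarrow> G i' z \<noteq> 0"
    "G i' z \<noteq> 0 \<Longrightarrow> snd (bchart d S' i') (blow_point c S i z) =
      (\<chi> j. if j \<in> S' - {i'} then G j z / G i' z else transition c d (blow S i z) $ j)"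
proof -
  note cA = sub_chart_in[OF c] and dA = sub_chart_in[OF d]
  obtain q where q: "q \<in> fst c" "q \<in> fst d" "snd c q = blow S i z" using z by force
  have inv: "inv_chart c (blow S i z) = q" using cA q by (metis inv_apply)
  have tr: "transition c d (blow S i z) = snd d q" using trans_apply[OF cA q(1), of d] q(3) by simp
  have N: "q \<in> N \<longleftrightarrow> z $ i = 0" using blow_point(5)[OF c i, of z] z inv by auto
  have "(blow_point c S i z \<in> fst (bchart d S' i') \<longleftrightarrow> G i' z \<noteq> 0) \<and>
    (G i' z \<noteq> 0 \<longrightarrow> snd (bchart d S' i') (blow_point c S i z) =
      (\<chi> j. if j \<in> S' - {i'} then G j z / G i' z else transition c d (blow S i z) $ j))"
  proof (cases "z $ i = 0")
    case True
    let ?v = "tangent_of A c q (exc_dir S i z)"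
    have p: "blow_point c S i z = Inr (q, normal_line A N q ?v)"
      by (simp add: blow_point_def inv True)
    have qN: "q \<in> N" using N True by blast
    have v: "?v \<in> tangent_space A q" by (rule tangent_of_in[OF cA q(1)])
    have G: "G j z = ?v d $ j" for j
    proof -
      have "((\<lambda>z. transition c d (blow S i z) $ j) has_derivative (\<lambda>w. jac c d q (dblow S i z w) $ j)) (at z)"
        by (rule bounded_linear.has_derivative[OF bounded_linear_vec_nth transition_blow_has_derivative[OF cA dA q]])
      then have "frechet_derivative (\<lambda>z. transition c d (blow S i z) $ j) (at z) = (\<lambda>w. jac c d q (dblow S i z w) $ j)"
        by (rule frechet_derivative_at[symmetric])
      then show ?thesis
        by (simp add: G_def coord_quot_def True dblow_axis tangent_of_apply[OF dA q(2)])
    qed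
    show ?thesis
      unfolding p bchart_Inr[OF d q(2) qN i' v] bchart_snd_Inr[OF d q(2) qN i' v] G tr by simp
  next
    case False
    have p: "blow_point c S i z = Inl q" by (simp add: blow_point_def inv False)
    have qN: "q \<notin> N" using N False by blast
    have G: "G j z = snd d q $ j / z $ i" for j
      using False by (simp add: G_def coord_quot_def tr divide_inverse mult.commute)
    show ?thesis
      unfolding p bchart_Inl bchart_snd_Inl G tr using q(2) qN False by (auto simp: unblow_def vec_eq_iff)
  qed
  then show "blow_point c S i z \<in> fst (bchart d S' i') \<longleftrightarrow> G i' z \<noteq> 0"
    "G i' z \<noteq> 0 \<Longrightarrow> snd (bchart d S' i') (blow_point c S i z) =
      (\<chi> j. if j \<in> S' - {i'} then G j z / G i' z else transition c d (blow S i z) $ j)" by blast+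
qed

lemma open_blow_overlap: "c \<in> A \<Longrightarrow> d \<in> A \<Longrightarrow> open (blow S i -` (snd c ` (fst c \<inter> fst d)))"
  by (rule open_vimage[OF open_overlap continuous_blow])

lemma smooth_transition_blow:
  assumes "c \<in> A" "d \<in> A"
  shows "smooth_on (blow S i -` (snd c ` (fst c \<inter> fst d))) (\<lambda>z. transition c d (blow S i z))"
  by (rule smooth_on_compose[OF open_blow_overlap[OF assms] open_overlap[OF assms] _ smooth_transition[OF assms]])
    (auto intro!: smooth_on_blow open_blow_overlap assms)

lemma half_compatible_bb:
  assumes c: "submanifold_chart A N c S" and i: "i \<in> S" and d: "submanifold_chart A N d S'" and i': "i' \<in> S'"
  shows "half_compatible (bchart c S i) (bchart d S' i')"
proof -
  note cA = sub_chart_in[OF c] and dA = sub_chart_in[OF d]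
  let ?\<Omega> = "blow S i -` (snd c ` (fst c \<inter> fst d))"
  let ?h = "\<lambda>j z. transition c d (blow S i z) $ j"
  let ?G = "\<lambda>j. coord_quot i (?h j)"
  have \<Omega>: "open ?\<Omega>" by (rule open_blow_overlap[OF cA dA])
  have h: "smooth_on ?\<Omega> (?h j)" for j
    by (rule smooth_on_nth[OF \<Omega> smooth_transition_blow[OF cA dA]])
  \<comment> \<open>The hyperplane \<open>z\<^sub>i = 0\<close> is mapped into \<open>N\<close>,
    where the normal coordinates of \<open>d\<close> vanish; this is what makes the quotients
    \<open>G j\<close> smooth for \<open>j\<close> in \<open>S'\<close>.\<close>
  have h0: "?h j z = 0" if j: "j \<in> S'" and z: "z \<in> ?\<Omega>" "z $ i = 0" for j z
  proof -
    obtain q where q: "q \<in> fst c" "q \<in> fst d" "snd c q = blow S i z" using z(1) by force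
    have "inv_chart c (blow S i z) = q" using cA q by (metis inv_apply)
    then have "q \<in> N" using blow_point(5)[OF c i, of z] z by auto
    then show ?thesis
      using sub_chart_mem[OF d q(2)] j trans_apply[OF cA q(1), of d] q(3) by simp
  qed
  have G: "smooth_on ?\<Omega> (?G j)" if "j \<in> S'" for j
    by (rule smooth_on_coord_quot[OF \<Omega> h h0[OF that]])
  \<comment> \<open>Where \<open>G i'\<close> is nonzero, and nowhere else in the overlap, the point
    also belongs to the second blowup chart.\<close>
  define Z where "Z = ?\<Omega> \<inter> ?G i' -` (- {0})"
  have Z: "open Z" unfolding Z_def
    by (rule continuous_open_preimage[OF smooth_on_imp_continuous_on[OF G[OF i']] \<Omega>]) auto
  let ?\<phi> = "\<lambda>z. \<chi> j. if j \<in> S' - {i'} then ?G j z / ?G i' z else ?h j z"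
  have "smooth_on Z (\<lambda>z. if j \<in> S' - {i'} then ?G j z / ?G i' z else ?h j z)" for j
  proof (cases "j \<in> S' - {i'}")
    case True
    have "smooth_on Z (\<lambda>z. ?G j z / ?G i' z)"
      by (rule smooth_on_divide[OF Z smooth_on_subset[OF G] smooth_on_subset[OF G[OF i']]])
        (use True in \<open>auto simp: Z_def\<close>)
    then show ?thesis using True by simp
  next
    case False
    have "smooth_on Z (?h j)" by (rule smooth_on_subset[OF h]) (auto simp: Z_def)
    then show ?thesis unfolding if_not_P[OF False] .
  qed
  then have \<phi>: "smooth_on Z ?\<phi>" by (rule smooth_on_vec_lambda[OF Z])
  let ?g = "bchart c S i" and ?k = "bchart d S' i'"
  have pt: "snd ?g b \<in> ?\<Omega>" "b = blow_point c S i (snd ?g b)" if b: "b \<in> fst ?g" "b \<in> fst ?k" for b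
    using bchart_point[OF c i b(1)] bchart_point(1)[OF d i' b(2)] by (auto intro: rev_image_eqI)
  show ?thesis
  proof (rule half_compatibleI[OF bchart_is_chart[OF c i] Z _ \<phi>])
    show "snd ?k b = ?\<phi> (snd ?g b)" if b: "b \<in> fst ?g" "b \<in> fst ?k" for b
    proof -
      have z: "blow S i (snd ?g b) \<in> snd c ` (fst c \<inter> fst d)" using pt(1)[OF b] by simp
      have "?G i' (snd ?g b) \<noteq> 0"
        using bchart_overlap(1)[OF c i d i' z] bchart_point(3)[OF c i b(1)] b(2) by simp
      from bchart_overlap(2)[OF c i d i' z this] show ?thesis
        unfolding bchart_point(3)[OF c i b(1)] .
    qed
    show "snd ?g ` (fst ?g \<inter> fst ?k) = Z"
    proof (intro subset_antisym subsetI)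
      fix z assume "z \<in> snd ?g ` (fst ?g \<inter> fst ?k)"
      then obtain b where b: "b \<in> fst ?g" "b \<in> fst ?k" "z = snd ?g b" by blast
      have z: "blow S i (snd ?g b) \<in> snd c ` (fst c \<inter> fst d)" using pt(1)[OF b(1,2)] by simp
      then show "z \<in> Z"
        using bchart_overlap(1)[OF c i d i' z] bchart_point(3)[OF c i b(1)] b by (simp add: Z_def)
    next
      fix z assume z: "z \<in> Z"
      then have z': "blow S i z \<in> snd c ` (fst c \<inter> fst d)" "?G i' z \<noteq> 0" by (auto simp: Z_def)
      then have "blow_point c S i z \<in> fst ?k" using bchart_overlap(1)[OF c i d i' z'(1)] by simp
      moreover have "blow S i z \<in> snd c ` fst c" using z'(1) by blast
      ultimately show "z \<in> snd ?g ` (fst ?g \<inter> fst ?k)"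
        using blow_point(1,2)[OF c i, of z] by (metis IntI image_eqI)
    qed
  qed
qed

lemma off_chart_is_chart: "d \<in> A \<Longrightarrow> is_chart (off_chart d)"
  using chart[of d] by (auto simp: is_chart_def off_chart_def inj_on_def image_image)

lemma off_chart_image: "snd (off_chart d) ` (fst (off_chart d) \<inter> T) = snd d ` {q \<in> fst d. Inl q \<in> T}"
  by (force simp: off_chart_def)

lemma half_compatible_bo:
  assumes c: "submanifold_chart A N c S" and i: "i \<in> S" and d: "d \<in> A" "fst d \<inter> N = {}"
  shows "half_compatible (bchart c S i) (off_chart d)"
proof -
  note cA = sub_chart_in[OF c]
  let ?g = "bchart c S i" and ?k = "off_chart d"
  show ?thesis
  proof (rule half_compatibleI[OF bchart_is_chart[OF c i] open_blow_overlap[OF cA d(1)] _ smooth_transition_blow[OF cA d(1)]])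
    show "snd ?k b = transition c d (blow S i (snd ?g b))" if b: "b \<in> fst ?g" "b \<in> fst ?k" for b
    proof -
      obtain q where q: "b = Inl q" "q \<in> fst d" using b(2) by (auto simp: off_chart_def)
      have "q \<in> fst c" "snd c q = blow S i (snd ?g b)" using bchart_point(1,2)[OF c i b(1)] q by simp_all
      then show ?thesis using trans_apply[OF cA, of q d] q by simp
    qed
    show "snd ?g ` (fst ?g \<inter> fst ?k) = blow S i -` snd c ` (fst c \<inter> fst d)"
    proof (intro subset_antisym subsetI)
      fix z assume "z \<in> snd ?g ` (fst ?g \<inter> fst ?k)"
      then obtain b where b: "b \<in> fst ?g" "b \<in> fst ?k" "z = snd ?g b" by blast
      then obtain q where q: "b = Inl q" "q \<in> fst d" by (auto simp: off_chart_def)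
      have "q \<in> fst c" "snd c q = blow S i z" using bchart_point(1,2)[OF c i b(1)] q b by simp_all
      then show "z \<in> blow S i -` snd c ` (fst c \<inter> fst d)" using q(2) by (auto intro: rev_image_eqI)
    next
      fix z assume "z \<in> blow S i -` snd c ` (fst c \<inter> fst d)"
      then obtain q where q: "q \<in> fst c" "q \<in> fst d" "snd c q = blow S i z" by force
      have inv: "inv_chart c (blow S i z) = q" using cA q by (metis inv_apply)
      have bz: "blow S i z \<in> snd c ` fst c" using q by (metis imageI)
      have "z $ i \<noteq> 0" using blow_point(5)[OF c i bz] inv q(2) d(2) by blast
      then have "blow_point c S i z = Inl q" by (simp add: blow_point_def inv)
      then show "z \<in> snd ?g ` (fst ?g \<inter> fst ?k)"
        using blow_point(1,2)[OF c i bz] q(2) by (metis IntI image_eqI off_chart_simps(1))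
    qed
  qed
qed

lemma half_compatible_ob:
  assumes c: "submanifold_chart A N c S" and i: "i \<in> S" and d: "d \<in> A" "fst d \<inter> N = {}"
  shows "half_compatible (off_chart d) (bchart c S i)"
proof -
  note cA = sub_chart_in[OF c]
  let ?g = "bchart c S i" and ?k = "off_chart d"
  let ?D = "snd d ` (fst d \<inter> fst c)"
  define Z where "Z = ?D \<inter> (\<lambda>x. transition d c x $ i) -` (- {0})"
  have D: "open ?D" and tr: "smooth_on ?D (transition d c)"
    using open_overlap[OF d(1) cA] smooth_transition[OF d(1) cA] by auto
  have Z: "open Z" unfolding Z_def
    by (rule continuous_open_preimage[OF smooth_on_imp_continuous_on[OF smooth_on_nth[OF D tr]] D]) auto
  have \<phi>: "smooth_on Z (\<lambda>x. unblow S i (transition d c x))"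
    by (rule smooth_on_unblow[OF Z smooth_on_subset[OF tr]]) (auto simp: Z_def)
  show ?thesis
  proof (rule half_compatibleI[OF off_chart_is_chart[OF d(1)] Z _ \<phi>])
    show "snd ?g b = unblow S i (transition d c (snd ?k b))" if b: "b \<in> fst ?k" "b \<in> fst ?g" for b
    proof -
      obtain q where q: "b = Inl q" "q \<in> fst d" using b(1) by (auto simp: off_chart_def)
      then show ?thesis using trans_apply[OF d(1) q(2), of c] by (simp add: bchart_snd_Inl)
    qed
    show "snd ?k ` (fst ?k \<inter> fst ?g) = Z"
      unfolding off_chart_image bchart_Inl Z_def using d by (auto simp: trans_apply)
  qed
qed

lemma half_compatible_oo:
  assumes "c \<in> A" "d \<in> A"
  shows "half_compatible (off_chart c) (off_chart d)"
proof (rule half_compatibleI[OF off_chart_is_chart[OF assms(1)] open_overlap[OF assms] _ smooth_transition[OF assms]])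
  show "snd (off_chart c) ` (fst (off_chart c) \<inter> fst (off_chart d)) = snd c ` (fst c \<inter> fst d)"
    unfolding off_chart_image by auto
  show "snd (off_chart d) b = transition c d (snd (off_chart c) b)"
    if "b \<in> fst (off_chart c)" "b \<in> fst (off_chart d)" for b
    using that assms by (auto simp: off_chart_def trans_apply)
qed

definition gen_charts :: "(('a, 'n) blowup_point, 'n) chart set" where
  "gen_charts = {bchart c S i | c S i. submanifold_chart A N c S \<and> i \<in> S} \<union> {off_chart d | d. d \<in> A \<and> fst d \<inter> N = {}}"

lemma bchart_gen: "submanifold_chart A N c S \<Longrightarrow> i \<in> S \<Longrightarrow> bchart c S i \<in> gen_charts"
  unfolding gen_charts_def
  by (rule UnI1, rule CollectI, rule exI[of _ c], rule exI[of _ S], rule exI[of _ i]) simp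

lemma off_chart_gen: "d \<in> A \<Longrightarrow> fst d \<inter> N = {} \<Longrightarrow> off_chart d \<in> gen_charts"
  unfolding gen_charts_def by (rule UnI2, rule CollectI, rule exI[of _ d]) simp

lemma gen_charts_cases:
  assumes "k \<in> gen_charts"
  obtains (b) c S i where "k = bchart c S i" "submanifold_chart A N c S" "i \<in> S"
  | (o) d where "k = off_chart d" "d \<in> A" "fst d \<inter> N = {}"
  using assms unfolding gen_charts_def
proof (elim UnE CollectE exE conjE)
  fix c S i assume "k = bchart c S i" "submanifold_chart A N c S" "i \<in> S"
  then show thesis by (rule b)
next
  fix d assume "k = off_chart d" "d \<in> A" "fst d \<inter> N = {}"
  then show thesis by (rule o)
qed

lemma half_compatible_gen_charts:
  assumes k: "k \<in> gen_charts" and l: "l \<in> gen_charts"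
  shows "half_compatible k l"
  using k
proof (cases rule: gen_charts_cases)
  case k: (b c S i)
  show ?thesis
    using l
  proof (cases rule: gen_charts_cases)
    case l: (b d S' i')
    show ?thesis unfolding k(1) l(1) by (rule half_compatible_bb[OF k(2,3) l(2,3)])
  next
    case l: (o d)
    show ?thesis unfolding k(1) l(1) by (rule half_compatible_bo[OF k(2,3) l(2,3)])
  qed
next
  case k: (o e)
  show ?thesis
    using l
  proof (cases rule: gen_charts_cases)
    case l: (b d S' i')
    show ?thesis unfolding k(1) l(1) by (rule half_compatible_ob[OF l(2,3) k(2,3)])
  next
    case l: (o d)
    show ?thesis unfolding k(1) l(1) by (rule half_compatible_oo[OF k(2) l(2)])
  qed
qed

lemma blowup_atlas_eq: "blowup_atlas M A N = maximal_atlas Bl gen_charts"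
  by (simp add: blowup_atlas_def gen_charts_def off_chart_def)

lemma restrict_off:
  assumes "d \<in> A"
  shows "(fst d - N, snd d) \<in> A"
proof -
  have "fst d \<inter> (M - N) = fst d - N" using cover assms by blast
  then show ?thesis using restrict_chart[OF maximal assms openin_off] by simp
qed

text \<open>A vector not tangent to \<open>N\<close> has a nonzero normal coordinate in any
  submanifold chart; its index selects the blowup chart.\<close>

lemma exc_point:
  assumes "b \<in> Exc"
  obtains c S i where "submanifold_chart A N c S" "i \<in> S" "b \<in> fst (bchart c S i)"
proof -
  obtain q l where b: "b = Inr (q, l)" "q \<in> N" "l \<in> proj_normal_space A N q"
    using assms by (auto simp: exceptional_divisor_def)
  obtain c S where c: "submanifold_chart A N c S" "q \<in> fst c"
    using submanifold b(2) unfolding closed_embedded_submanifold_def by blast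
  obtain v i where v: "v \<in> tangent_space A q" "i \<in> S" "v c $ i \<noteq> 0" "l = normal_line A N q v"
    using b(3) unfolding proj_normal_iff[OF c b(2)] by blast
  then show thesis using that[OF c(1) v(2)] bchart_Inr[OF c b(2) v(2,1)] b(1) by simp
qed

lemma smooth_atlas_gen_charts: "smooth_atlas Bl gen_charts"
  unfolding smooth_atlas_def
proof (intro conjI ballI)
  show "is_chart k" if "k \<in> gen_charts" for k
    by (rule gen_charts_cases[OF that]) (simp_all add: bchart_is_chart off_chart_is_chart)
  show "compatible k l" if "k \<in> gen_charts" "l \<in> gen_charts" for k l
    unfolding compatible_half using half_compatible_gen_charts that by blast
  show "(\<Union>k\<in>gen_charts. fst k) = Bl"
  proof (intro subset_antisym subsetI)
    fix b assume "b \<in> (\<Union>k\<in>gen_charts. fst k)"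
    then obtain k where k: "k \<in> gen_charts" "b \<in> fst k" by blast
    show "b \<in> Bl"
    using k(1) proof (cases rule: gen_charts_cases)
      case (b c S i)
      then have "fst c \<subseteq> M" using sub_chart_in cover by blast
      then show ?thesis
        using k(2) unfolding b(1) by (auto simp: blowup_set_def blowup_chart_def exceptional_divisor_def)
    next
      case (o d)
      then have "fst d \<subseteq> M" using cover by blast
      then show ?thesis using k(2) o by (auto simp: blowup_set_def off_chart_def)
    qed
  next
    fix b assume b: "b \<in> Bl"
    show "b \<in> (\<Union>k\<in>gen_charts. fst k)"
    proof (cases "b \<in> Exc")
      case True
      then obtain c S i where "submanifold_chart A N c S" "i \<in> S" "b \<in> fst (bchart c S i)"
        by (rule exc_point)
      then show ?thesis using bchart_gen by blast
    next
      case False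
      then obtain q where q: "b = Inl q" "q \<in> M" "q \<notin> N" using b by (auto simp: blowup_set_def)
      then obtain d where d: "d \<in> A" "q \<in> fst d" using cover by blast
      have "off_chart (fst d - N, snd d) \<in> gen_charts"
        by (rule off_chart_gen[OF restrict_off[OF d(1)]]) auto
      moreover have "b \<in> fst (off_chart (fst d - N, snd d))" using q d by simp
      ultimately show ?thesis by blast
    qed
  qed
qed

end

section \<open>Pulling back along the blowdown map\<close>

text \<open>\<open>pblow S i z\<close> is \<open>z\<^sub>i\<close> times the inverse of \<open>dblow S i z\<close>, extended over \<open>z\<^sub>i = 0\<close>.\<close>

definition pblow :: "'n set \<Rightarrow> 'n \<Rightarrow> real^'n \<Rightarrow> real^'n \<Rightarrow> real^'n::finite" where
  "pblow S i z y = (\<chi> j. if j \<in> S - {i} then y $ j - y $ i * z $ j else z $ i * y $ j)"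

lemma pblow_dblow: "pblow S i z (dblow S i z w) = z $ i *\<^sub>R w"
  and dblow_pblow: "dblow S i z (pblow S i z w) = z $ i *\<^sub>R w"
  by (auto simp: pblow_def dblow_def vec_eq_iff algebra_simps)

lemma linear_pblow: "linear (pblow S i z)"
  by (auto intro!: linearI simp: pblow_def vec_eq_iff algebra_simps)

lemma smooth_on_pblow:
  assumes "open O1" "smooth_on O1 f" "smooth_on O1 w"
  shows "smooth_on O1 (\<lambda>z. pblow S i (f z) (w z))"
  unfolding pblow_def
  by (intro smooth_on_vec_lambda smooth_on_if_const smooth_on_diff smooth_on_mult smooth_on_nth assms)

text \<open>Where \<open>z\<^sub>i\<close> is nonzero this is \<open>z\<^sub>i\<close> times the
  pullback by \<open>dblow S i z\<close>: the inverse on vectors, the transpose on covectors. The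
  factor clears the pole of the inverse.\<close>

definition gen_pull :: "'n set \<Rightarrow> 'n \<Rightarrow> real^'n \<Rightarrow> (real^'n) \<times> (real^'n) \<Rightarrow> (real^'n::finite) \<times> (real^'n)" where
  "gen_pull S i z = transfer (pblow S i z) (\<lambda>w. z $ i *\<^sub>R dblow S i z w)"

text \<open>Where \<open>z\<^sub>i\<close> is nonzero this is \<open>z\<^sub>i\<^sup>2\<close> times
  the inverse transpose of \<open>gen_pull S i z\<close>. It is also \<open>gen_pull\<close>
  conjugated by swapping vectors and covectors, and hence smooth in \<open>z\<close>.\<close>

definition gen_dual :: "'n set \<Rightarrow> 'n \<Rightarrow> real^'n \<Rightarrow> (real^'n) \<times> (real^'n) \<Rightarrow> (real^'n::finite) \<times> (real^'n)" where
  "gen_dual S i z x = (\<chi> k. fst x \<bullet> (z $ i *\<^sub>R dblow S i z (axis k 1)), pblow S i z (snd x))"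

lemma linear_gen_pull: "linear (gen_pull S i z)"
  unfolding gen_pull_def by (rule linear_transfer[OF linear_pblow])

lemma smooth_on_covector:
  assumes "open O1" "smooth_on O1 f" "smooth_on O1 \<alpha>"
  shows "smooth_on O1 (\<lambda>z. \<chi> k. \<alpha> z \<bullet> (f z $ i *\<^sub>R dblow S i (f z) (axis k 1)))"
  by (intro smooth_on_vec_lambda smooth_on_inner smooth_on_scaleR smooth_on_nth smooth_on_dblow assms smooth_on_const)

lemma smooth_on_gen_pull:
  assumes "open O1" "smooth_on O1 x"
  shows "smooth_on O1 (\<lambda>z. gen_pull S i z (x z))"
  unfolding gen_pull_def transfer_def
  by (intro smooth_on_Pair smooth_on_pblow smooth_on_covector smooth_on_fst smooth_on_snd assms smooth_on_id)

lemma smooth_on_gen_dual: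
  assumes "open O1" "smooth_on O1 x"
  shows "smooth_on O1 (\<lambda>z. gen_dual S i z (x z))"
  unfolding gen_dual_def
  by (intro smooth_on_Pair smooth_on_pblow smooth_on_covector smooth_on_fst smooth_on_snd assms smooth_on_id)

text \<open>In each component \<open>pblow\<close> meets the transpose of \<open>z\<^sub>i\<close>
  times \<open>dblow\<close>. One factor \<open>z\<^sub>i\<close> comes from
  \<open>dblow_pblow\<close>, the other from the scaling.\<close>

lemma gen_pull_inner_gen_dual: "gen_pull S i z x \<bullet> gen_dual S i z y = (z $ i)\<^sup>2 * (x \<bullet> y)"
proof -
  have L: "linear (\<lambda>w. z $ i *\<^sub>R dblow S i z w)"
    by (rule linear_compose_scale_right[OF linear_dblow])
  have "(\<chi> k. \<alpha> \<bullet> (z $ i *\<^sub>R dblow S i z (axis k 1))) \<bullet> pblow S i z w = (z $ i)\<^sup>2 * (\<alpha> \<bullet> w)" for \<alpha> w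
    using inner_vec_lambda_linear[OF L, of \<alpha> "pblow S i z w"] by (simp add: dblow_pblow power2_eq_square)
  then show ?thesis
    by (simp add: gen_pull_def gen_dual_def transfer_def inner_prod_def inner_commute[of "pblow S i z _"] algebra_simps)
      (simp add: inner_commute)
qed

text \<open>The left side is the true pullback of \<open>K\<close>; a subspace absorbs the scalar by
  which \<open>gen_pull\<close> differs from it.\<close>

lemma gen_pull_image:
  assumes "subspace K" "z $ i \<noteq> 0"
  shows "{(w, \<chi> k. \<eta> \<bullet> dblow S i z (axis k 1)) | w \<eta>. (dblow S i z w, \<eta>) \<in> K} = gen_pull S i z ` K"
proof (intro subset_antisym subsetI)
  fix y assume "y \<in> {(w, \<chi> k. \<eta> \<bullet> dblow S i z (axis k 1)) | w \<eta>. (dblow S i z w, \<eta>) \<in> K}"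
  then obtain w \<eta> where y: "y = (w, \<chi> k. \<eta> \<bullet> dblow S i z (axis k 1))" "(dblow S i z w, \<eta>) \<in> K" by blast
  let ?x = "inverse (z $ i) *\<^sub>R (dblow S i z w, \<eta>)"
  have "gen_pull S i z ?x = y"
    unfolding linear_scale[OF linear_gen_pull] using assms(2) y(1)
    by (simp add: gen_pull_def transfer_def pblow_dblow vec_eq_iff)
  moreover have "?x \<in> K" by (rule subspace_scale[OF assms(1) y(2)])
  ultimately show "y \<in> gen_pull S i z ` K" by blast
next
  fix y assume "y \<in> gen_pull S i z ` K"
  then obtain x where x: "x \<in> K" "y = gen_pull S i z x" by blast
  have "z $ i *\<^sub>R x \<in> K" by (rule subspace_scale[OF assms(1) x(1)])
  then have "(dblow S i z (pblow S i z (fst x)), z $ i *\<^sub>R snd x) \<in> K"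
    unfolding dblow_pblow by (simp add: scaleR_prod_def)
  moreover have "y = (pblow S i z (fst x), \<chi> k. (z $ i *\<^sub>R snd x) \<bullet> dblow S i z (axis k 1))"
    unfolding x(2) gen_pull_def transfer_def by simp
  ultimately show "y \<in> {(w, \<chi> k. \<eta> \<bullet> dblow S i z (axis k 1)) | w \<eta>. (dblow S i z w, \<eta>) \<in> K}" by blast
qed

context closed_submanifold
begin

abbreviation "BA \<equiv> blowup_atlas M A N"

lemma atlas_on_blowup: "atlas_on Bl BA"
  unfolding atlas_on_def blowup_atlas_eq by (rule smooth_atlas_maximal_atlas(1)[OF smooth_atlas_gen_charts])

interpretation B: atlas_on Bl BA by (rule atlas_on_blowup)

lemma gen_in: "k \<in> gen_charts \<Longrightarrow> k \<in> BA"
  unfolding blowup_atlas_eq using smooth_atlas_maximal_atlas(2)[OF smooth_atlas_gen_charts] by blast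

lemma bchart_in: "submanifold_chart A N c S \<Longrightarrow> i \<in> S \<Longrightarrow> bchart c S i \<in> BA"
  by (rule gen_in[OF bchart_gen])

lemma off_restrict_in: "d \<in> A \<Longrightarrow> off_chart (fst d - N, snd d) \<in> BA"
  by (rule gen_in[OF off_chart_gen[OF restrict_off]]) auto

lemma inv_off_chart:
  assumes "d \<in> A" "u \<in> snd d ` fst d"
  shows "inv_chart (off_chart d) u = Inl (inv_chart d u)"
proof -
  obtain q where "q \<in> fst d" "u = snd d q" using assms(2) by blast
  then show ?thesis using inv_chart_apply[OF off_chart_is_chart[OF assms(1)], of "Inl q"] assms(1) by simp
qed

lemma inv_bchart_blowdown:
  assumes "submanifold_chart A N c S" "i \<in> S" "blow S i u \<in> snd c ` fst c"
  shows "blowdown (inv_chart (bchart c S i) u) \<in> fst c"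
    "snd c (blowdown (inv_chart (bchart c S i) u)) = blow S i u"
  using bchart_point(1,2)[OF assms(1,2) blow_point(1)[OF assms]] blow_point(2)[OF assms]
  unfolding inv_bchart[OF assms] by simp_all

lemma smooth_map_blowdown: "smooth_map_between Bl BA M A blowdown"
proof (rule smooth_map_betweenI[OF atlas_on_blowup atlas_on_axioms])
  fix b assume "b \<in> Bl"
  then obtain k where k: "k \<in> gen_charts" "b \<in> fst k"
    using smooth_atlas_gen_charts unfolding smooth_atlas_def by blast
  from k(1) show "\<exists>c\<in>BA. \<exists>a\<in>A. \<exists>S. open S \<and> S \<subseteq> snd c ` fst c \<and> b \<in> fst c \<and> snd c b \<in> S \<and>
        (\<forall>u\<in>S. blowdown (inv_chart c u) \<in> fst a) \<and> smooth_on S (\<lambda>u. snd a (blowdown (inv_chart c u)))"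
  proof (cases rule: gen_charts_cases)
    case c: (b c S i)
    let ?S = "snd k ` fst k"
    have S: "open ?S" by (rule B.open_domain[OF gen_in[OF k(1)]])
    have u: "blow S i u \<in> snd c ` fst c" if "u \<in> ?S" for u
      using that bchart_image[OF c(2,3)] unfolding c(1) by blast
    have "smooth_on ?S (\<lambda>u. snd c (blowdown (inv_chart k u)))"
      by (subst smooth_on_cong[OF S, of _ "blow S i"])
        (use u inv_bchart_blowdown(2)[OF c(2,3)] S smooth_on_blow[OF S smooth_on_id[OF S]] in \<open>auto simp: c(1)\<close>)
    moreover have "\<forall>u\<in>?S. blowdown (inv_chart k u) \<in> fst c"
      using u inv_bchart_blowdown(1)[OF c(2,3)] unfolding c(1) by blast
    ultimately show ?thesis
      using gen_in[OF k(1)] sub_chart_in[OF c(2)] S k(2)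
      by (intro bexI[of _ k] bexI[of _ c] exI[of _ ?S]) auto
  next
    case d: (o d)
    let ?S = "snd d ` fst d"
    have S: "open ?S" by (rule open_domain[OF d(2)])
    have inv: "blowdown (inv_chart k u) \<in> fst d \<and> snd d (blowdown (inv_chart k u)) = u" if "u \<in> ?S" for u
      using inv_off_chart[OF d(2) that] that d(1,2) by auto
    have "smooth_on ?S (\<lambda>u. snd d (blowdown (inv_chart k u)))"
      by (subst smooth_on_cong[OF S, of _ "\<lambda>u. u"]) (use inv S in auto)
    moreover have "?S \<subseteq> snd k ` fst k" "snd k b \<in> ?S"
      using k(2) unfolding d(1) off_chart_def by force+
    ultimately show ?thesis
      using gen_in[OF k(1)] d(2) S k(2) inv
      by (intro bexI[of _ k] bexI[of _ d] exI[of _ ?S]) auto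
  qed
qed

section \<open>The complement of the exceptional divisor\<close>

lemma Bl_off: "Bl - Exc = Inl ` (M - N)"
  by (auto simp: blowup_set_def exceptional_divisor_def)

lemma Exc_sub: "Exc \<subseteq> Bl"
  by (simp add: blowup_set_def)

text \<open>In a blowup chart the divisor is the hyperplane \<open>z\<^sub>i = 0\<close>, and every
  nonempty open set leaves a hyperplane.\<close>

lemma Exc_thin:
  assumes "openin (atlas_topology BA) T" "T \<subseteq> Exc"
  shows "T = {}"
proof (rule ccontr)
  assume "T \<noteq> {}"
  then obtain b where b: "b \<in> T" "b \<in> Exc" using assms(2) by blast
  obtain c S i where c: "submanifold_chart A N c S" "i \<in> S" and bc: "b \<in> fst (bchart c S i)"
    using exc_point[OF b(2)] .
  let ?g = "bchart c S i"
  have op: "open (snd ?g ` (fst ?g \<inter> T))" by (rule B.open_image[OF assms(1) bchart_in[OF c]])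
  have z0: "snd ?g b \<in> snd ?g ` (fst ?g \<inter> T)" using b bc by blast
  obtain s :: "nat \<Rightarrow> real^'n" where s: "\<And>n. s n \<in> snd ?g ` (fst ?g \<inter> T)" "\<And>n. s n $ i \<noteq> 0"
    by (rule off_hyperplane_sequence[OF op z0, of i]) (rule that)
  obtain b' where b': "b' \<in> fst ?g" "b' \<in> T" "s 0 = snd ?g b'" using s(1)[of 0] by blast
  have "blow S i (snd ?g b') \<in> snd c ` fst c" using bchart_point(1,2)[OF c b'(1)] by (metis imageI)
  from blow_point(4)[OF c this] have "snd ?g b' $ i = 0"
    unfolding bchart_point(3)[OF c b'(1)] using b'(2) assms(2) by blast
  then show False using s(2)[of 0] b'(3) by simp
qed

lemma off_restrict_image:
  assumes "d \<in> A" "T \<subseteq> Bl - Exc"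
  shows "snd (off_chart (fst d - N, snd d)) ` (fst (off_chart (fst d - N, snd d)) \<inter> T) = snd d ` (fst d \<inter> blowdown ` T)"
  unfolding off_chart_image using assms(2) unfolding Bl_off by force

lemma openin_Bl_off: "openin (atlas_topology BA) (Bl - Exc)"
proof (subst openin_subopen, intro ballI)
  fix b assume "b \<in> Bl - Exc"
  then obtain q where q: "b = Inl q" "q \<in> M" "q \<notin> N" unfolding Bl_off by blast
  then obtain d where d: "d \<in> A" "q \<in> fst d" using cover by blast
  let ?k = "off_chart (fst d - N, snd d)"
  have "fst ?k \<subseteq> Bl - Exc" unfolding Bl_off using cover d(1) by (auto simp: off_chart_def)
  moreover have "b \<in> fst ?k" using q d by simp
  ultimately show "\<exists>T. openin (atlas_topology BA) T \<and> b \<in> T \<and> T \<subseteq> Bl - Exc"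
    using B.openin_domain[OF off_restrict_in[OF d(1)]] by blast
qed

text \<open>The maximal blowup atlas contains charts beyond the generating ones. Each of them,
  restricted to the complement of the divisor and moved down, lies in \<open>A\<close> by
  maximality: compatibility with \<open>d\<close> is compatibility upstairs with the lift of
  \<open>d\<close> restricted to the complement of \<open>N\<close>.\<close>

lemma off_chart_transport:
  assumes c: "c \<in> BA"
  shows "(blowdown ` (fst c \<inter> (Bl - Exc)), \<lambda>q. snd c (Inl q)) \<in> A" (is "?a \<in> A")
proof -
  have fa: "q \<in> fst ?a \<longleftrightarrow> q \<in> M \<and> q \<notin> N \<and> Inl q \<in> fst c" for q
    unfolding Bl_off by force
  have inj: "inj_on (snd c) (fst c)" using B.chart[OF c] by (simp add: is_chart_def)
  have chart_a: "is_chart ?a"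
    unfolding is_chart_def
  proof
    show "inj_on (snd ?a) (fst ?a)"
      by (rule inj_onI) (use fa inj_onD[OF inj] in force)
    have "snd ?a ` fst ?a = snd c ` (fst c \<inter> (Bl - Exc))" unfolding Bl_off by force
    then show "open (snd ?a ` fst ?a)" using B.open_image[OF openin_Bl_off c] by simp
  qed
  have "compatible ?a d" if d: "d \<in> A" for d
  proof -
    let ?k = "off_chart (fst d - N, snd d)"
    note k = off_restrict_in[OF d]
    have dM: "fst d \<subseteq> M" using cover d by blast
    have mem: "q \<in> fst ?a \<and> q \<in> fst d \<longleftrightarrow> Inl q \<in> fst c \<and> Inl q \<in> fst ?k" for q
      unfolding fa unfolding off_chart_simps fst_conv using dM by blast
    have kc: "\<exists>q. b = Inl q" if "b \<in> fst ?k" for b using that by (auto simp: off_chart_def)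
    have "half_compatible ?a d"
    proof (rule half_compatibleI[OF chart_a B.open_overlap[OF c k] _ B.smooth_transition[OF c k]])
      show "snd ?a ` (fst ?a \<inter> fst d) = snd c ` (fst c \<inter> fst ?k)"
      proof (intro subset_antisym subsetI)
        fix u assume "u \<in> snd ?a ` (fst ?a \<inter> fst d)"
        then obtain q where "q \<in> fst ?a" "q \<in> fst d" "u = snd c (Inl q)" by auto
        then show "u \<in> snd c ` (fst c \<inter> fst ?k)" using mem[of q] by blast
      next
        fix u assume "u \<in> snd c ` (fst c \<inter> fst ?k)"
        then obtain q where q: "Inl q \<in> fst c" "Inl q \<in> fst ?k" "u = snd c (Inl q)" using kc by blast
        then have "q \<in> fst ?a \<inter> fst d" "u = snd ?a q" using mem[of q] by auto
        then show "u \<in> snd ?a ` (fst ?a \<inter> fst d)" by blast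
      qed
      show "snd d q = transition c ?k (snd ?a q)" if q: "q \<in> fst ?a" "q \<in> fst d" for q
        using mem[of q] q B.trans_apply[OF c, of "Inl q" ?k] by simp
    qed
    moreover have "half_compatible d ?a"
    proof (rule half_compatibleI[OF chart[OF d] B.open_overlap[OF k c] _ B.smooth_transition[OF k c]])
      show "snd d ` (fst d \<inter> fst ?a) = snd ?k ` (fst ?k \<inter> fst c)"
      proof (intro subset_antisym subsetI)
        fix u assume "u \<in> snd d ` (fst d \<inter> fst ?a)"
        then obtain q where "q \<in> fst ?a" "q \<in> fst d" "u = snd ?k (Inl q)" by auto
        then show "u \<in> snd ?k ` (fst ?k \<inter> fst c)" using mem[of q] by blast
      next
        fix u assume "u \<in> snd ?k ` (fst ?k \<inter> fst c)"
        then obtain q where q: "Inl q \<in> fst c" "Inl q \<in> fst ?k" "u = snd ?k (Inl q)" using kc by blast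
        then have "q \<in> fst d \<inter> fst ?a" "u = snd d q" using mem[of q] by auto
        then show "u \<in> snd d ` (fst d \<inter> fst ?a)" by blast
      qed
      show "snd ?a q = transition ?k c (snd d q)" if q: "q \<in> fst d" "q \<in> fst ?a" for q
        using mem[of q] q B.trans_apply[OF k, of "Inl q" c] by simp
    qed
    ultimately show ?thesis unfolding compatible_half by blast
  qed
  moreover have "fst ?a \<subseteq> M" using fa by blast
  ultimately have "?a \<in> maximal_atlas M A" using chart_a by (auto simp: maximal_atlas_def)
  then show ?thesis using maximal by simp
qed

lemma chartwise_identity_blowdown: "chartwise_identity Bl BA M A blowdown (Bl - Exc)"
proof (intro chartwise_identity.intro chartwise_identity_axioms.intro smooth_map_blowdown openin_Bl_off)
  show "T = {}" if "openin (atlas_topology BA) T" "T \<subseteq> Bl - (Bl - Exc)" for T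
    by (rule Exc_thin[OF that(1)]) (use that(2) in blast)
  show "\<exists>a\<in>A. fst a = blowdown ` (fst c \<inter> (Bl - Exc)) \<and> (\<forall>b\<in>fst c \<inter> (Bl - Exc). snd a (blowdown b) = snd c b)"
    if c: "c \<in> BA" for c
    by (rule bexI[OF _ off_chart_transport[OF c]]) (auto simp: Bl_off)
  show "openin (atlas_topology A) (blowdown ` T)" if T: "openin (atlas_topology BA) T" "T \<subseteq> Bl - Exc" for T
    unfolding openin_iff
  proof (intro conjI ballI)
    show "blowdown ` T \<subseteq> M" using T(2) unfolding Bl_off by auto
    show "open (snd d ` (fst d \<inter> blowdown ` T))" if d: "d \<in> A" for d
      using B.open_image[OF T(1) off_restrict_in[OF d]] unfolding off_restrict_image[OF d T(2)] .
  qed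
qed

text \<open>As \<open>T\<close> is arbitrary, this is density in the divisor of the points with a
  frame around them. A frame of \<open>L\<close> near the image of \<open>b\<close> is composed with
  \<open>blow\<close>, pulled back by \<open>gen_pull\<close>, and then improved by
  division.\<close>

lemma exceptional_frame_dense:
  assumes D: "twisted_dirac A M H L" and T: "openin (atlas_topology BA) T" and b: "b \<in> T" "b \<in> Exc"
  shows "\<exists>b'\<in>T \<inter> Exc. \<exists>c O1 e. local_frame BA (pullback_dirac BA A blowdown L) Exc c O1 e \<and> b' \<in> fst c \<and> snd c b' \<in> O1"
proof -
  interpret P: smooth_map_between Bl BA M A blowdown by (rule smooth_map_blowdown)
  obtain c S i where c: "submanifold_chart A N c S" "i \<in> S" and bc: "b \<in> fst (bchart c S i)"
    using exc_point[OF b(2)] .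
  let ?g = "bchart c S i"
  note cA = sub_chart_in[OF c(1)] and gB = bchart_in[OF c]
  have L: "smooth_subbundle A M L" "\<And>q. q \<in> M \<Longrightarrow> maximally_isotropic A q (L q)"
    using D by (auto simp: twisted_dirac_def)
  have gen: "L q \<subseteq> gen_tangent_space A q" if "q \<in> fst d" "d \<in> A" for q d
    using L(1) cover that unfolding smooth_subbundle_def by blast
  let ?q0 = "blowdown b"
  have q0: "?q0 \<in> fst c" "snd c ?q0 = blow S i (snd ?g b)" by (rule bchart_point[OF c bc])+
  have q0M: "?q0 \<in> M" using q0(1) cA cover by blast
  obtain a0 O0 e0 where a0: "local_frame A L {} a0 O0 e0" "?q0 \<in> fst a0" "snd a0 ?q0 \<in> O0"
    by (rule dirac_local_frame[OF L q0M], assumption, rule that)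
  obtain O1 e where e: "local_frame A L {} c O1 e" "snd c ?q0 \<in> O1"
  proof (rule local_frame_in_chart[OF a0 cA q0(1)])
    show "L q \<subseteq> gen_tangent_space A q" if "q \<in> fst a0" for q
      by (rule gen[OF that local_frameD(1)[OF a0(1)]])
    fix O1 e assume "local_frame A L {} c O1 e" "snd c ?q0 \<in> O1"
    then show thesis by (rule that)
  qed
  note eD = local_frameD[OF e(1)]
  define S0 where "S0 = snd ?g ` (fst ?g \<inter> T) \<inter> blow S i -` O1"
  have S0: "open S0" unfolding S0_def
    by (intro open_Int B.open_image[OF T gB] open_vimage[OF eD(2) continuous_blow])
  have z0: "snd ?g b \<in> S0" using b bc e(2) unfolding S0_def q0(2) by blast
  have bz: "blow S i z \<in> snd c ` fst c" if "z \<in> S0" for z using that eD(3) unfolding S0_def by blast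
  have z0i: "snd ?g b $ i = 0"
    using blow_point(4)[OF c bz[OF z0]] b(2) unfolding bchart_point(3)[OF c bc] by blast
  let ?e = "\<lambda>k z. e k (blow S i z)"
  have e_smooth: "smooth_on S0 (?e k)" for k
    by (rule smooth_on_compose[OF S0 eD(2) _ eD(4) smooth_on_blow[OF S0 smooth_on_id[OF S0]]]) (auto simp: S0_def)
  let ?F = "\<lambda>k z. gen_pull S i z (?e k z)" and ?G = "\<lambda>k z. gen_dual S i z (?e k z)"
  let ?w = "\<lambda>z. cross_gram (\<lambda>k. ?e k z) (\<lambda>k. ?e k z)"
  \<comment> \<open>Each of the \<open>n\<close> rows contributes \<open>z\<^sub>i\<^sup>2\<close>,
    whence the exponent \<open>2 * CARD('n)\<close>. What remains is the ordinary Gram determinant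
    of a frame of \<open>L\<close>, which has no zeros over \<open>S0\<close>.\<close>
  have gram: "cross_gram (\<lambda>k. ?F k z) (\<lambda>k. ?G k z) = (z $ i) ^ (2 * CARD('n)) * ?w z" for z
  proof -
    have "(\<chi> k l. ?F k z \<bullet> ?G l z) = (\<chi> k. (z $ i)\<^sup>2 *s (\<chi> l. ?e k z \<bullet> ?e l z))"
      by (simp add: vec_eq_iff gen_pull_inner_gen_dual)
    then have "cross_gram (\<lambda>k. ?F k z) (\<lambda>k. ?G k z) = (\<Prod>k\<in>(UNIV :: 'n set). (z $ i)\<^sup>2) * ?w z"
      unfolding cross_gram_def by (simp only: det_rows_mul)
    then show ?thesis by (simp add: power_mult)
  qed
  have "\<exists>S' (F' :: 'n \<Rightarrow> real^'n \<Rightarrow> (real^'n) \<times> (real^'n)). open S' \<and> S' \<subseteq> S0 \<and> (\<exists>z\<in>S'. z $ i = 0) \<and> (\<forall>k. smooth_on S' (F' k)) \<and>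
           (\<forall>z\<in>S'. \<forall>k. F' k z \<noteq> 0) \<and> (\<forall>z\<in>S'. \<forall>k l. k \<noteq> l \<longrightarrow> F' k z \<bullet> F' l z = 0) \<and>
           (\<forall>z\<in>S'. z $ i \<noteq> 0 \<longrightarrow> span (range (\<lambda>k. F' k z)) = span (range (\<lambda>k. ?F k z)))"
    (is "\<exists>S' F'. ?P S' F'")
  \<comment> \<open>At the start no member is known to be nonzero on the divisor, hence
    \<open>J = {}\<close>.\<close>
  proof (rule exists_orthogonal_frame_near_hyperplane[OF S0 z0 z0i, where J = "{}" and w = ?w and G = ?G])
    show "smooth_on S0 (?F k)" for k by (rule smooth_on_gen_pull[OF S0 e_smooth])
    show "continuous_on S0 (?G k)" for k
      by (rule smooth_on_imp_continuous_on[OF smooth_on_gen_dual[OF S0 e_smooth]])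
    show "continuous_on S0 ?w"
      by (rule continuous_on_cross_gram) (rule smooth_on_imp_continuous_on[OF e_smooth])+
    show "?w z \<noteq> 0" if "z \<in> S0" for z
      by (rule cross_gram_nonzero; rule eD(5,6)) (use that in \<open>auto simp: S0_def\<close>)
  qed (use gram in auto)
  then obtain S' F' where P: "?P S' F'" by (elim exE)
  have S': "open S'" "S' \<subseteq> S0"
    using P by simp_all
  have ex: "\<exists>z\<in>S'. z $ i = 0" using P by (elim conjE)
  have F': "\<forall>k. smooth_on S' (F' k)" using P by (elim conjE)
  have nz: "F' k z \<noteq> 0" if "z \<in> S'" for k z using P that by (elim conjE) simp
  have orth: "F' k z \<bullet> F' l z = 0" if "z \<in> S'" "k \<noteq> l" for k l z using P that by (elim conjE) simp
  have sp: "span (range (\<lambda>k. F' k z)) = span (range (\<lambda>k. ?F k z))" if "z \<in> S'" "z $ i \<noteq> 0" for z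
    using P that by (elim conjE) simp
  have "local_frame BA (pullback_dirac BA A blowdown L) Exc ?g S' F'"
    unfolding local_frame_def
  proof (intro conjI ballI impI gB S'(1) F')
    show "S' \<subseteq> snd ?g ` fst ?g" using S'(2) unfolding S0_def by blast
    fix u assume u: "u \<in> S'"
    show inj: "inj (\<lambda>k. F' k u)"
    proof (rule injI, rule ccontr)
      fix k l assume "F' k u = F' l u" "k \<noteq> l"
      then show False using orth[OF u, of k l] nz[OF u, of l] by simp
    qed
    show "independent (range (\<lambda>k. F' k u))"
    proof (rule pairwise_orthogonal_independent)
      show "pairwise orthogonal (range (\<lambda>k. F' k u))"
        by (auto simp: pairwise_def orthogonal_def intro!: orth[OF u])
      show "0 \<notin> range (\<lambda>k. F' k u)" using nz[OF u] by force
    qed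
    assume off: "inv_chart ?g u \<notin> Exc"
    have uS0: "u \<in> S0" using u S'(2) by blast
    note bu = bz[OF uS0]
    let ?b = "inv_chart ?g u" and ?q = "blowdown (inv_chart ?g u)"
    have bp: "?b = blow_point c S i u" by (rule inv_bchart[OF c bu])
    have ui: "u $ i \<noteq> 0" using off blow_point(4)[OF c bu] unfolding bp by blast
    have b': "?b \<in> fst ?g" "snd ?g ?b = u" unfolding bp by (rule blow_point(1,2)[OF c bu])+
    have q: "?q \<in> fst c" "snd c ?q = blow S i u" by (rule inv_bchart_blowdown[OF c bu])+
    have mj: "P.mjac ?g c ?b = dblow S i u"
    proof -
      have "frechet_derivative (\<lambda>v. snd c (blowdown (inv_chart ?g v))) (at u) = frechet_derivative (blow S i) (at u)"
      proof (rule frechet_derivative_cong_open[OF B.open_domain[OF gB]])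
        show "u \<in> snd ?g ` fst ?g" using b' by (metis imageI)
        show "snd c (blowdown (inv_chart ?g v)) = blow S i v" if "v \<in> snd ?g ` fst ?g" for v
          by (rule inv_bchart_blowdown(2)[OF c]) (use that bchart_image[OF c] in blast)
      qed
      then show ?thesis
        unfolding P.mjac_def b'(2) using frechet_derivative_at[OF blow_has_derivative[of S i u]] by simp
    qed
    have "gen_coords A c ?q ` L ?q = span (range (\<lambda>k. ?e k u))"
      using eD(7)[of "blow S i u"] uS0 inv_apply[OF cA q(1)] unfolding q(2) by (simp add: S0_def)
    then have "gen_coords BA ?g ?b ` pullback_dirac BA A blowdown L ?b =
        {(w, \<chi> k. \<eta> \<bullet> dblow S i u (axis k 1)) | w \<eta>. (dblow S i u w, \<eta>) \<in> span (range (\<lambda>k. ?e k u))}"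
      unfolding P.pullback_dirac_coords[where L = L, OF gB b'(1) cA q(1) gen[OF q(1) cA]] mj by simp
    also have "\<dots> = gen_pull S i u ` span (range (\<lambda>k. ?e k u))"
      by (rule gen_pull_image[OF subspace_span ui])
    also have "\<dots> = span (range (\<lambda>k. ?F k u))"
      unfolding linear_span_image[OF linear_gen_pull, symmetric] image_image ..
    finally show "gen_coords BA ?g ?b ` pullback_dirac BA A blowdown L ?b = span (range (\<lambda>k. F' k u))"
      unfolding sp[OF u ui] .
  qed
  moreover obtain z where z: "z \<in> S'" "z $ i = 0" using ex by blast
  have zS0: "z \<in> S0" using z(1) S'(2) by blast
  obtain b' where b': "b' \<in> fst ?g" "b' \<in> T" "z = snd ?g b'" using zS0 unfolding S0_def by blast
  have "b' \<in> Exc"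
    using blow_point(4)[OF c bz[OF zS0]] z(2) bchart_point(3)[OF c b'(1)] b'(3) by simp
  ultimately show ?thesis using b' z(1) by blast
qed

end

theorem corollary5p6:
  fixes M N :: "'a set"
    and A :: "('a, 'n::finite) chart set"
    and H :: "('a, 'n) three_form"
    and L :: "'a \<Rightarrow> ('a, 'n) gvec set"
  defines "B \<equiv> blowup_atlas M A N"
    and "E \<equiv> exceptional_divisor A N"
  assumes "smooth_manifold M A"
    and "twisted_dirac A M H L"
    and "closed_embedded_submanifold A N"
  shows "\<exists>V L'. V \<subseteq> E \<and>
           openin (subtopology (atlas_topology B) E) V \<and>
           subtopology (atlas_topology B) E closure_of V = E \<and>
           twisted_dirac B (V \<union> (blowup_set M A N - E)) (pullback_three_form B A blowdown H) L' \<and>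
           (\<forall>b \<in> blowup_set M A N - E. L' b = pullback_dirac B A blowdown L b)"
proof -
  interpret closed_submanifold M A N
    using assms(3,5) by unfold_locales (auto simp: smooth_manifold_def)
  interpret B: chartwise_identity "blowup_set M A N" B M A blowdown "blowup_set M A N - E"
    unfolding B_def E_def by (rule chartwise_identity_blowdown)
  let ?H = "pullback_three_form B A blowdown H" and ?L = "pullback_dirac B A blowdown L"
  have "closed_three_form A M H" using assms(4) by (simp add: twisted_dirac_def)
  \<comment> \<open>The divisor plays the role of \<open>X\<close>. Off it the pullback is a Dirac
    structure, and the pulled back form is closed on the whole blowup.\<close>
  then interpret D: dirac_off "blowup_set M A N" B E ?H ?L
    using Exc_thin B.pullback_twisted_dirac[OF assms(4)] B.pullback_form_closed
    by unfold_locales (auto simp: B_def E_def)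
  let ?V = "D.regular_set \<inter> E"
  \<comment> \<open>Every point off the divisor is regular, so adding the complement to
    \<open>V\<close> recovers the whole set on which \<open>frame_limit\<close> is Dirac.\<close>
  have V: "?V \<union> (blowup_set M A N - E) = D.regular_set"
    using D.regular_superset D.regular_subset by blast
  have top: "topspace (subtopology (atlas_topology B) E) = E"
    using B.B.topspace_atlas Exc_sub by (auto simp: E_def)
  have "subtopology (atlas_topology B) E closure_of ?V = E"
  proof (intro subset_antisym subsetI)
    fix b assume b: "b \<in> E"
    show "b \<in> subtopology (atlas_topology B) E closure_of ?V"
      unfolding in_closure_of top
    proof (intro conjI b allI impI, elim conjE)
      fix T assume "b \<in> T" "openin (subtopology (atlas_topology B) E) T"
      then obtain T' where T': "openin (atlas_topology B) T'" "T = T' \<inter> E" "b \<in> T'"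
        unfolding openin_subtopology by blast
      obtain b' where "b' \<in> T' \<inter> E" "\<exists>c O1 e. local_frame B ?L E c O1 e \<and> b' \<in> fst c \<and> snd c b' \<in> O1"
        using exceptional_frame_dense[OF assms(4) T'(1,3)[unfolded B_def] b[unfolded E_def]]
        unfolding B_def E_def by blast
      then show "\<exists>y. y \<in> ?V \<and> y \<in> T" unfolding D.regular_set_def T'(2) by blast
    qed
  qed (use closure_of_subset_topspace[of "subtopology (atlas_topology B) E" ?V] top in blast)
  moreover have "openin (subtopology (atlas_topology B) E) ?V"
    unfolding openin_subtopology using D.openin_regular_set by blast
  moreover have "twisted_dirac B (?V \<union> (blowup_set M A N - E)) ?H D.frame_limit"
    unfolding V by (rule D.frame_limit_dirac)
  ultimately show ?thesis
    using D.frame_limit_eq by (intro exI[of _ ?V] exI[of _ D.frame_limit]) simp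
qed

end
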